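(* Let $\mathcal I$ be an inference family on a finite hypergraph $H=(V,F)$ and $F_{\mathrm B}$ its Bethe free energy on $L(\mathcal I)$, as in the context. At every point $\eta\in L(\mathcal I)$, with associated pseudomarginals $\{b_\alpha,b_i\}$, define for $\alpha\in F$ and distinct $i,j\in\alpha$ $$u^\alpha_{i\to j}=\mathrm{Var}_{b_j}(\phi_j)^{-1}\mathrm{Cov}_{b_\alpha}(\phi_j,\phi_i)\in\mathbb{R}^{r_j\times r_i}.$$ Then $$\det\big(I-\mathcal M(\mathbf u)\big)=\det\big(\nabla^2F_{\mathrm B}(\eta)\big)\prod_{\alpha\in F}\det\mathrm{Var}_{b_\alpha}(\Phi_\alpha)\prod_{i\in V}\det\mathrm{Var}_{b_i}(\phi_i)^{1-d_i},$$ where $\det(I-\mathcal M(\mathbf u))=\zeta_H(\mathbf u)^{-1}$ is the reciprocal of the graph zeta function with these weights, and $\nabla^2 F_{\mathrm B}$ is the Hessian in the coordinates $((\bar\eta_\alpha)_{\alpha\in F},(\eta_i)_{i\in V})$.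
   Context: Hypergraph $H=(V,F)$: finite $V$, finite collection $F$ of nonempty subsets; $d_i=|\{\alpha: i\in\alpha\}|$. Directed edges $\vec E=\{(\alpha\to i):i\in\alpha\}$, $s(\alpha\to i)=\alpha$, $t(\alpha\to i)=i$; $e'\rightharpoonup e$ means $t(e')\in s(e)$, $t(e')\ne t(e)$, $s(e')\ne s(e)$. For weights $u^\alpha_{i\to j}$, $\mathcal M(\mathbf u)$ is the linear operator on $\bigoplus_{e\in\vec E}\mathbb{C}^{r_{t(e)}}$ given by $(\mathcal M(\mathbf u)f)(e)=\sum_{e':e'\rightharpoonup e}u^{s(e)}_{t(e')\to t(e)}f(e')$. Inference family: for each $i\in V$, a measure space $(\mathcal X_i,\nu_i)$ and statistic $\phi_i:\mathcal X_i\to\mathbb{R}^{r_i}$ defining the exponential family $\mathcal E_i=\{\exp(\langle\theta,\phi_i\rangle-\psi_i(\theta))\}$, $\psi_i(\theta)=\log\int e^{\langle\theta,\phi_i\rangle}d\nu_i$, $\theta$ in the interior of the set where this is finite; for each $\alpha\in F$ an exponential family $\mathcal E_\alpha$ on $\mathcal X_\alpha=\prod_{i\in\alpha}\mathcal X_i$ (product measure) with statistic $\Phi_\alpha(x_\alpha)=(\bar\phi_\alpha(x_\alpha),(\phi_i(x_i))_{i\in\alpha})$ and log-partition $\psi_\alpha$. Assumptions: all covariance matrices of the sufficient statistics under members of these families are positive definite, and the $x_i$-marginal of every member of $\mathcal E_\alpha$ lies in $\mathcal E_i$. Expectation parameters $\eta=\mathbb{E}[\text{statistic}]$ range over the open sets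 $Y_i,Y_\alpha$ (images of the moment maps); $\varphi_i,\varphi_\alpha$ denote the Legendre transforms $\varphi(\eta)=\sup_\theta(\langle\theta,\eta\rangle-\psi(\theta))$. $L(\mathcal I)$ is the set of $\{\eta^\alpha=(\bar\eta_\alpha,(\eta^\alpha_i)_{i\in\alpha})\in Y_\alpha,\ \eta_i\in Y_i\}$ with $\eta^\alpha_i=\eta_i$ for all $i\in\alpha$; the pseudomarginals $b_\alpha\in\mathcal E_\alpha$, $b_i\in\mathcal E_i$ are the members with these expectation parameters. Given constant vectors $\bar\theta_\alpha$, the Bethe free energy is $F_{\mathrm B}(\eta)=-\sum_\alpha\langle\bar\theta_\alpha,\eta^\alpha\rangle+\sum_\alpha\varphi_\alpha(\eta^\alpha)+\sum_i(1-d_i)\varphi_i(\eta_i)$. *)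

theory Defs
  imports "HOL-Probability.Probability"
begin

section \<open>Vectors and matrices indexed by a finite set\<close>

text \<open>The dimensions vary with the vertex and the hyperedge, so a vector is a function
  \<open>'k \<Rightarrow> 'a\<close> and a matrix a function \<open>'k \<Rightarrow> 'k \<Rightarrow> 'a\<close>, both read on an explicit finite index
  set \<open>K\<close>; values outside \<open>K\<close> are irrelevant.\<close>

definition dot :: "'k set \<Rightarrow> ('k \<Rightarrow> real) \<Rightarrow> ('k \<Rightarrow> real) \<Rightarrow> real" where
  "dot K a b = (\<Sum>k\<in>K. a k * b k)"

text \<open>The formula defining \<^const>\<open>Determinants.det\<close>, with \<open>K\<close> in place of the index type.\<close>

definition fdet :: "'k set \<Rightarrow> ('k \<Rightarrow> 'k \<Rightarrow> 'a::comm_ring_1) \<Rightarrow> 'a" where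
  "fdet K A = (\<Sum>p | p permutes K. of_int (sign p) * (\<Prod>k\<in>K. A k (p k)))"

text \<open>As \<^const>\<open>matrix_inv\<close>.\<close>

definition fmat_inv :: "'k set \<Rightarrow> ('k \<Rightarrow> 'k \<Rightarrow> real) \<Rightarrow> 'k \<Rightarrow> 'k \<Rightarrow> real" where
  "fmat_inv K A = (SOME B. \<forall>k\<in>K. \<forall>l\<in>K.
      (\<Sum>m\<in>K. A k m * B m l) = (if k = l then 1 else 0) \<and>
      (\<Sum>m\<in>K. B k m * A m l) = (if k = l then 1 else 0))"

definition pos_def :: "'k set \<Rightarrow> ('k \<Rightarrow> 'k \<Rightarrow> real) \<Rightarrow> bool" where
  "pos_def K A \<longleftrightarrow>
     (\<forall>k\<in>K. \<forall>l\<in>K. A k l = A l k) \<and>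
     (\<forall>v. (\<exists>k\<in>K. v k \<noteq> 0) \<longrightarrow> (\<Sum>k\<in>K. \<Sum>l\<in>K. v k * A k l * v l) > 0)"

text \<open>Determinant of a linear operator on \<open>\<complex>\<^sup>K\<close>, through its matrix in the standard basis.\<close>

definition op_det :: "'k set \<Rightarrow> (('k \<Rightarrow> complex) \<Rightarrow> ('k \<Rightarrow> complex)) \<Rightarrow> complex" where
  "op_det K L = fdet K (\<lambda>k l. L (\<lambda>m. if m = l then 1 else 0) k)"

definition partial :: "'k \<Rightarrow> (('k \<Rightarrow> real) \<Rightarrow> real) \<Rightarrow> ('k \<Rightarrow> real) \<Rightarrow> real" where
  "partial c f x = deriv (\<lambda>t. f (x(c := t))) (x c)"

definition hessian :: "(('k \<Rightarrow> real) \<Rightarrow> real) \<Rightarrow> ('k \<Rightarrow> real) \<Rightarrow> 'k \<Rightarrow> 'k \<Rightarrow> real" where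
  "hessian f x c d = partial c (partial d f) x"


section \<open>Exponential families\<close>

record ('x, 'k) exp_family =
  base :: "'x measure"
  index :: "'k set"
  stat :: "'x \<Rightarrow> 'k \<Rightarrow> real"

definition partition_fun :: "('x, 'k) exp_family \<Rightarrow> ('k \<Rightarrow> real) \<Rightarrow> real" where
  "partition_fun E \<theta> = (\<integral>x. exp (dot (index E) \<theta> (stat E x)) \<partial>base E)"

definition log_partition :: "('x, 'k) exp_family \<Rightarrow> ('k \<Rightarrow> real) \<Rightarrow> real" where
  "log_partition E \<theta> = ln (partition_fun E \<theta>)"

text \<open>The logarithm of the integral is finite iff the integral lies in \<open>(0, \<infinity>)\<close>; the interior
  is taken in \<open>\<real>\<^sup>K\<close> for \<open>K = index E\<close>.\<close>

definition params :: "('x, 'k) exp_family \<Rightarrow> ('k \<Rightarrow> real) set" where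
  "params E = powertop_real (index E) interior_of
     {\<theta>. integrable (base E) (\<lambda>x. exp (dot (index E) \<theta> (stat E x))) \<and> 0 < partition_fun E \<theta>}"

definition member :: "('x, 'k) exp_family \<Rightarrow> ('k \<Rightarrow> real) \<Rightarrow> 'x measure" where
  "member E \<theta> = density (base E)
     (\<lambda>x. ennreal (exp (dot (index E) \<theta> (stat E x) - log_partition E \<theta>)))"

definition members :: "('x, 'k) exp_family \<Rightarrow> 'x measure set" where
  "members E = member E ` params E"

definition mean_vec :: "('x, 'k) exp_family \<Rightarrow> 'x measure \<Rightarrow> 'k \<Rightarrow> real" where
  "mean_vec E b = (\<lambda>k\<in>index E. \<integral>x. stat E x k \<partial>b)"

definition mean_params :: "('x, 'k) exp_family \<Rightarrow> ('k \<Rightarrow> real) set" where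
  "mean_params E = mean_vec E ` members E"

definition Cov :: "'x measure \<Rightarrow> ('x \<Rightarrow> real) \<Rightarrow> ('x \<Rightarrow> real) \<Rightarrow> real" where
  "Cov b f g = (\<integral>x. (f x - (\<integral>y. f y \<partial>b)) * (g x - (\<integral>y. g y \<partial>b)) \<partial>b)"

definition Var :: "('x, 'k) exp_family \<Rightarrow> 'x measure \<Rightarrow> 'k \<Rightarrow> 'k \<Rightarrow> real" where
  "Var E b k l = Cov b (\<lambda>x. stat E x k) (\<lambda>x. stat E x l)"

definition legendre :: "('x, 'k) exp_family \<Rightarrow> ('k \<Rightarrow> real) \<Rightarrow> real" where
  "legendre E \<eta> = (SUP \<theta>\<in>params E. dot (index E) \<theta> \<eta> - log_partition E \<theta>)"

definition regular_exp_family :: "('x, 'k) exp_family \<Rightarrow> bool" where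
  "regular_exp_family E \<longleftrightarrow>
     finite (index E) \<and>
     (\<forall>k\<in>index E. (\<lambda>x. stat E x k) \<in> borel_measurable (base E)) \<and>
     (\<forall>b\<in>members E. pos_def (index E) (Var E b))"


section \<open>Hypergraphs\<close>

definition hypergraph :: "'v set \<Rightarrow> 'v set set \<Rightarrow> bool" where
  "hypergraph V F \<longleftrightarrow> finite V \<and> F \<subseteq> Pow V \<and> {} \<notin> F"

definition deg :: "'v set set \<Rightarrow> 'v \<Rightarrow> nat" where
  "deg F i = card {\<alpha>\<in>F. i \<in> \<alpha>}"

text \<open>The directed edge \<open>\<alpha> \<rightarrow> i\<close> is the pair \<open>(\<alpha>, i)\<close>.\<close>

type_synonym 'v dedge = "'v set \<times> 'v"

abbreviation src :: "'v dedge \<Rightarrow> 'v set" where "src \<equiv> fst"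
abbreviation tgt :: "'v dedge \<Rightarrow> 'v" where "tgt \<equiv> snd"

definition dedges :: "'v set set \<Rightarrow> 'v dedge set" where
  "dedges F = {e. src e \<in> F \<and> tgt e \<in> src e}"

definition follows :: "'v dedge \<Rightarrow> 'v dedge \<Rightarrow> bool"  (infix "\<rightharpoonup>" 50) where
  "e' \<rightharpoonup> e \<longleftrightarrow> tgt e' \<in> src e \<and> tgt e' \<noteq> tgt e \<and> src e' \<noteq> src e"

text \<open>An element of the direct sum over \<open>e\<close> of \<open>\<complex>\<close> to the power \<open>r (tgt e)\<close> is a function on
  \<open>dedge_index F r\<close>.  The \<open>(k, l)\<close> entry of the weight matrix with upper index \<open>\<alpha>\<close> and lower
  index \<open>i \<rightarrow> j\<close> is \<open>u \<alpha> i j k l\<close>, for \<open>k < r j\<close> and \<open>l < r i\<close>.\<close>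

definition dedge_index :: "'v set set \<Rightarrow> ('v \<Rightarrow> nat) \<Rightarrow> ('v dedge \<times> nat) set" where
  "dedge_index F r = (SIGMA e:dedges F. {..<r (tgt e)})"

definition \<M> :: "'v set set \<Rightarrow> ('v \<Rightarrow> nat) \<Rightarrow>
    ('v set \<Rightarrow> 'v \<Rightarrow> 'v \<Rightarrow> nat \<Rightarrow> nat \<Rightarrow> complex) \<Rightarrow>
    ('v dedge \<times> nat \<Rightarrow> complex) \<Rightarrow> ('v dedge \<times> nat \<Rightarrow> complex)" where
  "\<M> F r u f = (\<lambda>(e, k). \<Sum>e' | e' \<in> dedges F \<and> e' \<rightharpoonup> e.
      \<Sum>l<r (tgt e'). u (src e) (tgt e') (tgt e) k l * f (e', l))"


section \<open>Inference families and the Bethe free energy\<close>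

text \<open>Components of the statistic of a hyperedge: \<open>Extra k\<close> is the \<open>k\<close>-th component of its own
  statistic, \<open>Vtx i k\<close> the \<open>k\<close>-th component of the statistic of its vertex \<open>i\<close>.\<close>

datatype 'v hindex = Extra nat | Vtx 'v nat

record ('v, 'x) inference_data =
  verts :: "'v set"
  hedges :: "'v set set"
  vmeasure :: "'v \<Rightarrow> 'x measure"
  vdim :: "'v \<Rightarrow> nat"
  vstat :: "'v \<Rightarrow> 'x \<Rightarrow> nat \<Rightarrow> real"
  hdim :: "'v set \<Rightarrow> nat"
  hstat :: "'v set \<Rightarrow> ('v \<Rightarrow> 'x) \<Rightarrow> nat \<Rightarrow> real"

definition vfam :: "('v, 'x) inference_data \<Rightarrow> 'v \<Rightarrow> ('x, nat) exp_family" where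
  "vfam D i = \<lparr>base = vmeasure D i, index = {..<vdim D i}, stat = vstat D i\<rparr>"

text \<open>\<open>hdim D \<alpha>\<close> and \<open>hstat D \<alpha>\<close> are the dimension and the values of the additional statistic of
  \<open>\<alpha>\<close> only; the full statistic of \<open>\<alpha>\<close> is the \<open>stat\<close> component below.\<close>

definition hfam :: "('v, 'x) inference_data \<Rightarrow> 'v set \<Rightarrow> ('v \<Rightarrow> 'x, 'v hindex) exp_family" where
  "hfam D \<alpha> =
    \<lparr>base = PiM \<alpha> (vmeasure D),
     index = Extra ` {..<hdim D \<alpha>} \<union> {Vtx i k | i k. i \<in> \<alpha> \<and> k < vdim D i},
     stat = (\<lambda>x j. case j of Extra k \<Rightarrow> hstat D \<alpha> x k | Vtx i k \<Rightarrow> vstat D i (x i) k)\<rparr>"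

definition inference_family :: "('v, 'x) inference_data \<Rightarrow> bool" where
  "inference_family D \<longleftrightarrow>
     hypergraph (verts D) (hedges D) \<and>
     (\<forall>i\<in>verts D. regular_exp_family (vfam D i)) \<and>
     (\<forall>\<alpha>\<in>hedges D. regular_exp_family (hfam D \<alpha>)) \<and>
     (\<forall>\<alpha>\<in>hedges D. \<forall>b\<in>members (hfam D \<alpha>). \<forall>i\<in>\<alpha>.
        distr b (vmeasure D i) (\<lambda>x. x i) \<in> members (vfam D i))"

type_synonym 'v lparam = "('v set \<Rightarrow> 'v hindex \<Rightarrow> real) \<times> ('v \<Rightarrow> nat \<Rightarrow> real)"

definition local_params :: "('v, 'x) inference_data \<Rightarrow> 'v lparam set" where
  "local_params D = {(\<eta>F, \<eta>V).
     \<eta>F \<in> (\<Pi>\<^sub>E \<alpha>\<in>hedges D. mean_params (hfam D \<alpha>)) \<and>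
     \<eta>V \<in> (\<Pi>\<^sub>E i\<in>verts D. mean_params (vfam D i)) \<and>
     (\<forall>\<alpha>\<in>hedges D. \<forall>i\<in>\<alpha>. \<forall>k<vdim D i. \<eta>F \<alpha> (Vtx i k) = \<eta>V i k)}"

definition pseudomarginals :: "('v, 'x) inference_data \<Rightarrow> 'v lparam \<Rightarrow>
    ('v set \<Rightarrow> ('v \<Rightarrow> 'x) measure) \<Rightarrow> ('v \<Rightarrow> 'x measure) \<Rightarrow> bool" where
  "pseudomarginals D \<eta> bF bV \<longleftrightarrow>
     (\<forall>\<alpha>\<in>hedges D. bF \<alpha> \<in> members (hfam D \<alpha>) \<and> mean_vec (hfam D \<alpha>) (bF \<alpha>) = fst \<eta> \<alpha>) \<and>
     (\<forall>i\<in>verts D. bV i \<in> members (vfam D i) \<and> mean_vec (vfam D i) (bV i) = snd \<eta> i)"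

definition bethe :: "('v, 'x) inference_data \<Rightarrow> ('v set \<Rightarrow> 'v hindex \<Rightarrow> real) \<Rightarrow>
    'v lparam \<Rightarrow> real" where
  "bethe D \<theta> \<eta> =
     - (\<Sum>\<alpha>\<in>hedges D. dot (index (hfam D \<alpha>)) (\<theta> \<alpha>) (fst \<eta> \<alpha>))
     + (\<Sum>\<alpha>\<in>hedges D. legendre (hfam D \<alpha>) (fst \<eta> \<alpha>))
     + (\<Sum>i\<in>verts D. (1 - real (deg (hedges D) i)) * legendre (vfam D i) (snd \<eta> i))"

text \<open>The coordinates on \<open>local_params D\<close>: the additional components for every hyperedge and the
  components for every vertex.\<close>

datatype 'v coord = HCoord "'v set" nat | VCoord 'v nat

definition coord_index :: "('v, 'x) inference_data \<Rightarrow> 'v coord set" where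
  "coord_index D =
     {HCoord \<alpha> k | \<alpha> k. \<alpha> \<in> hedges D \<and> k < hdim D \<alpha>} \<union>
     {VCoord i k | i k. i \<in> verts D \<and> k < vdim D i}"

definition to_coords :: "'v lparam \<Rightarrow> 'v coord \<Rightarrow> real" where
  "to_coords \<eta> c = (case c of HCoord \<alpha> k \<Rightarrow> fst \<eta> \<alpha> (Extra k) | VCoord i k \<Rightarrow> snd \<eta> i k)"

definition of_coords :: "('v, 'x) inference_data \<Rightarrow> ('v coord \<Rightarrow> real) \<Rightarrow> 'v lparam" where
  "of_coords D x =
    ((\<lambda>\<alpha>\<in>hedges D. \<lambda>j\<in>index (hfam D \<alpha>).
        case j of Extra k \<Rightarrow> x (HCoord \<alpha> k) | Vtx i k \<Rightarrow> x (VCoord i k)),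
     (\<lambda>i\<in>verts D. \<lambda>k\<in>{..<vdim D i}. x (VCoord i k)))"

lemma of_coords_to_coords:
  assumes "inference_family D" "\<eta> \<in> local_params D"
  shows "of_coords D (to_coords \<eta>) = \<eta>"
proof -
  obtain f g where \<eta>: "\<eta> = (f, g)" by fastforce
  have f: "f \<in> (\<Pi>\<^sub>E \<alpha>\<in>hedges D. mean_params (hfam D \<alpha>))"
    and g: "g \<in> (\<Pi>\<^sub>E i\<in>verts D. mean_params (vfam D i))"
    and c: "\<And>\<alpha> i k. \<alpha> \<in> hedges D \<Longrightarrow> i \<in> \<alpha> \<Longrightarrow> k < vdim D i \<Longrightarrow> f \<alpha> (Vtx i k) = g i k"
    using assms(2) by (auto simp: \<eta> local_params_def)
  have fe: "f \<alpha> \<in> extensional (index (hfam D \<alpha>))" if "\<alpha> \<in> hedges D" for \<alpha>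
    using PiE_mem[OF f that] by (auto simp: mean_params_def mean_vec_def)
  have ge: "g i \<in> extensional {..<vdim D i}" if "i \<in> verts D" for i
    using PiE_mem[OF g that] by (auto simp: mean_params_def mean_vec_def vfam_def)
  have "fst (of_coords D (to_coords \<eta>)) \<alpha> j = f \<alpha> j" for \<alpha> j
    using PiE_arb[OF f, of \<alpha>] fe[of \<alpha>] c[of \<alpha>]
    by (cases "\<alpha> \<in> hedges D"; cases "j \<in> index (hfam D \<alpha>)")
       (auto simp: of_coords_def to_coords_def \<eta> hfam_def extensional_def split: hindex.splits)
  moreover have "snd (of_coords D (to_coords \<eta>)) i k = g i k" for i k
    using PiE_arb[OF g, of i] ge[of i]
    by (cases "i \<in> verts D"; cases "k < vdim D i")
       (auto simp: of_coords_def to_coords_def \<eta> extensional_def)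
  ultimately show ?thesis
    by (intro prod_eqI ext) (auto simp: \<eta>)
qed

definition bethe_weight :: "('v, 'x) inference_data \<Rightarrow>
    ('v set \<Rightarrow> ('v \<Rightarrow> 'x) measure) \<Rightarrow> ('v \<Rightarrow> 'x measure) \<Rightarrow>
    'v set \<Rightarrow> 'v \<Rightarrow> 'v \<Rightarrow> nat \<Rightarrow> nat \<Rightarrow> real" where
  "bethe_weight D bF bV \<alpha> i j k l =
     (\<Sum>m<vdim D j. fmat_inv {..<vdim D j} (Var (vfam D j) (bV j)) k m *
        Cov (bF \<alpha>) (\<lambda>x. vstat D j (x j) m) (\<lambda>x. vstat D i (x i) l))"

end

theory Submission
  imports "Jordan_Normal_Form.Determinant" Defs
begin

text \<open>The gradient of \<open>\<phi>\<close> is the inverse of the moment map \<open>\<eta> = \<nabla>\<psi>(\<theta>)\<close>, whose derivative is the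
  covariance matrix; hence the Hessian of \<open>\<phi>\<close> is the inverse covariance and the Hessian of the Bethe
  free energy is \<open>H = Q\<^sup>T S\<^sup>-\<^sup>1 Q + (1 - d) R\<^sup>-\<^sup>1\<close>.  Here \<open>S\<close> is block diagonal with the covariances of
  the hyperedges, \<open>R\<close> is block diagonal with those of the vertices (and the identity on the
  additional statistics, which are treated like vertices of degree 1), \<open>Q\<close> sends a component of a
  hyperedge statistic to its coordinate and \<open>d\<close> is the degree.  If \<open>T\<close> carries a copy of the vertex
  covariances on every hyperedge, then \<open>I - \<M>\<close> is
  \<open>I - (T\<^sup>-\<^sup>1 S - I) (Q Q\<^sup>T - I) = T\<^sup>-\<^sup>1 (S - (S - T) Q Q\<^sup>T)\<close>, and since \<open>T Q = Q R\<close> Sylvester's identity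
  \<open>det (I - X Y) = det (I - Y X)\<close> turns its determinant into that of \<open>H\<close>.\<close>

section \<open>Determinants over a finite index set\<close>

text \<open>The sizes of the index sets vary with the vertex and the hyperedge, so the analysis is
  done coordinate by coordinate with explicit error bounds. Tilting a density by an exponential
  turns every quantity at a nearby parameter into an expectation under one fixed member, which gives
  the moment map up to a quadratic error. Its local surjectivity comes from minimising a convex
  function over a compact box; the expansion is then inverted by linear algebra. In the algebra,
  \<open>S\<close> must contain the covariances with the additional statistics, so these stay in the
  edge matrix until the end, where they form an identity block of a triangular matrix. The
  hypothesis on marginals makes the vertex blocks of \<open>S\<close> and \<open>T\<close> agree, so
  \<open>T^-1 S - I\<close> has no entry between components of one vertex; this matches the
  condition that consecutive directed edges have different targets. The exponents
  \<open>1 - d_i\<close> arise as a quotient: \<open>det R\<close> has one factor per vertex,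
  \<open>det T\<close> one per incidence.\<close>

lemma fdet_cong:
  assumes "K = K'" "\<And>k l. k \<in> K \<Longrightarrow> l \<in> K \<Longrightarrow> A k l = B k l"
  shows "fdet K A = fdet K' B"
  unfolding fdet_def assms(1)[symmetric]
  by (intro sum.cong prod.cong refl arg_cong2[where f = "(*)"] assms(2))
     (auto simp: permutes_in_image)

lemma fdet_empty [simp]: "fdet {} A = 1"
  by (simp add: fdet_def)

lemma fdet_of_real: "fdet K (\<lambda>k l. complex_of_real (A k l)) = complex_of_real (fdet K A)"
  by (simp add: fdet_def)

text \<open>Conjugation by \<open>h\<close> is a bijection between the permutations of
  \<open>K\<close> and those of its image, and it preserves signs. With an enumeration as
  \<open>h\<close>, this transports determinant theory from \<open>{0..<n}\<close> to any finite
  index set.\<close>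

lemma fdet_image:
  assumes "finite K" "inj_on h K"
  shows "fdet (h ` K) A = fdet K (\<lambda>k l. A (h k) (h l))"
proof -
  have bij: "bij_betw (map_permutation K h) {p. p permutes K} {p. p permutes (h ` K)}"
  proof -
    have b: "bij_betw h K (h ` K)"
      using assms(2) by (simp add: bij_betw_def)
    have "bij_betw (map_permutation K h) {p. p permutes K} {p. p permutes (h ` K)} \<longleftrightarrow>
       bij_betw (\<lambda>p x. if x \<in> h ` K then h (p (inv_into K h x)) else x)
         {p. p permutes K} {p. p permutes (h ` K)}"
      by (rule bij_betw_cong) (auto simp: map_permutation_def restrict_id_def fun_eq_iff)
    then show ?thesis
      using bij_betw_permutations[OF b] by simp
  qed
  have "fdet (h ` K) A = (\<Sum>p | p permutes K.
      of_int (sign (map_permutation K h p)) * (\<Prod>k\<in>h ` K. A k (map_permutation K h p k)))"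
    unfolding fdet_def by (rule sum.reindex_bij_betw[OF bij, symmetric])
  also have "\<dots> = (\<Sum>p | p permutes K. of_int (sign p) * (\<Prod>k\<in>K. A (h k) (h (p k))))"
    using assms
    by (intro sum.cong refl) (simp add: sign_map_permutation prod.reindex map_permutation_apply)
  finally show ?thesis
    by (simp add: fdet_def)
qed

lemma fdet_eq_det: "fdet {0..<n} A = Determinant.det (Matrix.mat n n (\<lambda>(i, j). A i j))"
proof -
  have "(\<Prod>i = 0..<n. Matrix.mat n n (\<lambda>(i, j). A i j) $$ (i, p i)) = (\<Prod>i = 0..<n. A i (p i))"
    if "p permutes {0..<n}" for p
    using permutes_in_image[OF that] by (intro prod.cong) auto
  then show ?thesis
    by (simp add: fdet_def Determinant.det_def)
qed

lemma fdet_matmul: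
  assumes "finite K"
  shows "fdet K (\<lambda>k l. \<Sum>m\<in>K. A k m * B m l) = fdet K A * fdet K B"
proof -
  obtain h where h: "bij_betw h {0..<card K} K"
    using ex_bij_betw_nat_finite[OF assms] by blast
  then have K: "K = h ` {0..<card K}" and i: "inj_on h {0..<card K}"
    by (auto simp: bij_betw_def)
  let ?n = "card K"
  let ?m = "\<lambda>A. Matrix.mat ?n ?n (\<lambda>(i, j). A (h i) (h j))"
  have r: "fdet K A = Determinant.det (?m A)" for A :: "'a \<Rightarrow> 'a \<Rightarrow> 'b"
    using fdet_image[OF _ i, of A] by (simp add: K[symmetric] fdet_eq_det)
  have eq: "?m (\<lambda>k l. \<Sum>m\<in>K. A k m * B m l) = ?m A * ?m B"
    by (rule eq_matI)
       (auto simp: scalar_prod_def sum.reindex_bij_betw[OF h, symmetric])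
  then show ?thesis
    unfolding r eq by (intro det_mult[of _ ?n]) auto
qed

lemma fdet_block_lower:
  fixes A :: "'k \<Rightarrow> 'k \<Rightarrow> 'a::idom"
  assumes "finite K" "finite L" "K \<inter> L = {}"
    and "\<And>k l. k \<in> K \<Longrightarrow> l \<in> L \<Longrightarrow> A k l = 0"
  shows "fdet (K \<union> L) A = fdet K A * fdet L A"
proof -
  define n m where "n = card K" and "m = card L"
  obtain f where f: "bij_betw f {0..<n} K"
    using ex_bij_betw_nat_finite[OF assms(1)] unfolding n_def by blast
  obtain g where g: "bij_betw g {0..<m} L"
    using ex_bij_betw_nat_finite[OF assms(2)] unfolding m_def by blast
  \<comment> \<open>\<open>h\<close> lists \<open>K\<close> first and \<open>L\<close> after it, so
    that the zero entries form the upper right block.\<close>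
  define h where "h i = (if i < n then f i else g (i - n))" for i
  have hK: "h ` {0..<n} = K"
    using f by (auto simp: bij_betw_def h_def)
  have hL: "h ` {n..<n + m} = L"
  proof -
    have "h ` {n..<n + m} = (\<lambda>i. g (i - n)) ` {n..<n + m}"
      by (auto simp: h_def)
    also have "\<dots> = g ` ((\<lambda>i. i - n) ` {n..<n + m})"
      by (simp add: image_image)
    also have "(\<lambda>i. i - n) ` {n..<n + m} = {0..<m}"
      by (force intro: image_eqI[where x = "n + _"])
    finally show ?thesis
      using g by (auto simp: bij_betw_def)
  qed
  have U: "K \<union> L = h ` {0..<n + m}"
    unfolding hK[symmetric] hL[symmetric] image_Un[symmetric]
    by (simp add: ivl_disj_un)
  \<comment> \<open>\<open>h\<close> is injective by counting: its image has as many elements as its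
    domain.\<close>
  have "card (K \<union> L) = n + m"
    using assms(1-3) by (simp add: n_def m_def card_Un_disjoint)
  then have inj: "inj_on h {0..<n + m}"
    by (intro eq_card_imp_inj_on) (simp_all add: U[symmetric])
  define B where "B i j = A (h i) (h j)" for i j
  have KB: "fdet K A = fdet {0..<n} B"
    unfolding B_def hK[symmetric]
    using inj_on_subset[OF inj, of "{0..<n}"] hK by (subst fdet_image) auto
  have LB: "fdet L A = fdet {0..<m} (\<lambda>i j. B (i + n) (j + n))"
  proof -
    have "(\<lambda>i. i + n) ` {0..<m} = {n..<n + m}"
      by (simp add: add.commute)
    then have "fdet {n..<n + m} B = fdet {0..<m} (\<lambda>i j. B (i + n) (j + n))"
      by (metis fdet_image finite_atLeastLessThan inj_on_add')
    moreover have "fdet L A = fdet {n..<n + m} B"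
      unfolding B_def hL[symmetric]
      using inj_on_subset[OF inj, of "{n..<n + m}"] hL by (subst fdet_image) auto
    ultimately show ?thesis by simp
  qed
  let ?P = "Matrix.mat n n (\<lambda>(i, j). B i j)"
  let ?Q = "Matrix.mat m n (\<lambda>(i, j). B (i + n) j)"
  let ?R = "Matrix.mat m m (\<lambda>(i, j). B (i + n) (j + n))"
  have "fdet (K \<union> L) A = Determinant.det (Matrix.mat (n + m) (n + m) (\<lambda>(i, j). B i j))"
    unfolding U by (simp add: fdet_image[OF _ inj] fdet_eq_det B_def)
  also have "Matrix.mat (n + m) (n + m) (\<lambda>(i, j). B i j) = four_block_mat ?P (0\<^sub>m n m) ?Q ?R"
  proof (rule eq_matI, goal_cases)
    case (1 i j)
    have "B i j = 0" if "i < n" "\<not> j < n" "j < n + m"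
      unfolding B_def using that hK hL by (intro assms(4)) fastforce+
    with 1 show ?case by auto
  qed auto
  also have "Determinant.det \<dots> = Determinant.det ?P * Determinant.det ?R"
    by (rule det_four_block_mat_upper_right_zero[of _ _ _ m]) auto
  finally show ?thesis
    by (simp add: KB LB fdet_eq_det)
qed

lemma fdet_identity:
  fixes A :: "'k \<Rightarrow> 'k \<Rightarrow> 'a::comm_ring_1"
  assumes "finite K" "\<And>k l. k \<in> K \<Longrightarrow> l \<in> K \<Longrightarrow> A k l = (if k = l then 1 else 0)"
  shows "fdet K A = 1"
proof -
  obtain h where h: "bij_betw h {0..<card K} K"
    using ex_bij_betw_nat_finite[OF assms(1)] by blast
  then have K: "K = h ` {0..<card K}" and i: "inj_on h {0..<card K}"
    by (auto simp: bij_betw_def)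
  have "fdet K A = fdet {0..<card K} (\<lambda>k l. A (h k) (h l))"
    using fdet_image[OF _ i, of A] by (simp add: K[symmetric])
  also have "\<dots> = Determinant.det (Matrix.mat (card K) (card K) (\<lambda>(i, j). A (h i) (h j)))"
    by (rule fdet_eq_det)
  also have "Matrix.mat (card K) (card K) (\<lambda>(i, j). A (h i) (h j)) = 1\<^sub>m (card K)"
    using bij_betwE[OF h] by (intro eq_matI) (auto simp: assms(2) inj_on_eq_iff[OF i])
  finally show ?thesis by simp
qed

text \<open>One label class is split off at a time, since the entries between it and the rest
  vanish. Labels in \<open>L\<close> that no index carries contribute the empty determinant
  1.\<close>

lemma fdet_block_diagonal:
  fixes A :: "'k \<Rightarrow> 'k \<Rightarrow> 'a::idom"
  assumes "finite L" "finite K" "lbl ` K \<subseteq> L"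
    and "\<And>k l. k \<in> K \<Longrightarrow> l \<in> K \<Longrightarrow> lbl k \<noteq> lbl l \<Longrightarrow> A k l = 0"
  shows "fdet K A = (\<Prod>x\<in>L. fdet {k \<in> K. lbl k = x} A)"
  using assms
proof (induction L arbitrary: K rule: finite_induct)
  case empty
  then show ?case by auto
next
  case (insert x L)
  let ?K = "{k \<in> K. lbl k = x}" and ?K' = "{k \<in> K. lbl k \<noteq> x}"
  have "fdet (?K \<union> ?K') A = fdet ?K A * fdet ?K' A"
    by (rule fdet_block_lower) (use insert.prems in auto)
  also have "?K \<union> ?K' = K" by auto
  also have "fdet ?K' A = (\<Prod>y\<in>L. fdet {k \<in> ?K'. lbl k = y} A)"
    by (rule insert.IH) (use insert.prems in auto)
  also have "\<dots> = (\<Prod>y\<in>L. fdet {k \<in> K. lbl k = y} A)"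
    using insert.hyps by (intro prod.cong refl arg_cong2[where f = fdet]) auto
  finally show ?case
    using insert.hyps by simp
qed

lemma mult_indicator:
  fixes r :: "'r::semiring_1"
  shows "(if P then 1 else 0) * r = (if P then r else 0)"
    and "r * (if P then 1 else 0) = (if P then r else 0)"
  by auto

text \<open>Sylvester's identity: both sides are the determinant of
  \<open>[[1, X], [Y, 1]]\<close>, eliminated in two ways.\<close>

lemma fdet_sylvester:
  fixes X :: "'a \<Rightarrow> 'c \<Rightarrow> 'r::idom"
  assumes "finite A" "finite C"
  shows "fdet A (\<lambda>a b. (if a = b then 1 else 0) - (\<Sum>c\<in>C. X a c * Y c b)) =
         fdet C (\<lambda>c d. (if c = d then 1 else 0) - (\<Sum>a\<in>A. Y c a * X a d))"
proof -
  let ?I = "Inl ` A :: ('a + 'c) set" and ?J = "Inr ` C :: ('a + 'c) set"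
  let ?S = "?I \<union> ?J"
  define M where "M s t = (case s of
      Inl a \<Rightarrow> (case t of Inl b \<Rightarrow> if a = b then 1 else 0 | Inr c \<Rightarrow> X a c)
    | Inr c \<Rightarrow> (case t of Inl b \<Rightarrow> Y c b | Inr d \<Rightarrow> if c = d then 1 else 0))" for s t
  \<comment> \<open>\<open>U\<close> is \<open>[[1, 0], [-Y, 1]]\<close>, hence of determinant 1.
    Multiplied from the right it turns \<open>M\<close> into \<open>[[1 - XY, X], [0, 1]]\<close>,
    from the left into \<open>[[1, X], [0, 1 - YX]]\<close>.\<close>
  define U where "U s t = (case s of
      Inl a \<Rightarrow> (case t of Inl b \<Rightarrow> if a = b then 1 else 0 | Inr c \<Rightarrow> 0)
    | Inr c \<Rightarrow> (case t of Inl b \<Rightarrow> - Y c b | Inr d \<Rightarrow> if c = d then 1 else 0))" for s t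
  have S: "(\<Sum>s\<in>?S. f s) = (\<Sum>a\<in>A. f (Inl a)) + (\<Sum>c\<in>C. f (Inr c))" for f :: "_ \<Rightarrow> 'r"
    using assms by (subst sum.union_disjoint) (auto simp: sum.reindex)
  note [simp] = mult_indicator
  have [simp]: "- (if P then r else 0) = (if P then - r else 0)" for P and r :: 'r
    by auto
  have fin: "finite ?S" using assms by simp
  have low: "fdet ?S B = fdet A (\<lambda>a b. B (Inl a) (Inl b)) * fdet C (\<lambda>c d. B (Inr c) (Inr d))"
    if "\<And>a c. a \<in> A \<Longrightarrow> c \<in> C \<Longrightarrow> B (Inl a) (Inr c) = 0" for B :: "_ \<Rightarrow> _ \<Rightarrow> 'r"
    using that assms by (subst fdet_block_lower) (auto simp: fdet_image)
  have U1: "fdet ?S U = 1"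
    using assms by (subst low) (auto simp: U_def fdet_identity)
  have "fdet ?S M = fdet ?S (\<lambda>s t. \<Sum>m\<in>?S. M s m * U m t)"
    using fdet_matmul[OF fin, of M U] by (simp add: U1)
  \<comment> \<open>Both products have their zero block below the diagonal, so \<open>?J\<close> is
    listed first to fit the orientation of \<open>fdet_block_lower\<close>.\<close>
  also have "\<dots> = fdet (?J \<union> ?I) (\<lambda>s t. \<Sum>m\<in>?S. M s m * U m t)"
    by (simp add: Un_commute)
  also have "\<dots> = fdet ?J (\<lambda>s t. \<Sum>m\<in>?S. M s m * U m t) * fdet ?I (\<lambda>s t. \<Sum>m\<in>?S. M s m * U m t)"
    by (rule fdet_block_lower)
       (use assms in \<open>auto simp: S M_def U_def\<close>)
  also have "fdet ?J (\<lambda>s t. \<Sum>m\<in>?S. M s m * U m t) = 1"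
    using assms by (simp add: fdet_image)
      (rule fdet_identity, auto simp: S M_def U_def)
  also have "fdet ?I (\<lambda>s t. \<Sum>m\<in>?S. M s m * U m t) =
      fdet A (\<lambda>a b. (if a = b then 1 else 0) - (\<Sum>c\<in>C. X a c * Y c b))"
    using assms by (simp add: fdet_image)
      (rule fdet_cong, auto simp: S M_def U_def sum_negf)
  finally have 1: "fdet ?S M = fdet A (\<lambda>a b. (if a = b then 1 else 0) - (\<Sum>c\<in>C. X a c * Y c b))"
    by simp
  have "fdet ?S M = fdet ?S (\<lambda>s t. \<Sum>m\<in>?S. U s m * M m t)"
    using fdet_matmul[OF fin, of U M] by (simp add: U1)
  also have "\<dots> = fdet (?J \<union> ?I) (\<lambda>s t. \<Sum>m\<in>?S. U s m * M m t)"
    by (simp add: Un_commute)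
  also have "\<dots> = fdet ?J (\<lambda>s t. \<Sum>m\<in>?S. U s m * M m t) * fdet ?I (\<lambda>s t. \<Sum>m\<in>?S. U s m * M m t)"
    by (rule fdet_block_lower)
       (use assms in \<open>auto simp: S M_def U_def\<close>)
  also have "fdet ?I (\<lambda>s t. \<Sum>m\<in>?S. U s m * M m t) = 1"
    using assms by (simp add: fdet_image)
      (rule fdet_identity, auto simp: S M_def U_def)
  also have "fdet ?J (\<lambda>s t. \<Sum>m\<in>?S. U s m * M m t) =
      fdet C (\<lambda>c d. (if c = d then 1 else 0) - (\<Sum>a\<in>A. Y c a * X a d))"
    using assms by (simp add: fdet_image)
      (rule fdet_cong, auto simp: S M_def U_def sum_negf)
  finally show ?thesis
    by (simp add: 1)
qed

section \<open>Kernels and inverses\<close>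

lemma fdet_zero_imp_kernel:
  fixes A :: "'k \<Rightarrow> 'k \<Rightarrow> real"
  assumes "finite K" "fdet K A = 0"
  obtains v where "\<exists>k\<in>K. v k \<noteq> 0" "\<And>k. k \<in> K \<Longrightarrow> (\<Sum>l\<in>K. A k l * v l) = 0"
proof -
  obtain h where h: "bij_betw h {0..<card K} K"
    using ex_bij_betw_nat_finite[OF assms(1)] by blast
  then have K: "K = h ` {0..<card K}" and i: "inj_on h {0..<card K}"
    by (auto simp: bij_betw_def)
  let ?n = "card K"
  let ?m = "Matrix.mat ?n ?n (\<lambda>(i, j). A (h i) (h j))"
  have "Determinant.det ?m = 0"
    using fdet_image[OF _ i, of A] assms(2) by (simp add: K[symmetric] fdet_eq_det)
  then obtain w where w: "w \<in> carrier_vec ?n" "w \<noteq> 0\<^sub>v ?n" "?m *\<^sub>v w = 0\<^sub>v ?n"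
    using det_0_iff_vec_prod_zero[of ?m ?n] by auto
  define v where "v k = vec_index w (inv_into {0..<?n} h k)" for k
  have vh: "v (h i) = vec_index w i" if "i < ?n" for i
    using that i by (simp add: v_def)
  have "\<exists>i<?n. vec_index w i \<noteq> 0"
    using w(1,2) by (metis carrier_vecD eq_vecI index_zero_vec(1,2))
  then have "\<exists>k\<in>K. v k \<noteq> 0"
    using vh K by (metis atLeastLessThan_iff imageI le0)
  moreover have "(\<Sum>l\<in>K. A k l * v l) = 0" if k: "k \<in> K" for k
  proof -
    obtain j where j: "j < ?n" "k = h j"
      using k bij_betw_imp_surj_on[OF h] by force
    have "(\<Sum>l\<in>K. A k l * v l) = (\<Sum>i = 0..<?n. A (h j) (h i) * vec_index w i)"
      unfolding sum.reindex_bij_betw[OF h, symmetric] using j vh by (intro sum.cong) auto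
    also have "\<dots> = vec_index (?m *\<^sub>v w) j"
      using j w(1) by (simp add: scalar_prod_def)
    finally show ?thesis
      using w(3) j by simp
  qed
  ultimately show ?thesis by (rule that)
qed

text \<open>This is the existence statement behind the choice in \<open>fmat_inv\<close>.\<close>

lemma ex_fmat_inverse:
  fixes A :: "'k \<Rightarrow> 'k \<Rightarrow> real"
  assumes "finite K" "fdet K A \<noteq> 0"
  shows "\<exists>B. \<forall>k\<in>K. \<forall>l\<in>K. (\<Sum>m\<in>K. A k m * B m l) = (if k = l then 1 else 0) \<and>
      (\<Sum>m\<in>K. B k m * A m l) = (if k = l then 1 else 0)"
proof -
  obtain h where h: "bij_betw h {0..<card K} K"
    using ex_bij_betw_nat_finite[OF assms(1)] by blast
  then have K: "K = h ` {0..<card K}" and i: "inj_on h {0..<card K}"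
    by (auto simp: bij_betw_def)
  let ?n = "card K"
  let ?m = "Matrix.mat ?n ?n (\<lambda>(i, j). A (h i) (h j))"
  have "Determinant.det ?m \<noteq> 0"
    using fdet_image[OF _ i, of A] assms(2) by (simp add: K[symmetric] fdet_eq_det)
  then obtain N where N: "N \<in> carrier_mat ?n ?n" "N * ?m = 1\<^sub>m ?n" "?m * N = 1\<^sub>m ?n"
    \<comment> \<open>\<open>b\<close> is the extension field of the ring record; any value will
      do.\<close>
    using det_non_zero_imp_unit[of ?m ?n, where b = "()"]
    by (auto simp: Units_def ring_mat_def)
  define g where "g = inv_into {0..<?n} h"
  have gh: "g (h i) = i" if "i < ?n" for i
    using that i by (simp add: g_def)
  define B where "B k l = N $$ (g k, g l)" for k l
  have "(\<Sum>m\<in>K. A k m * B m l) = (if k = l then 1 else 0) \<and>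
      (\<Sum>m\<in>K. B k m * A m l) = (if k = l then 1 else 0)" if kl: "k \<in> K" "l \<in> K" for k l
  proof -
    have "k \<in> h ` {0..<?n}" "l \<in> h ` {0..<?n}"
      using kl bij_betw_imp_surj_on[OF h] by simp_all
    then obtain p q where pq: "p < ?n" "k = h p" "q < ?n" "l = h q"
      by auto
    have "(\<Sum>m\<in>K. A k m * B m l) = (?m * N) $$ (p, q)"
      unfolding sum.reindex_bij_betw[OF h, symmetric]
      using pq N(1) gh by (auto simp: B_def scalar_prod_def intro!: sum.cong)
    moreover have "(\<Sum>m\<in>K. B k m * A m l) = (N * ?m) $$ (p, q)"
      unfolding sum.reindex_bij_betw[OF h, symmetric]
      using pq N(1) gh by (auto simp: B_def scalar_prod_def intro!: sum.cong)
    ultimately show ?thesis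
      using pq N inj_on_eq_iff[OF i] by auto
  qed
  then show ?thesis by blast
qed

text \<open>A nonzero kernel vector would give the quadratic form the value 0.\<close>

lemma pos_def_fdet_nonzero:
  assumes "finite K" "pos_def K A"
  shows "fdet K A \<noteq> 0"
proof
  assume "fdet K A = 0"
  then obtain v where v: "\<exists>k\<in>K. v k \<noteq> 0" "\<And>k. k \<in> K \<Longrightarrow> (\<Sum>l\<in>K. A k l * v l) = 0"
    using fdet_zero_imp_kernel[OF assms(1)] by blast
  have "(\<Sum>k\<in>K. \<Sum>l\<in>K. v k * A k l * v l) = (\<Sum>k\<in>K. v k * (\<Sum>l\<in>K. A k l * v l))"
    by (simp add: sum_distrib_left mult.assoc)
  also have "\<dots> = 0"
    using v(2) by simp
  finally show False
    using assms(2) v(1) by (auto simp: pos_def_def)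
qed

lemma fmat_inv:
  fixes A :: "'k \<Rightarrow> 'k \<Rightarrow> real"
  assumes "finite K" "fdet K A \<noteq> 0" "k \<in> K" "l \<in> K"
  shows fmat_inv_right: "(\<Sum>m\<in>K. A k m * fmat_inv K A m l) = (if k = l then 1 else 0)"
    and fmat_inv_left: "(\<Sum>m\<in>K. fmat_inv K A k m * A m l) = (if k = l then 1 else 0)"
proof -
  note * = bspec[OF bspec[OF someI_ex[OF ex_fmat_inverse[OF assms(1,2)]] assms(3)] assms(4)]
  show "(\<Sum>m\<in>K. A k m * fmat_inv K A m l) = (if k = l then 1 else 0)"
    unfolding fmat_inv_def by (rule conjunct1[OF *])
  show "(\<Sum>m\<in>K. fmat_inv K A k m * A m l) = (if k = l then 1 else 0)"
    unfolding fmat_inv_def by (rule conjunct2[OF *])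
qed

text \<open>With \<open>Q a c = (if \<pi> a = c then 1 else 0)\<close>, hypothesis \<open>TR\<close> says \<open>T Q = Q R\<close> and hypothesis \<open>W\<close>
  says \<open>T W = S - (S - T) Q Q\<^sup>T\<close>.\<close>

lemma fdet_edge_vertex_identity:
  fixes S T Si W :: "'a \<Rightarrow> 'a \<Rightarrow> 'r::idom" and R Ri H :: "'c \<Rightarrow> 'c \<Rightarrow> 'r"
  assumes fin: "finite A" "finite C" and \<pi>: "\<And>a. a \<in> A \<Longrightarrow> \<pi> a \<in> C"
    and Si: "\<And>a b. a \<in> A \<Longrightarrow> b \<in> A \<Longrightarrow> (\<Sum>m\<in>A. S a m * Si m b) = (if a = b then 1 else 0)"
    and Ri: "\<And>c e. c \<in> C \<Longrightarrow> e \<in> C \<Longrightarrow> (\<Sum>m\<in>C. Ri c m * R m e) = (if c = e then 1 else 0)"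
    and TR: "\<And>a c. a \<in> A \<Longrightarrow> c \<in> C \<Longrightarrow> (\<Sum>b\<in>A. if \<pi> b = c then T a b else 0) = R (\<pi> a) c"
    and W: "\<And>a b. a \<in> A \<Longrightarrow> b \<in> A \<Longrightarrow> (\<Sum>m\<in>A. T a m * W m b) =
       T a b - (\<Sum>m\<in>A. if \<pi> m = \<pi> b \<and> m \<noteq> b then S a m - T a m else 0)"
    and H: "\<And>c e. c \<in> C \<Longrightarrow> e \<in> C \<Longrightarrow> H c e = (1 - of_nat (card {a \<in> A. \<pi> a = c})) * Ri c e +
       (\<Sum>a\<in>A. \<Sum>b\<in>A. if \<pi> a = c \<and> \<pi> b = e then Si a b else 0)"
  shows "fdet A T * fdet A W = fdet A S * fdet C H * fdet C R"
proof -
  define Y where "Y c b = (if \<pi> b = c then 1 else 0 :: 'r)" for c b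
  \<comment> \<open>In matrix form \<open>Y\<close> is the transpose of \<open>Q\<close> and
    \<open>X = Q - S^-1 Q R\<close>, which equals \<open>(1 - S^-1 T) Q\<close> by
    \<open>TR\<close>; thus \<open>Z = 1 - X Y\<close> satisfies \<open>S Z = T W\<close>.\<close>
  define X where "X a c = Y c a - (\<Sum>n\<in>A. Si a n * R (\<pi> n) c)" for a c
  define Z where "Z a b = (if a = b then 1 else 0) - (\<Sum>c\<in>C. X a c * Y c b)" for a b
  have Y: "(\<Sum>c\<in>C. f c * Y c b) = f (\<pi> b)" "(\<Sum>c\<in>C. Y c b * f c) = f (\<pi> b)"
    if "b \<in> A" for f b
    using that fin \<pi> by (simp_all add: Y_def mult_indicator)
  have SX: "(\<Sum>m\<in>A. S a m * X m c) = (\<Sum>m\<in>A. S a m * Y c m) - R (\<pi> a) c"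
    if "a \<in> A" "c \<in> C" for a c
  proof -
    have "(\<Sum>m\<in>A. S a m * (\<Sum>n\<in>A. Si m n * R (\<pi> n) c)) =
        (\<Sum>n\<in>A. (\<Sum>m\<in>A. S a m * Si m n) * R (\<pi> n) c)"
      by (simp add: sum_distrib_left sum_distrib_right mult.assoc) (rule sum.swap)
    also have "\<dots> = (\<Sum>n\<in>A. if a = n then R (\<pi> n) c else 0)"
      using that by (intro sum.cong) (auto simp: Si)
    also have "\<dots> = R (\<pi> a) c"
      using that fin by simp
    finally show ?thesis
      by (simp add: X_def right_diff_distrib sum_subtractf)
  qed
  have TW: "(\<Sum>m\<in>A. T a m * W m b) = (\<Sum>m\<in>A. S a m * Z m b)" if ab: "a \<in> A" "b \<in> A" for a b
  proof -
    have "(\<Sum>m\<in>A. if \<pi> m = \<pi> b \<and> m \<noteq> b then S a m - T a m else 0) =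
        (\<Sum>m\<in>A. (S a m * Y (\<pi> b) m - (if \<pi> m = \<pi> b then T a m else 0))
          - (if m = b then S a b - T a b else 0))"
      by (intro sum.cong) (auto simp: Y_def)
    also have "\<dots> = (\<Sum>m\<in>A. S a m * Y (\<pi> b) m) - R (\<pi> a) (\<pi> b) - (S a b - T a b)"
      using ab fin \<pi> by (simp add: sum_subtractf TR)
    finally have "(\<Sum>m\<in>A. T a m * W m b) = S a b - (\<Sum>m\<in>A. S a m * X m (\<pi> b))"
      using W[OF ab] SX ab \<pi> by simp
    also have "\<dots> = (\<Sum>m\<in>A. S a m * ((if m = b then 1 else 0) - X m (\<pi> b)))"
      using ab fin
      by (simp add: right_diff_distrib sum_subtractf mult_indicator)
    finally show ?thesis
      using ab by (simp add: Z_def Y)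
  qed
  have "fdet A T * fdet A W = fdet A (\<lambda>a b. \<Sum>m\<in>A. T a m * W m b)"
    by (rule fdet_matmul[OF fin(1), symmetric])
  also have "\<dots> = fdet A (\<lambda>a b. \<Sum>m\<in>A. S a m * Z m b)"
    by (rule fdet_cong) (auto simp: TW)
  also have "\<dots> = fdet A S * fdet A Z"
    by (rule fdet_matmul[OF fin(1)])
  also have "fdet A Z = fdet C (\<lambda>c e. (if c = e then 1 else 0) - (\<Sum>a\<in>A. Y c a * X a e))"
    unfolding Z_def by (rule fdet_sylvester[OF fin])
  also have "\<dots> = fdet C (\<lambda>c e. \<Sum>m\<in>C. H c m * R m e)"
  proof (rule fdet_cong[OF refl])
    fix c e assume ce: "c \<in> C" "e \<in> C"
    \<comment> \<open>Here \<open>1 - Y X = 1 - Q^T Q + Q^T S^-1 Q R\<close>. The matrix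
      \<open>Q^T Q\<close> is diagonal with the fibre sizes of \<pi>, so this is
      \<open>H R\<close>.\<close>
    define d where "d = (of_nat (card {a \<in> A. \<pi> a = c}) :: 'r)"
    have d: "(\<Sum>a\<in>A. Y c a * Y e a) = d * (if c = e then 1 else 0)"
    proof (cases "c = e")
      case True
      have "(\<Sum>a\<in>A. Y c a * Y e a) = (\<Sum>a\<in>A. if \<pi> a = c then 1 else 0)"
        using True by (intro sum.cong) (auto simp: Y_def)
      also have "\<dots> = d"
        using fin by (simp add: d_def sum.If_cases Int_def)
      finally show ?thesis
        using True by simp
    qed (auto simp: Y_def intro!: sum.neutral)
    have "(\<Sum>m\<in>C. H c m * R m e) = (\<Sum>m\<in>C. ((1 - d) * Ri c m +
       (\<Sum>a\<in>A. \<Sum>b\<in>A. Y c a * (Y m b * Si a b))) * R m e)"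
      using ce by (intro sum.cong refl) (auto simp: H d_def Y_def intro!: sum.cong)
    also have "\<dots> = (1 - d) * (\<Sum>m\<in>C. Ri c m * R m e) +
        (\<Sum>m\<in>C. \<Sum>a\<in>A. \<Sum>b\<in>A. Y c a * (Y m b * (Si a b * R m e)))"
      by (simp add: distrib_right sum.distrib sum_distrib_left sum_distrib_right mult.assoc)
    also have "(\<Sum>m\<in>C. \<Sum>a\<in>A. \<Sum>b\<in>A. Y c a * (Y m b * (Si a b * R m e))) =
        (\<Sum>a\<in>A. \<Sum>b\<in>A. \<Sum>m\<in>C. Y c a * (Y m b * (Si a b * R m e)))"
      by (subst sum.swap) (intro sum.cong refl sum.swap)
    also have "\<dots> = (\<Sum>a\<in>A. Y c a * (\<Sum>b\<in>A. Si a b * R (\<pi> b) e))"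
      by (simp add: sum_distrib_left[symmetric] Y cong: sum.cong)
    finally show "(if c = e then 1 else 0) - (\<Sum>a\<in>A. Y c a * X a e) = (\<Sum>m\<in>C. H c m * R m e)"
      using ce d by (simp add: X_def Ri right_diff_distrib left_diff_distrib sum_subtractf)
  qed
  also have "\<dots> = fdet C H * fdet C R"
    by (rule fdet_matmul[OF fin(2)])
  finally show ?thesis
    by (simp add: mult.assoc)
qed

section \<open>Exponential families\<close>

text \<open>This norm is convenient because \<open>exp (\<rho> * l1 K t)\<close> is a product over
  the coordinates; see \<open>integrable_exp_l1\<close>.\<close>

definition l1 :: "'k set \<Rightarrow> ('k \<Rightarrow> real) \<Rightarrow> real" where
  "l1 K v = (\<Sum>k\<in>K. \<bar>v k\<bar>)"

lemma l1_nonneg: "0 \<le> l1 K v"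
  by (simp add: l1_def sum_nonneg)

lemma abs_le_l1: "finite K \<Longrightarrow> k \<in> K \<Longrightarrow> \<bar>v k\<bar> \<le> l1 K v"
  unfolding l1_def by (rule member_le_sum) auto

lemma abs_dot_le: "finite K \<Longrightarrow> \<bar>dot K v w\<bar> \<le> l1 K v * l1 K w"
proof -
  assume K: "finite K"
  have "\<bar>dot K v w\<bar> \<le> (\<Sum>k\<in>K. \<bar>v k\<bar> * \<bar>w k\<bar>)"
    unfolding dot_def abs_mult[symmetric] by (rule sum_abs)
  also have "\<dots> \<le> (\<Sum>k\<in>K. \<bar>v k\<bar> * l1 K w)"
    using K by (intro sum_mono mult_left_mono abs_le_l1) auto
  finally show ?thesis
    by (simp add: l1_def sum_distrib_right)
qed

lemma dot_cong: "(\<And>k. k \<in> K \<Longrightarrow> v k = v' k) \<Longrightarrow> (\<And>k. k \<in> K \<Longrightarrow> w k = w' k) \<Longrightarrow>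
    dot K v w = dot K v' w'"
  by (simp add: dot_def)

lemma dot_diff_left: "dot K (\<lambda>k. v k - v' k) w = dot K v w - dot K v' w"
  by (simp add: dot_def left_diff_distrib sum_subtractf)

lemma dot_diff_right: "dot K v (\<lambda>k. w k - w' k) = dot K v w - dot K v w'"
  by (simp add: dot_def right_diff_distrib sum_subtractf)

text \<open>Multiplying \<open>1 - y <= exp (- y)\<close> by \<open>exp y\<close> gives
  \<open>exp y - 1 <= y * exp y\<close>, which settles nonnegative \<open>y\<close>; for negative
  \<open>y\<close> already \<open>1 + y <= exp y\<close> suffices.\<close>

lemma abs_exp_minus_one_le: "\<bar>exp y - 1\<bar> \<le> \<bar>y\<bar> * exp \<bar>y\<bar>" for y :: real
proof (cases "y \<ge> 0")
  case True
  have "1 - y \<le> exp (- y)"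
    using exp_ge_add_one_self[of "- y"] by simp
  then have "(1 - y) * exp y \<le> 1"
    using mult_right_mono[of "1 - y" "exp (-y)" "exp y"] by (simp add: exp_minus)
  with True show ?thesis
    by (simp add: algebra_simps)
next
  case False
  have "1 + y \<le> exp y"
    by simp
  moreover have "\<bar>y\<bar> * 1 \<le> \<bar>y\<bar> * exp \<bar>y\<bar>"
    by (intro mult_left_mono) auto
  moreover have "\<bar>exp y - 1\<bar> = 1 - exp y"
    using False by simp
  ultimately show ?thesis
    using False by linarith
qed

text \<open>The same inequality gives \<open>exp y - 1 - y <= y * (exp y - 1)\<close>, and the
  first-order bound makes the right side quadratic.\<close>

lemma abs_exp_minus_one_minus_le: "\<bar>exp y - 1 - y\<bar> \<le> y\<^sup>2 * exp \<bar>y\<bar>" for y :: real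
proof -
  have 0: "1 + y \<le> exp y" by simp
  have *: "exp y - 1 - y \<le> y * (exp y - 1)"
  proof -
    have "1 - y \<le> exp (- y)"
      using exp_ge_add_one_self[of "- y"] by simp
    then have "(1 - y) * exp y \<le> 1"
      using mult_right_mono[of "1 - y" "exp (-y)" "exp y"] by (simp add: exp_minus)
    then show ?thesis
      by (simp add: algebra_simps)
  qed
  also have "\<dots> \<le> \<bar>y\<bar> * \<bar>exp y - 1\<bar>"
    by (simp add: abs_mult[symmetric])
  also have "\<dots> \<le> \<bar>y\<bar> * (\<bar>y\<bar> * exp \<bar>y\<bar>)"
    by (intro mult_left_mono abs_exp_minus_one_le) auto
  also have "\<dots> = y\<^sup>2 * exp \<bar>y\<bar>"
    by (simp add: power2_eq_square mult.assoc[symmetric])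
  finally show ?thesis
    using 0 by linarith
qed

text \<open>Equality case of \<open>ln x <= x - 1\<close> at \<open>x = exp y\<close>. It makes the
  gradient inequality for the log partition function strict.\<close>

lemma exp_eq_one_plus_imp:
  fixes y :: real
  assumes "exp y = 1 + y"
  shows "y = 0"
proof -
  have "ln (exp y) = y"
    by simp
  also have "\<dots> = exp y - 1"
    using assms by simp
  finally have "ln (exp y) = exp y - 1" .
  then have "exp y = 1"
    using ln_eq_minus_one exp_gt_zero by blast
  then show ?thesis by simp
qed

text \<open>A basic open set of the product topology restricts finitely many coordinates, so one
  radius serves them all. It is applied to \<open>params\<close>, which is an interior in this
  topology.\<close>

lemma openin_powertop_real_box:
  fixes f :: "_ \<Rightarrow> real"
  assumes K: "finite K" and "openin (powertop_real K) U" "\<theta> \<in> U"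
  obtains \<rho> where "0 < \<rho>"
    "\<And>\<theta>'. \<theta>' \<in> extensional K \<Longrightarrow> (\<And>k. k \<in> K \<Longrightarrow> \<bar>\<theta>' k - \<theta> k\<bar> \<le> \<rho>) \<Longrightarrow> \<theta>' \<in> U"
proof -
  obtain X where "\<forall>k\<in>K. openin euclideanreal (X k)"
      and X2: "\<theta> \<in> Pi\<^sub>E K X" "Pi\<^sub>E K X \<subseteq> U"
    using bspec[OF assms(2)[unfolded openin_product_topology_alt] assms(3)] by blast
  then have X1: "open (X k)" if "k \<in> K" for k
    using that by (subst open_openin) blast
  have "\<exists>e>0. \<forall>t. \<bar>t - \<theta> k\<bar> < e \<longrightarrow> t \<in> X k" if "k \<in> K" for k
    using X1[OF that] PiE_mem[OF X2(1) that] unfolding open_real by blast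
  then obtain e where e: "\<And>k. k \<in> K \<Longrightarrow> e k > 0"
      "\<And>k t. k \<in> K \<Longrightarrow> \<bar>t - \<theta> k\<bar> < e k \<Longrightarrow> t \<in> X k"
    by (metis (no_types, lifting))
  \<comment> \<open>Halving gives a closed box inside the open intervals; the extra 1 keeps the
    minimum defined for empty \<open>K\<close>.\<close>
  define \<rho> where "\<rho> = Min (insert 1 (e ` K)) / 2"
  have "0 < Min (insert 1 (e ` K))"
    using K e(1) by (subst Min_gr_iff) auto
  have \<rho>: "\<rho> < e k" if "k \<in> K" for k
  proof -
    have "Min (insert 1 (e ` K)) \<le> e k"
      by (rule Min_le) (use that K in auto)
    then show ?thesis
      using e(1)[OF that] by (simp add: \<rho>_def)
  qed
  have \<rho>0: "0 < \<rho>"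
    using \<open>0 < Min (insert 1 (e ` K))\<close> by (simp add: \<rho>_def)
  show ?thesis
  proof (rule that[OF \<rho>0])
    fix \<theta>' assume ext: "\<theta>' \<in> extensional K" and le: "\<And>k. k \<in> K \<Longrightarrow> \<bar>\<theta>' k - \<theta> k\<bar> \<le> \<rho>"
    have "\<theta>' k \<in> X k" if "k \<in> K" for k
      using e(2)[OF that le_less_trans[OF le[OF that] \<rho>[OF that]]] .
    then have "\<theta>' \<in> Pi\<^sub>E K X"
      using ext by (simp add: PiE_iff)
    then show "\<theta>' \<in> U"
      using X2(2) by blast
  qed
qed

lemma integrable_abs_le:
  fixes f g :: "'x \<Rightarrow> real"
  assumes "integrable M g" "f \<in> borel_measurable M" "\<And>x. \<bar>f x\<bar> \<le> g x"
  shows "integrable M f"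
proof (rule Bochner_Integration.integrable_bound[OF assms(1,2)], rule AE_I2)
  fix x
  show "norm (f x) \<le> norm (g x)"
    using assms(3)[of x] by simp
qed

text \<open>The derivatives of the natural parameter and of the Legendre transform are read off from
  explicit bounds of this form.\<close>

lemma has_real_derivative_quadratic_error:
  fixes f :: "real \<Rightarrow> real"
  assumes "0 < \<delta>" "\<And>t. \<bar>t\<bar> < \<delta> \<Longrightarrow> \<bar>f (x + t) - f x - t * D\<bar> \<le> M * t\<^sup>2"
  shows "(f has_real_derivative D) (at x)"
  unfolding DERIV_def
proof -
  have "eventually (\<lambda>t. t \<noteq> 0 \<and> \<bar>t\<bar> < \<delta>) (at (0::real))"
    using assms(1) unfolding eventually_at by (intro exI[of _ \<delta>]) (auto simp: dist_real_def)
  then have "eventually (\<lambda>t. norm ((f (x + t) - f x) / t - D) \<le> M * \<bar>t\<bar>) (at 0)"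
  proof eventually_elim
    case (elim t)
    then have "\<bar>(f (x + t) - f x) / t - D\<bar> = \<bar>f (x + t) - f x - t * D\<bar> / \<bar>t\<bar>"
      by (simp add: abs_divide[symmetric] diff_divide_distrib)
    also have "\<dots> \<le> M * t\<^sup>2 / \<bar>t\<bar>"
      using elim by (intro divide_right_mono assms(2)) auto
    also have "\<dots> = M * \<bar>t\<bar>"
      using elim by (simp add: power2_eq_square abs_if)
    finally show ?case by simp
  qed
  moreover have "((\<lambda>t. M * \<bar>t\<bar>) \<longlongrightarrow> 0) (at 0)"
    by (auto intro!: tendsto_eq_intros)
  ultimately have "((\<lambda>t. (f (x + t) - f x) / t - D) \<longlongrightarrow> 0) (at 0)"
    by (rule Lim_null_comparison)
  then show "((\<lambda>t. (f (x + t) - f x) / t) \<longlongrightarrow> D) (at 0)"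
    by (rule LIM_zero_cancel)
qed

section \<open>Hessians in finitely many coordinates\<close>

text \<open>A witness \<open>g\<close> for the first partial derivatives on a whole box is recorded,
  because \<open>hessian\<close> differentiates them near \<open>x\<close> and \<open>deriv\<close>
  is additive only where differentiability is known. Coordinates outside \<open>C\<close> stay
  free.\<close>

definition has_hessian_at ::
    "'c set \<Rightarrow> (('c \<Rightarrow> real) \<Rightarrow> real) \<Rightarrow> ('c \<Rightarrow> real) \<Rightarrow> ('c \<Rightarrow> 'c \<Rightarrow> real) \<Rightarrow> bool" where
  "has_hessian_at C f x H \<longleftrightarrow> (\<exists>g \<delta>. 0 < \<delta> \<and>
     (\<forall>y. (\<forall>c\<in>C. \<bar>y c - x c\<bar> < \<delta>) \<longrightarrow>
        (\<forall>d\<in>C. ((\<lambda>t. f (y(d := t))) has_real_derivative g d y) (at (y d)))) \<and>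
     (\<forall>c\<in>C. \<forall>d\<in>C. ((\<lambda>t. g d (x(c := t))) has_real_derivative H c d) (at (x c))))"

lemma has_hessian_atI:
  assumes "0 < \<delta>"
    and "\<And>y d. (\<And>c. c \<in> C \<Longrightarrow> \<bar>y c - x c\<bar> < \<delta>) \<Longrightarrow> d \<in> C \<Longrightarrow>
       ((\<lambda>t. f (y(d := t))) has_real_derivative g d y) (at (y d))"
    and "\<And>c d. c \<in> C \<Longrightarrow> d \<in> C \<Longrightarrow> ((\<lambda>t. g d (x(c := t))) has_real_derivative H c d) (at (x c))"
  shows "has_hessian_at C f x H"
  unfolding has_hessian_at_def using assms by blast

lemma hessian_eq:
  assumes "has_hessian_at C f x H" "c \<in> C" "d \<in> C"
  shows "hessian f x c d = H c d"
proof -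
  obtain g \<delta> where \<delta>: "0 < \<delta>"
    and f: "\<And>y d. (\<forall>c\<in>C. \<bar>y c - x c\<bar> < \<delta>) \<Longrightarrow> d \<in> C \<Longrightarrow>
       ((\<lambda>t. f (y(d := t))) has_real_derivative g d y) (at (y d))"
    and g: "((\<lambda>t. g d (x(c := t))) has_real_derivative H c d) (at (x c))"
    using assms unfolding has_hessian_at_def by blast
  \<comment> \<open>Points of the line through \<open>x\<close> in direction \<open>c\<close> that
    are within \<delta> of \<open>x\<close> lie in the box, so the first partial derivative is
    \<open>g\<close> there.\<close>
  have "partial d f (x(c := t)) = g d (x(c := t))" if "\<bar>t - x c\<bar> < \<delta>" for t
    unfolding partial_def using that \<delta> assms(3) by (intro DERIV_imp_deriv f) auto
  then have "((\<lambda>t. partial d f (x(c := t))) has_real_derivative H c d) (at (x c))"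
    using \<delta> by (intro has_field_derivative_transform_within[OF g, of \<delta>])
      (auto simp: dist_real_def)
  then show ?thesis
    unfolding hessian_def partial_def[of c] by (rule DERIV_imp_deriv)
qed

lemma has_hessian_at_const: "has_hessian_at C (\<lambda>x. a) x (\<lambda>c d. 0)"
  by (rule has_hessian_atI[where \<delta> = 1 and g = "\<lambda>_ _. 0"]) auto

lemma has_hessian_at_add:
  assumes "has_hessian_at C f x H" "has_hessian_at C f' x H'"
  shows "has_hessian_at C (\<lambda>y. f y + f' y) x (\<lambda>c d. H c d + H' c d)"
proof -
  obtain g \<delta> where \<delta>: "0 < \<delta>"
    and f: "\<And>y d. (\<forall>c\<in>C. \<bar>y c - x c\<bar> < \<delta>) \<Longrightarrow> d \<in> C \<Longrightarrow>
       ((\<lambda>t. f (y(d := t))) has_real_derivative g d y) (at (y d))"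
    and g: "\<And>c d. c \<in> C \<Longrightarrow> d \<in> C \<Longrightarrow>
       ((\<lambda>t. g d (x(c := t))) has_real_derivative H c d) (at (x c))"
    using assms(1) unfolding has_hessian_at_def by blast
  obtain g' \<delta>' where \<delta>': "0 < \<delta>'"
    and f': "\<And>y d. (\<forall>c\<in>C. \<bar>y c - x c\<bar> < \<delta>') \<Longrightarrow> d \<in> C \<Longrightarrow>
       ((\<lambda>t. f' (y(d := t))) has_real_derivative g' d y) (at (y d))"
    and g': "\<And>c d. c \<in> C \<Longrightarrow> d \<in> C \<Longrightarrow>
       ((\<lambda>t. g' d (x(c := t))) has_real_derivative H' c d) (at (x c))"
    using assms(2) unfolding has_hessian_at_def by blast
  show ?thesis
    by (rule has_hessian_atI[where \<delta> = "min \<delta> \<delta>'" and g = "\<lambda>d y. g d y + g' d y"])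
      (use \<delta> \<delta>' in \<open>auto intro!: DERIV_add f f' g g'\<close>)
qed

lemma has_hessian_at_cmult:
  assumes "has_hessian_at C f x H"
  shows "has_hessian_at C (\<lambda>y. a * f y) x (\<lambda>c d. a * H c d)"
proof -
  obtain g \<delta> where \<delta>: "0 < \<delta>"
    and f: "\<And>y d. (\<forall>c\<in>C. \<bar>y c - x c\<bar> < \<delta>) \<Longrightarrow> d \<in> C \<Longrightarrow>
       ((\<lambda>t. f (y(d := t))) has_real_derivative g d y) (at (y d))"
    and g: "\<And>c d. c \<in> C \<Longrightarrow> d \<in> C \<Longrightarrow>
       ((\<lambda>t. g d (x(c := t))) has_real_derivative H c d) (at (x c))"
    using assms(1) unfolding has_hessian_at_def by blast
  show ?thesis
    by (rule has_hessian_atI[where \<delta> = \<delta> and g = "\<lambda>d y. a * g d y"])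
      (use \<delta> in \<open>auto intro!: DERIV_cmult f g\<close>)
qed

lemma has_hessian_at_sum:
  assumes "\<And>i. i \<in> I \<Longrightarrow> has_hessian_at C (f i) x (H i)"
  shows "has_hessian_at C (\<lambda>y. \<Sum>i\<in>I. f i y) x (\<lambda>c d. \<Sum>i\<in>I. H i c d)"
  using assms
proof (induction I rule: infinite_finite_induct)
  case (insert i I)
  then show ?case
    using has_hessian_at_add[of C "f i" x "H i"] by simp
qed (simp_all add: has_hessian_at_const)

lemma has_hessian_at_dot:
  "has_hessian_at C (\<lambda>y. dot K a (\<lambda>j. y (\<iota> j))) x (\<lambda>c d. 0)"
proof (rule has_hessian_atI[where \<delta> = 1 and g = "\<lambda>d _. \<Sum>j\<in>K. if \<iota> j = d then a j else 0"])
  fix y d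
  have "((\<lambda>t. a j * (y(d := t)) (\<iota> j)) has_real_derivative (if \<iota> j = d then a j else 0)) (at (y d))"
    for j
    by (cases "\<iota> j = d") (auto intro!: derivative_eq_intros)
  then show "((\<lambda>t. dot K a (\<lambda>j. (y(d := t)) (\<iota> j))) has_real_derivative
      (\<Sum>j\<in>K. if \<iota> j = d then a j else 0)) (at (y d))"
    unfolding dot_def by (intro DERIV_sum)
qed auto

section \<open>Changing the parameter of an exponential family\<close>

locale regular_family =
  fixes E :: "('x, 'k) exp_family" (structure)
  assumes regular: "regular_exp_family E"
begin

abbreviation "K \<equiv> index E"
abbreviation "T \<equiv> stat E"
abbreviation "Z \<equiv> partition_fun E"
abbreviation "P \<equiv> member E"

definition mean :: "('k \<Rightarrow> real) \<Rightarrow> 'k \<Rightarrow> real" where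
  "mean \<theta> k = (\<integral>x. T x k \<partial>P \<theta>)"

lemma finite_index [simp, intro]: "finite K"
  using regular by (simp add: regular_exp_family_def)

lemma measurable_stat [measurable]: "k \<in> K \<Longrightarrow> (\<lambda>x. T x k) \<in> borel_measurable (base E)"
  using regular by (simp add: regular_exp_family_def)

lemma measurable_dot [measurable]: "(\<lambda>x. dot K v (T x)) \<in> borel_measurable (base E)"
  unfolding dot_def by measurable

lemma measurable_l1 [measurable]: "(\<lambda>x. l1 K (T x)) \<in> borel_measurable (base E)"
  unfolding l1_def by measurable

lemma sets_P [measurable_cong, simp]: "sets (P \<theta>) = sets (base E)"
  by (simp add: member_def)

lemma borel_measurable_P [simp]: "borel_measurable (P \<theta>) = borel_measurable (base E)"
  by (rule measurable_cong_sets) auto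

lemma params_domain:
  assumes "\<theta> \<in> params E"
  shows params_extensional: "\<theta> \<in> extensional K"
    and params_integrable: "integrable (base E) (\<lambda>x. exp (dot K \<theta> (T x)))"
    and partition_pos: "0 < Z \<theta>"
  using assms subsetD[OF interior_of_subset[of "powertop_real K"]]
    subsetD[OF interior_of_subset_topspace[of "powertop_real K"]]
  unfolding params_def by (fastforce simp: PiE_iff)+

lemma params_box:
  assumes "\<theta> \<in> params E"
  obtains \<rho> where "0 < \<rho>"
    "\<And>\<theta>'. \<theta>' \<in> extensional K \<Longrightarrow> (\<And>k. k \<in> K \<Longrightarrow> \<bar>\<theta>' k - \<theta> k\<bar> \<le> \<rho>) \<Longrightarrow> \<theta>' \<in> params E"
  using openin_powertop_real_box[of K "params E" \<theta>] assms
  unfolding params_def by auto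

lemma pos_def_Var: "\<theta> \<in> params E \<Longrightarrow> pos_def K (Var E (P \<theta>))"
  using regular by (auto simp: regular_exp_family_def members_def)

lemma density_eq:
  assumes "\<theta> \<in> params E"
  shows "exp (dot K \<theta> (T x) - log_partition E \<theta>) = exp (dot K \<theta> (T x)) / Z \<theta>"
  using partition_pos[OF assms] by (simp add: exp_diff log_partition_def)

lemma integrable_P_iff:
  assumes "\<theta> \<in> params E" "f \<in> borel_measurable (base E)"
  shows "integrable (P \<theta>) f \<longleftrightarrow> integrable (base E) (\<lambda>x. exp (dot K \<theta> (T x)) * f x)"
proof -
  have "integrable (P \<theta>) f \<longleftrightarrow> integrable (base E) (\<lambda>x. exp (dot K \<theta> (T x)) / Z \<theta> * f x)"
    unfolding member_def using assms
    by (subst integrable_real_density) (auto simp: density_eq partition_pos less_imp_le intro!: AE_I2 divide_nonneg_pos)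
  also have "\<dots> \<longleftrightarrow> integrable (base E) (\<lambda>x. exp (dot K \<theta> (T x)) * f x)"
    using partition_pos[OF assms(1)]
      integrable_mult_left_iff[of "base E" "1 / Z \<theta>" "\<lambda>x. exp (dot K \<theta> (T x)) * f x"]
    by simp
  finally show ?thesis .
qed

lemma integral_P:
  fixes f :: "_ \<Rightarrow> real"
  assumes "\<theta> \<in> params E" "f \<in> borel_measurable (base E)"
  shows "(\<integral>x. f x \<partial>P \<theta>) = (\<integral>x. exp (dot K \<theta> (T x)) * f x \<partial>base E) / Z \<theta>"
proof -
  have "(\<integral>x. f x \<partial>P \<theta>) = (\<integral>x. exp (dot K \<theta> (T x)) / Z \<theta> * f x \<partial>base E)"
    unfolding member_def using assms
    by (subst integral_real_density) (auto simp: density_eq partition_pos less_imp_le intro!: AE_I2 divide_nonneg_pos)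
  also have "\<dots> = (\<integral>x. exp (dot K \<theta> (T x)) * f x \<partial>base E) / Z \<theta>"
    by (simp add: mult.commute[of _ "f _"] mult.assoc[symmetric])
  finally show ?thesis .
qed

lemma prob_space_P:
  fixes f :: "_ \<Rightarrow> real"
  assumes "\<theta> \<in> params E"
  shows "prob_space (P \<theta>)"
proof
  have "emeasure (P \<theta>) (space (P \<theta>)) = (\<integral>\<^sup>+x. ennreal (exp (dot K \<theta> (T x)) / Z \<theta>) \<partial>base E)"
    unfolding member_def using assms by (simp add: emeasure_density density_eq cong: nn_integral_cong)
  also have "\<dots> = ennreal (\<integral>x. exp (dot K \<theta> (T x)) / Z \<theta> \<partial>base E)"
    using params_integrable[OF assms] partition_pos[OF assms]
    by (intro nn_integral_eq_integral) auto
  also have "\<dots> = 1"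
    using partition_pos[OF assms] by (simp add: partition_fun_def)
  finally show "emeasure (P \<theta>) (space (P \<theta>)) = 1" .
qed

text \<open>The ratio of the partition functions is the moment generating function of the statistic
  under \<open>P \<theta>\<close>. After cancelling \<open>Z \<theta>\<close> both sides integrate
  the same function, so a divergent integral has the value 0 on both.\<close>

lemma partition_change:
  assumes "\<theta> \<in> params E"
  shows "Z \<theta>' = Z \<theta> * (\<integral>x. exp (dot K (\<lambda>k. \<theta>' k - \<theta> k) (T x)) \<partial>P \<theta>)"
  using partition_pos[OF assms]
  by (simp add: integral_P[OF assms] exp_add[symmetric] dot_diff_left partition_fun_def)

lemma density_shift:
  "exp (dot K \<theta> (T x)) * (c * exp (dot K (\<lambda>k. \<theta>' k - \<theta> k) (T x))) = exp (dot K \<theta>' (T x)) * c"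
  by (simp add: dot_diff_left exp_diff)

text \<open>Expectations at \<theta>' are normalised tilted expectations at \<theta>, so all
  estimates can be made under one fixed measure.\<close>

lemma integral_change:
  fixes f :: "_ \<Rightarrow> real"
  assumes "\<theta> \<in> params E" "\<theta>' \<in> params E" "f \<in> borel_measurable (base E)"
  shows "(\<integral>x. f x \<partial>P \<theta>') = (\<integral>x. f x * exp (dot K (\<lambda>k. \<theta>' k - \<theta> k) (T x)) \<partial>P \<theta>) /
      (\<integral>x. exp (dot K (\<lambda>k. \<theta>' k - \<theta> k) (T x)) \<partial>P \<theta>)"
proof -
  have "(\<integral>x. f x \<partial>P \<theta>') = (\<integral>x. exp (dot K \<theta>' (T x)) * f x \<partial>base E) / Z \<theta>'"
    by (rule integral_P) fact+
  moreover have "(\<integral>x. f x * exp (dot K (\<lambda>k. \<theta>' k - \<theta> k) (T x)) \<partial>P \<theta>) =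
      (\<integral>x. exp (dot K \<theta>' (T x)) * f x \<partial>base E) / Z \<theta>"
    using assms by (simp add: integral_P density_shift)
  ultimately show ?thesis
    unfolding partition_change[OF assms(1), of \<theta>'] by simp
qed

lemma integrable_change:
  fixes f :: "_ \<Rightarrow> real"
  assumes "\<theta> \<in> params E" "\<theta>' \<in> params E" "f \<in> borel_measurable (base E)"
  shows "integrable (P \<theta>') f \<longleftrightarrow>
    integrable (P \<theta>) (\<lambda>x. f x * exp (dot K (\<lambda>k. \<theta>' k - \<theta> k) (T x)))"
  using assms by (simp add: integrable_P_iff density_shift)

section \<open>Exponential moments and dominated integrals\<close>

text \<open>Bound each \<open>exp (\<rho> * |t k|)\<close> by
  \<open>exp (\<rho> * t k) + exp (- \<rho> * t k)\<close> and multiply out: the summands are the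
  exponentials of \<open>dot K (w B) t\<close>, one for each corner of the box around \<theta>, and
  every corner lies in \<open>params E\<close>.\<close>

lemma integrable_exp_l1:
  assumes "\<theta> \<in> params E"
  obtains \<rho> where "0 < \<rho>" "integrable (P \<theta>) (\<lambda>x. exp (\<rho> * l1 K (T x)))"
proof -
  obtain \<rho> where \<rho>: "0 < \<rho>"
    "\<And>\<theta>'. \<theta>' \<in> extensional K \<Longrightarrow> (\<And>k. k \<in> K \<Longrightarrow> \<bar>\<theta>' k - \<theta> k\<bar> \<le> \<rho>) \<Longrightarrow> \<theta>' \<in> params E"
    using params_box[OF assms] by blast
  define w where "w B k = (if k \<in> B then \<rho> else - \<rho>)" for B and k :: 'k
  define \<theta>w where "\<theta>w B = (\<lambda>k\<in>K. \<theta> k + w B k)" for B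
  have "integrable (P \<theta>) (\<lambda>x. exp (dot K (w B) (T x)))" for B
  proof -
    have mem: "\<theta>w B \<in> params E"
      using \<rho>(1) by (intro \<rho>(2)) (auto simp: \<theta>w_def w_def)
    \<comment> \<open>The constant 1 is integrable at the corner; \<open>integrable_change\<close>
      reads this back under \<open>P \<theta>\<close>.\<close>
    have "integrable (P \<theta>) (\<lambda>x. 1 * exp (dot K (\<lambda>k. \<theta>w B k - \<theta> k) (T x)))"
      by (subst integrable_change[OF assms mem, symmetric])
        (auto intro!: prob_space_P[OF mem] finite_measure.integrable_const prob_space.finite_measure)
    also have "(\<lambda>x. 1 * exp (dot K (\<lambda>k. \<theta>w B k - \<theta> k) (T x))) = (\<lambda>x. exp (dot K (w B) (T x)))"
      by (auto simp: \<theta>w_def intro!: dot_cong)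
    finally show ?thesis .
  qed
  then have int: "integrable (P \<theta>) (\<lambda>x. \<Sum>B\<in>Pow K. exp (dot K (w B) (T x)))"
    by (intro Bochner_Integration.integrable_sum)
  have "exp (\<rho> * l1 K t) \<le> (\<Sum>B\<in>Pow K. exp (dot K (w B) t))" for t
  proof -
    have "exp (\<rho> * l1 K t) = (\<Prod>k\<in>K. exp (\<rho> * \<bar>t k\<bar>))"
      by (simp add: l1_def exp_sum sum_distrib_left)
    also have "\<dots> \<le> (\<Prod>k\<in>K. exp (\<rho> * t k) + exp (- \<rho> * t k))"
      by (intro prod_mono) (auto simp: abs_if)
    also have "\<dots> = (\<Sum>B\<in>Pow K. (\<Prod>k\<in>B. exp (\<rho> * t k)) * (\<Prod>k\<in>K - B. exp (- \<rho> * t k)))"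
      by (rule prod_add) simp
    also have "\<dots> = (\<Sum>B\<in>Pow K. exp (dot K (w B) t))"
    proof (intro sum.cong refl)
      fix B assume "B \<in> Pow K"
      then have B: "B \<subseteq> K" "finite B"
        using finite_subset by auto
      have "dot K (w B) t = (\<Sum>k\<in>B. w B k * t k) + (\<Sum>k\<in>K - B. w B k * t k)"
        unfolding dot_def using B by (simp add: sum.subset_diff add.commute)
      also have "\<dots> = (\<Sum>k\<in>B. \<rho> * t k) + (\<Sum>k\<in>K - B. - \<rho> * t k)"
        by (intro arg_cong2[where f = "(+)"] sum.cong) (auto simp: w_def)
      finally show "(\<Prod>k\<in>B. exp (\<rho> * t k)) * (\<Prod>k\<in>K - B. exp (- \<rho> * t k)) = exp (dot K (w B) t)"
        using B by (simp add: exp_sum[symmetric] exp_add[symmetric])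
    qed
    finally show ?thesis .
  qed
  then have "integrable (P \<theta>) (\<lambda>x. exp (\<rho> * l1 K (T x)))"
    by (intro integrable_abs_le[OF int]) simp_all
  then show ?thesis
    using that \<rho>(1) by blast
qed

text \<open>The cube is the power that \<open>mean_expansion\<close> needs: one factor
  \<open>1 + s\<close> bounds the centred statistic and two come from the quadratic remainder of
  \<open>exp\<close>.\<close>

definition dominator :: "real \<Rightarrow> 'x \<Rightarrow> real" where
  "dominator r x = (1 + l1 K (T x)) ^ 3 * exp (r * l1 K (T x))"

lemma measurable_dominator [measurable]: "dominator r \<in> borel_measurable (base E)"
  unfolding dominator_def by measurable

lemma dominator_nonneg: "0 \<le> dominator r x"
  by (simp add: dominator_def l1_nonneg)

lemma integrable_dominator:
  assumes "\<theta> \<in> params E"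
  obtains r where "0 < r" "integrable (P \<theta>) (dominator r)"
proof -
  obtain \<rho> where \<rho>: "0 < \<rho>" "integrable (P \<theta>) (\<lambda>x. exp (\<rho> * l1 K (T x)))"
    using integrable_exp_l1[OF assms] .
  \<comment> \<open>Each factor \<open>1 + s\<close> is at most
    \<open>(1 + 6 / \<rho>) * exp (\<rho> * s / 6)\<close>, so the cube costs
    \<open>exp (\<rho> * s / 2)\<close> and leaves the other half for the exponential in the
    dominator.\<close>
  define C where "C = (1 + 6 / \<rho>) ^ 3"
  have "dominator (\<rho> / 2) x \<le> C * exp (\<rho> * l1 K (T x))" for x
  proof -
    let ?s = "l1 K (T x)"
    have s: "0 \<le> ?s" by (rule l1_nonneg)
    have "1 + ?s \<le> (1 + 6 / \<rho>) * (1 + \<rho> * ?s / 6)"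
      using \<rho>(1) s by (simp add: field_simps)
    also have "\<dots> \<le> (1 + 6 / \<rho>) * exp (\<rho> * ?s / 6)"
      using \<rho>(1) by (intro mult_left_mono) auto
    finally have "(1 + ?s) ^ 3 \<le> ((1 + 6 / \<rho>) * exp (\<rho> * ?s / 6)) ^ 3"
      using s by (intro power_mono) auto
    also have "\<dots> = C * exp (\<rho> * ?s / 2)"
      by (simp add: C_def power_mult_distrib exp_of_nat_mult[symmetric])
    finally have "dominator (\<rho> / 2) x \<le> C * exp (\<rho> * ?s / 2) * exp (\<rho> / 2 * ?s)"
      unfolding dominator_def by (intro mult_right_mono) auto
    also have "\<dots> = C * exp (\<rho> * ?s)"
      by (simp add: mult.assoc exp_add[symmetric])
    finally show ?thesis .
  qed
  then have "integrable (P \<theta>) (dominator (\<rho> / 2))"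
    using \<rho>(2) dominator_nonneg
    by - (rule integrable_abs_le[of _ "\<lambda>x. C * exp (\<rho> * l1 K (T x))"], simp_all)
  with \<rho>(1) show ?thesis
    using that[of "\<rho> / 2"] by simp
qed

lemma integrable_dominated:
  assumes "integrable (P \<theta>) (dominator r)" "f \<in> borel_measurable (base E)"
    and "\<And>x. \<bar>f x\<bar> \<le> C * dominator r x"
  shows "integrable (P \<theta>) f" "\<bar>\<integral>x. f x \<partial>P \<theta>\<bar> \<le> C * (\<integral>x. dominator r x \<partial>P \<theta>)"
proof -
  have i: "integrable (P \<theta>) (\<lambda>x. C * dominator r x)"
    using assms(1) by simp
  show f: "integrable (P \<theta>) f"
    using assms(2,3) by (intro integrable_abs_le[OF i]) simp_all
  have "\<bar>\<integral>x. f x \<partial>P \<theta>\<bar> \<le> (\<integral>x. \<bar>f x\<bar> \<partial>P \<theta>)"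
    by (rule integral_abs_bound)
  also have "\<dots> \<le> (\<integral>x. C * dominator r x \<partial>P \<theta>)"
    using f i assms(3) by (intro integral_mono) auto
  finally show "\<bar>\<integral>x. f x \<partial>P \<theta>\<bar> \<le> C * (\<integral>x. dominator r x \<partial>P \<theta>)"
    by simp
qed

lemma poly_le_dominator:
  assumes "0 < r" "n \<le> 3" "0 \<le> t" "t \<le> r * l1 K (T x)"
  shows "l1 K (T x) ^ n * exp t \<le> dominator r x" "(1 + l1 K (T x)) ^ n * exp t \<le> dominator r x"
proof -
  have "(1 + l1 K (T x)) ^ n \<le> (1 + l1 K (T x)) ^ 3"
    using assms(2) l1_nonneg[of K "T x"] by (intro power_increasing) auto
  then show *: "(1 + l1 K (T x)) ^ n * exp t \<le> dominator r x"
    unfolding dominator_def using assms l1_nonneg[of K "T x"] by (intro mult_mono) auto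
  have "l1 K (T x) ^ n \<le> (1 + l1 K (T x)) ^ n"
    using l1_nonneg[of K "T x"] by (intro power_mono) auto
  then show "l1 K (T x) ^ n * exp t \<le> dominator r x"
    using * by (meson exp_ge_zero mult_right_mono order_trans)
qed

lemma moments:
  assumes "\<theta> \<in> params E"
  shows integrable_stat: "k \<in> K \<Longrightarrow> integrable (P \<theta>) (\<lambda>x. T x k)"
    and integrable_stat_mult: "k \<in> K \<Longrightarrow> l \<in> K \<Longrightarrow> integrable (P \<theta>) (\<lambda>x. T x k * T x l)"
proof -
  obtain r where r: "0 < r" "integrable (P \<theta>) (dominator r)"
    using integrable_dominator[OF assms] .
  have s: "l1 K (T x) ^ n \<le> dominator r x" if "n \<le> 3" for x n
    using poly_le_dominator(1)[OF r(1) that, of 0 x] r(1) l1_nonneg[of K "T x"] by simp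
  show "integrable (P \<theta>) (\<lambda>x. T x k)" if "k \<in> K"
    using that s[of 1] by (intro integrable_dominated(1)[OF r(2), of _ 1])
      (auto intro: order_trans[OF abs_le_l1])
  show "integrable (P \<theta>) (\<lambda>x. T x k * T x l)" if "k \<in> K" "l \<in> K"
  proof (rule integrable_dominated(1)[OF r(2), of _ 1])
    fix x
    have "\<bar>T x k * T x l\<bar> \<le> l1 K (T x) * l1 K (T x)"
      unfolding abs_mult using that by (intro mult_mono abs_le_l1 l1_nonneg) auto
    then show "\<bar>T x k * T x l\<bar> \<le> 1 * dominator r x"
      using s[of 2 x] by (simp add: power2_eq_square)
  qed (use that in auto)
qed

abbreviation dst :: "('k \<Rightarrow> real) \<Rightarrow> ('k \<Rightarrow> real) \<Rightarrow> real" where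
  "dst \<theta>' \<theta> \<equiv> l1 K (\<lambda>k. \<theta>' k - \<theta> k)"

lemma integrable_const_P:
  fixes c :: real
  assumes "\<theta> \<in> params E"
  shows "integrable (P \<theta>) (\<lambda>x. c)"
proof -
  interpret prob_space "P \<theta>"
    by (rule prob_space_P[OF assms])
  show ?thesis
    by simp
qed

lemma integrable_exp_shift:
  assumes "\<theta> \<in> params E" "\<theta>' \<in> params E"
  shows "integrable (P \<theta>) (\<lambda>x. exp (dot K (\<lambda>k. \<theta>' k - \<theta> k) (T x)))"
proof -
  have "integrable (P \<theta>) (\<lambda>x. 1 * exp (dot K (\<lambda>k. \<theta>' k - \<theta> k) (T x)))"
    by (rule iffD1[OF integrable_change[OF assms borel_measurable_const] integrable_const_P[OF assms(2)]])
  then show ?thesis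
    by simp
qed

section \<open>Covariances\<close>

lemma integrable_centered_mult:
  assumes "\<theta> \<in> params E" "k \<in> K" "l \<in> K"
  shows "integrable (P \<theta>) (\<lambda>x. (T x k - a) * (T x l - b))"
proof -
  have "integrable (P \<theta>) (\<lambda>x. T x k * T x l - a * T x l - b * T x k + a * b)"
    using assms by (intro Bochner_Integration.integrable_add Bochner_Integration.integrable_diff
      integrable_mult_right integrable_stat integrable_stat_mult integrable_const_P)
  then show ?thesis
    by (simp add: algebra_simps)
qed

lemma integral_const_P:
  fixes c :: real
  assumes "\<theta> \<in> params E"
  shows "(\<integral>x. c \<partial>P \<theta>) = c"
proof -
  interpret prob_space "P \<theta>"
    by (rule prob_space_P[OF assms])
  show ?thesis
    by (simp add: prob_space)
qed

lemma integral_centered: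
  assumes "\<theta> \<in> params E" "k \<in> K"
  shows "(\<integral>x. T x k - mean \<theta> k \<partial>P \<theta>) = 0"
  using integrable_stat[OF assms] integrable_const_P[OF assms(1)] integral_const_P[OF assms(1)]
  by (simp add: mean_def)

lemma Var_eq: "Var E (P \<theta>) k l = (\<integral>x. (T x k - mean \<theta> k) * (T x l - mean \<theta> l) \<partial>P \<theta>)"
  by (simp add: Var_def Cov_def mean_def)

text \<open>This is the linear term of \<open>mean_expansion\<close>. Centring one factor suffices,
  because a constant in the other is multiplied by a function of mean zero.\<close>

lemma Var_apply:
  assumes "\<theta> \<in> params E" "k \<in> K"
  shows "(\<Sum>l\<in>K. Var E (P \<theta>) k l * v l) = (\<integral>x. (T x k - mean \<theta> k) * dot K v (T x) \<partial>P \<theta>)"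
    and "integrable (P \<theta>) (\<lambda>x. (T x k - mean \<theta> k) * dot K v (T x))"
proof -
  have i: "integrable (P \<theta>) (\<lambda>x. (T x k - mean \<theta> k) * T x l)" if "l \<in> K" for l
    using integrable_centered_mult[OF assms that, of "mean \<theta> k" 0] by simp
  have e: "(T x k - mean \<theta> k) * dot K v (T x) = (\<Sum>l\<in>K. v l * ((T x k - mean \<theta> k) * T x l))" for x
    by (simp add: dot_def sum_distrib_left mult.left_commute)
  show "integrable (P \<theta>) (\<lambda>x. (T x k - mean \<theta> k) * dot K v (T x))"
    unfolding e by (intro Bochner_Integration.integrable_sum integrable_mult_right i)
  have "Var E (P \<theta>) k l = (\<integral>x. (T x k - mean \<theta> k) * T x l \<partial>P \<theta>)" if "l \<in> K" for l
  proof -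
    have "Var E (P \<theta>) k l =
        (\<integral>x. (T x k - mean \<theta> k) * T x l - mean \<theta> l * (T x k - mean \<theta> k) \<partial>P \<theta>)"
      by (simp add: Var_eq algebra_simps)
    also have "\<dots> = (\<integral>x. (T x k - mean \<theta> k) * T x l \<partial>P \<theta>) -
        (\<integral>x. mean \<theta> l * (T x k - mean \<theta> k) \<partial>P \<theta>)"
      using assms that i[OF that]
      by (intro Bochner_Integration.integral_diff integrable_mult_right
          Bochner_Integration.integrable_diff integrable_stat integrable_const_P)
    finally show ?thesis
      using integral_centered[OF assms] by simp
  qed
  then show "(\<Sum>l\<in>K. Var E (P \<theta>) k l * v l) = (\<integral>x. (T x k - mean \<theta> k) * dot K v (T x) \<partial>P \<theta>)"
    unfolding e using i by (subst Bochner_Integration.integral_sum)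
      (auto simp: mult.commute intro!: sum.cong)
qed

text \<open>The quadratic form is the variance of \<open>dot K v (T x)\<close>, so positive
  definiteness says that this combination is not almost surely constant.\<close>

lemma Var_quadratic:
  assumes "\<theta> \<in> params E"
  shows "(\<Sum>k\<in>K. \<Sum>l\<in>K. v k * Var E (P \<theta>) k l * v l) =
      (\<integral>x. (dot K v (T x) - dot K v (mean \<theta>))\<^sup>2 \<partial>P \<theta>)"
proof -
  have d: "dot K v (T x) - dot K v (mean \<theta>) = (\<Sum>k\<in>K. v k * (T x k - mean \<theta> k))" for x
    by (simp add: dot_def right_diff_distrib sum_subtractf)
  have e: "(dot K v (T x) - dot K v (mean \<theta>))\<^sup>2 =
      (\<Sum>k\<in>K. \<Sum>l\<in>K. v k * v l * ((T x k - mean \<theta> k) * (T x l - mean \<theta> l)))" for x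
    unfolding d power2_eq_square sum_product by (intro sum.cong refl) (simp only: mult_ac)
  have i: "integrable (P \<theta>) (\<lambda>x. v k * v l * ((T x k - mean \<theta> k) * (T x l - mean \<theta> l)))"
    if "k \<in> K" "l \<in> K" for k l
    by (intro integrable_mult_right integrable_centered_mult assms that)
  have "(\<integral>x. (dot K v (T x) - dot K v (mean \<theta>))\<^sup>2 \<partial>P \<theta>) =
      (\<Sum>k\<in>K. \<integral>x. (\<Sum>l\<in>K. v k * v l * ((T x k - mean \<theta> k) * (T x l - mean \<theta> l))) \<partial>P \<theta>)"
    unfolding e by (intro Bochner_Integration.integral_sum Bochner_Integration.integrable_sum i)
  also have "\<dots> = (\<Sum>k\<in>K. \<Sum>l\<in>K. \<integral>x. v k * v l * ((T x k - mean \<theta> k) * (T x l - mean \<theta> l)) \<partial>P \<theta>)"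
    by (intro sum.cong refl Bochner_Integration.integral_sum i)
  also have "\<dots> = (\<Sum>k\<in>K. \<Sum>l\<in>K. v k * Var E (P \<theta>) k l * v l)"
    by (intro sum.cong refl) (simp add: Var_eq)
  finally show ?thesis by simp
qed

lemma partition_ratio:
  assumes "\<theta> \<in> params E"
  shows "(\<integral>x. exp (dot K (\<lambda>k. \<theta>' k - \<theta> k) (T x)) \<partial>P \<theta>) = Z \<theta>' / Z \<theta>"
  unfolding partition_change[OF assms, of \<theta>'] using partition_pos[OF assms] by simp

section \<open>Strict convexity of the log partition function\<close>

text \<open>Let \<open>y\<close> be the centred statistic in the direction \<theta>' - \<theta>. The
  integral of \<open>exp y - 1 - y\<close> is nonnegative; if it vanished, \<open>y\<close> would be
  0 almost everywhere and its variance 0, against positive definiteness. Hence \<open>exp y\<close>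
  has mean above 1, and taking logarithms gives the claim without differentiating under the
  integral.\<close>

lemma log_partition_gradient_less:
  assumes "\<theta> \<in> params E" "\<theta>' \<in> params E" "\<exists>k\<in>K. \<theta>' k \<noteq> \<theta> k"
  shows "log_partition E \<theta> + dot K (\<lambda>k. \<theta>' k - \<theta> k) (mean \<theta>) < log_partition E \<theta>'"
proof -
  let ?v = "\<lambda>k. \<theta>' k - \<theta> k"
  define m where "m = dot K ?v (mean \<theta>)"
  define y where "y x = dot K ?v (T x) - m" for x
  have [measurable]: "y \<in> borel_measurable (base E)"
    unfolding y_def by measurable
  have iy: "integrable (P \<theta>) y" "(\<integral>x. y x \<partial>P \<theta>) = 0"
  proof -
    have id: "integrable (P \<theta>) (\<lambda>x. dot K ?v (T x))"
      unfolding dot_def using assms(1) by (intro Bochner_Integration.integrable_sum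
          integrable_mult_right integrable_stat)
    then show "integrable (P \<theta>) y"
      unfolding y_def using assms(1) by (intro Bochner_Integration.integrable_diff integrable_const_P)
    have "(\<integral>x. dot K ?v (T x) \<partial>P \<theta>) = m"
      unfolding dot_def m_def mean_def using integrable_stat[OF assms(1)]
      by (subst Bochner_Integration.integral_sum) auto
    then show "(\<integral>x. y x \<partial>P \<theta>) = 0"
      unfolding y_def using id integrable_const_P[OF assms(1)] integral_const_P[OF assms(1)]
      by (subst Bochner_Integration.integral_diff) auto
  qed
  have ey: "exp (y x) = exp (- m) * exp (dot K ?v (T x))" for x
    by (simp add: y_def exp_diff exp_minus field_simps)
  have ie: "integrable (P \<theta>) (\<lambda>x. exp (y x))"
    unfolding ey using integrable_exp_shift[OF assms(1,2)] by (intro integrable_mult_right)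
  have Ee: "(\<integral>x. exp (y x) \<partial>P \<theta>) = exp (- m) * (Z \<theta>' / Z \<theta>)"
    unfolding ey by (simp add: partition_ratio[OF assms(1)])
  have ig: "integrable (P \<theta>) (\<lambda>x. exp (y x) - (1 + y x))"
    using assms(1) iy(1) ie by (intro Bochner_Integration.integrable_diff
      Bochner_Integration.integrable_add integrable_const_P)
  have Eg: "(\<integral>x. exp (y x) - (1 + y x) \<partial>P \<theta>) = exp (- m) * (Z \<theta>' / Z \<theta>) - 1"
    using assms(1) iy ie integrable_const_P[OF assms(1), of 1] integral_const_P[OF assms(1), of 1] Ee
    by simp
  have "(\<integral>x. exp (y x) - (1 + y x) \<partial>P \<theta>) \<noteq> 0"
  proof
    assume "(\<integral>x. exp (y x) - (1 + y x) \<partial>P \<theta>) = 0"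
    then have "AE x in P \<theta>. exp (y x) - (1 + y x) = 0"
      by (subst (asm) integral_nonneg_eq_0_iff_AE[OF ig]) auto
    then have "AE x in P \<theta>. (y x)\<^sup>2 = 0"
      by eventually_elim (simp add: exp_eq_one_plus_imp)
    then have "(\<integral>x. (y x)\<^sup>2 \<partial>P \<theta>) = 0"
      by (rule integral_eq_zero_AE)
    then have "(\<Sum>k\<in>K. \<Sum>l\<in>K. ?v k * Var E (P \<theta>) k l * ?v l) = 0"
      using Var_quadratic[OF assms(1), of ?v] by (simp add: y_def m_def)
    moreover have "(\<Sum>k\<in>K. \<Sum>l\<in>K. ?v k * Var E (P \<theta>) k l * ?v l) > 0"
      using pos_def_Var[OF assms(1)] assms(3) unfolding pos_def_def by auto
    ultimately show False by simp
  qed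
  moreover have "(\<integral>x. exp (y x) - (1 + y x) \<partial>P \<theta>) \<ge> 0"
    by (intro Bochner_Integration.integral_nonneg) simp
  ultimately have "1 < exp (- m) * (Z \<theta>' / Z \<theta>)"
    unfolding Eg by linarith
  then have "exp m * 1 < exp m * (exp (- m) * (Z \<theta>' / Z \<theta>))"
    by (rule mult_strict_left_mono) simp
  then have "exp m < Z \<theta>' / Z \<theta>"
    by (simp add: mult.assoc[symmetric] exp_add[symmetric])
  then have "ln (exp m) < ln (Z \<theta>' / Z \<theta>)"
    using partition_pos assms by (subst ln_less_cancel_iff) auto
  then show ?thesis
    using partition_pos[OF assms(1)] partition_pos[OF assms(2)]
    by (simp add: ln_div log_partition_def m_def)
qed

lemma log_partition_gradient_le:
  assumes "\<theta> \<in> params E" "\<theta>' \<in> params E"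
  shows "log_partition E \<theta> + dot K (\<lambda>k. \<theta>' k - \<theta> k) (mean \<theta>) \<le> log_partition E \<theta>'"
proof (cases "\<exists>k\<in>K. \<theta>' k \<noteq> \<theta> k")
  case False
  then have "\<theta>' = \<theta>"
    using params_extensional[OF assms(1)] params_extensional[OF assms(2)]
    by (intro extensionalityI) auto
  then show ?thesis
    by (simp add: dot_def)
qed (use log_partition_gradient_less[OF assms] in simp)

text \<open>Adding the strict gradient inequalities from \<theta> to \<theta>' and back gives
  \<open>0 < 0\<close> when the means agree.\<close>

lemma mean_injective:
  assumes "\<theta> \<in> params E" "\<theta>' \<in> params E" "\<And>k. k \<in> K \<Longrightarrow> mean \<theta> k = mean \<theta>' k"
  shows "\<theta> = \<theta>'"
proof (rule ccontr)
  assume "\<theta> \<noteq> \<theta>'"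
  then have ne: "\<exists>k\<in>K. \<theta>' k \<noteq> \<theta> k"
    using params_extensional[OF assms(1)] params_extensional[OF assms(2)]
    by (metis extensionalityI)
  then have ne': "\<exists>k\<in>K. \<theta> k \<noteq> \<theta>' k" by metis
  have "dot K (\<lambda>k. \<theta> k - \<theta>' k) (mean \<theta>') = - dot K (\<lambda>k. \<theta>' k - \<theta> k) (mean \<theta>)"
    using assms(3) by (simp add: dot_diff_left dot_def)
  then show False
    using log_partition_gradient_less[OF assms(1,2) ne]
      log_partition_gradient_less[OF assms(2,1) ne'] by linarith
qed

section \<open>Expansion of the moment map\<close>

text \<open>This controls the denominator in \<open>integral_change\<close> and yields continuity of
  the partition function.\<close>

lemma partition_ratio_near_one:
  assumes "\<theta> \<in> params E"
  obtains C r where "0 \<le> C" "0 < r"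
    "\<And>\<theta>'. \<theta>' \<in> params E \<Longrightarrow> dst \<theta>' \<theta> \<le> r \<Longrightarrow> \<bar>Z \<theta>' / Z \<theta> - 1\<bar> \<le> C * dst \<theta>' \<theta>"
proof -
  obtain r where r: "0 < r" "integrable (P \<theta>) (dominator r)"
    using integrable_dominator[OF assms] .
  define C where "C = (\<integral>x. dominator r x \<partial>P \<theta>)"
  show ?thesis
  proof (rule that[of C r])
    show "0 \<le> C"
      unfolding C_def by (simp add: dominator_nonneg)
    fix \<theta>' assume \<theta>': "\<theta>' \<in> params E" "dst \<theta>' \<theta> \<le> r"
    let ?v = "\<lambda>k. \<theta>' k - \<theta> k"
    have "\<bar>exp (dot K ?v (T x)) - 1\<bar> \<le> dst \<theta>' \<theta> * dominator r x" for x
    proof -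
      have d: "\<bar>dot K ?v (T x)\<bar> \<le> dst \<theta>' \<theta> * l1 K (T x)"
        by (rule abs_dot_le) simp
      also have "\<dots> \<le> r * l1 K (T x)"
        using \<theta>'(2) by (intro mult_right_mono l1_nonneg)
      finally have "l1 K (T x) ^ 1 * exp \<bar>dot K ?v (T x)\<bar> \<le> dominator r x"
        using r(1) by (intro poly_le_dominator) auto
      then have "dst \<theta>' \<theta> * (l1 K (T x) * exp \<bar>dot K ?v (T x)\<bar>) \<le> dst \<theta>' \<theta> * dominator r x"
        by (intro mult_left_mono l1_nonneg) simp
      moreover have "\<bar>exp (dot K ?v (T x)) - 1\<bar> \<le> \<bar>dot K ?v (T x)\<bar> * exp \<bar>dot K ?v (T x)\<bar>"
        by (rule abs_exp_minus_one_le)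
      moreover have "\<bar>dot K ?v (T x)\<bar> * exp \<bar>dot K ?v (T x)\<bar> \<le>
          dst \<theta>' \<theta> * l1 K (T x) * exp \<bar>dot K ?v (T x)\<bar>"
        by (intro mult_right_mono d) simp
      ultimately show ?thesis
        unfolding mult.assoc by linarith
    qed
    then have "\<bar>\<integral>x. exp (dot K ?v (T x)) - 1 \<partial>P \<theta>\<bar> \<le> dst \<theta>' \<theta> * C"
      unfolding C_def by (intro integrable_dominated(2)[OF r(2)]) auto
    also have "(\<integral>x. exp (dot K ?v (T x)) - 1 \<partial>P \<theta>) = Z \<theta>' / Z \<theta> - 1"
      using integrable_exp_shift[OF assms \<theta>'(1)] integrable_const_P[OF assms, of 1]
        integral_const_P[OF assms, of 1]
      by (simp add: partition_ratio[OF assms])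
    finally show "\<bar>Z \<theta>' / Z \<theta> - 1\<bar> \<le> C * dst \<theta>' \<theta>"
      by (simp add: mult.commute)
  qed (use r in auto)
qed

lemma abs_Var_apply_le:
  assumes "k \<in> K"
  shows "\<bar>\<Sum>l\<in>K. Var E b k l * v l\<bar> \<le> (\<Sum>k\<in>K. \<Sum>l\<in>K. \<bar>Var E b k l\<bar>) * l1 K v"
proof -
  have "\<bar>\<Sum>l\<in>K. Var E b k l * v l\<bar> \<le> (\<Sum>l\<in>K. \<bar>Var E b k l\<bar> * l1 K v)"
    by (rule order_trans[OF sum_abs]) (auto simp: abs_mult intro!: sum_mono mult_left_mono abs_le_l1)
  also have "\<dots> \<le> (\<Sum>k\<in>K. \<Sum>l\<in>K. \<bar>Var E b k l\<bar>) * l1 K v"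
    unfolding sum_distrib_right[symmetric] using assms
    by (intro mult_right_mono l1_nonneg member_le_sum[of k K "\<lambda>k. \<Sum>l\<in>K. \<bar>Var E b k l\<bar>"])
      (auto simp: sum_nonneg)
  finally show ?thesis .
qed

text \<open>Let \<open>f\<close> be the centred component and \<open>y\<close> the exponent of the
  tilt. In \<open>f * exp y = f + f * y + f * (exp y - 1 - y)\<close> the summands have integrals 0,
  the covariance term \<open>A\<close>, and a quadratic remainder \<open>R\<close>. Dividing by the
  normaliser \<open>D\<close> leaves the error \<open>(R - A * (D - 1)) / D\<close>, which is
  quadratic since \<open>A\<close> and \<open>D - 1\<close> are both of first order in the
  distance.\<close>

lemma mean_expansion:
  assumes \<theta>: "\<theta> \<in> params E"
  obtains C r where "0 \<le> C" "0 < r"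
    "\<And>\<theta>' k. \<theta>' \<in> params E \<Longrightarrow> dst \<theta>' \<theta> \<le> r \<Longrightarrow> k \<in> K \<Longrightarrow>
      \<bar>mean \<theta>' k - mean \<theta> k - (\<Sum>l\<in>K. Var E (P \<theta>) k l * (\<theta>' l - \<theta> l))\<bar> \<le> C * (dst \<theta>' \<theta>)\<^sup>2"
proof -
  obtain r where r: "0 < r" "integrable (P \<theta>) (dominator r)"
    using integrable_dominator[OF \<theta>] .
  obtain C0 r0 where C0: "0 \<le> C0" "0 < r0"
    "\<And>\<theta>'. \<theta>' \<in> params E \<Longrightarrow> dst \<theta>' \<theta> \<le> r0 \<Longrightarrow> \<bar>Z \<theta>' / Z \<theta> - 1\<bar> \<le> C0 * dst \<theta>' \<theta>"
    using partition_ratio_near_one[OF \<theta>] by blast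
  define G where "G = (\<integral>x. dominator r x \<partial>P \<theta>)"
  \<comment> \<open>Chosen so that the centred statistic is at most \<open>M * (1 + s)\<close>,
    where \<open>s\<close> is the norm of the statistic.\<close>
  define M where "M = 1 + (\<Sum>k\<in>K. \<bar>mean \<theta> k\<bar>)"
  define V where "V = (\<Sum>k\<in>K. \<Sum>l\<in>K. \<bar>Var E (P \<theta>) k l\<bar>)"
  \<comment> \<open>The last bound forces \<open>C0 * n <= 1 / 2\<close>, hence
    \<open>1 / 2 <= D\<close>; this is the factor 2 in the final constant.\<close>
  define r1 where "r1 = min r (min r0 (1 / (2 * C0 + 1)))"
  have G0: "0 \<le> G" unfolding G_def by (simp add: dominator_nonneg)
  have M1: "1 \<le> M" unfolding M_def by (simp add: sum_nonneg)
  have V0: "0 \<le> V" unfolding V_def by (simp add: sum_nonneg)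
  show ?thesis
  proof (rule that[of "2 * (M * G + V * C0)" r1])
    show "0 \<le> 2 * (M * G + V * C0)"
      using G0 M1 V0 C0(1) by simp
    show "0 < r1"
      using r(1) C0(1,2) by (simp add: r1_def)
    fix \<theta>' k assume \<theta>': "\<theta>' \<in> params E" "dst \<theta>' \<theta> \<le> r1" and k: "k \<in> K"
    let ?v = "\<lambda>k. \<theta>' k - \<theta> k"
    define n where "n = dst \<theta>' \<theta>"
    define y where "y x = dot K ?v (T x)" for x
    define f where "f x = T x k - mean \<theta> k" for x
    define A where "A = (\<Sum>l\<in>K. Var E (P \<theta>) k l * ?v l)"
    define D where "D = Z \<theta>' / Z \<theta>"
    define R where "R = (\<integral>x. f x * (exp (y x) - 1 - y x) \<partial>P \<theta>)"
    have n: "0 \<le> n" "n \<le> r" "n \<le> r0" "n \<le> 1 / (2 * C0 + 1)"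
      using \<theta>'(2) l1_nonneg by (auto simp: n_def r1_def)
    have [measurable]: "f \<in> borel_measurable (base E)" "y \<in> borel_measurable (base E)"
      unfolding f_def y_def using k by measurable
    have bound: "\<bar>f x * (exp (y x) - 1 - y x)\<bar> \<le> (M * n\<^sup>2) * dominator r x" for x
    proof -
      let ?s = "l1 K (T x)"
      have s: "0 \<le> ?s" by (rule l1_nonneg)
      have y: "\<bar>y x\<bar> \<le> n * ?s"
        unfolding y_def n_def by (rule abs_dot_le) simp
      also have "\<dots> \<le> r * ?s"
        using n s by (intro mult_right_mono)
      finally have dom: "(1 + ?s) ^ 3 * exp \<bar>y x\<bar> \<le> dominator r x"
        using r(1) by (intro poly_le_dominator) auto
      have "\<bar>f x\<bar> \<le> M * (1 + ?s)"
      proof -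
        have "\<bar>mean \<theta> k\<bar> \<le> M - 1"
          unfolding M_def using k by (simp add: member_le_sum[of k K "\<lambda>k. \<bar>mean \<theta> k\<bar>"])
        then have "\<bar>f x\<bar> \<le> ?s + M"
          using abs_le_l1[OF finite_index k, of "T x"] by (auto simp: f_def)
        also have "\<dots> \<le> M * (1 + ?s)"
          using M1 s mult_right_mono[of 1 M ?s] by (simp add: distrib_left)
        finally show ?thesis .
      qed
      moreover have "\<bar>exp (y x) - 1 - y x\<bar> \<le> n\<^sup>2 * (1 + ?s)\<^sup>2 * exp \<bar>y x\<bar>"
      proof -
        have "\<bar>y x\<bar>\<^sup>2 \<le> (n * (1 + ?s))\<^sup>2"
          using y n(1) by (intro power_mono) (auto simp: distrib_left)
        then have "(y x)\<^sup>2 * exp \<bar>y x\<bar> \<le> n\<^sup>2 * (1 + ?s)\<^sup>2 * exp \<bar>y x\<bar>"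
          by (intro mult_right_mono) (auto simp: power_mult_distrib)
        then show ?thesis
          using abs_exp_minus_one_minus_le[of "y x"] by linarith
      qed
      ultimately have "\<bar>f x * (exp (y x) - 1 - y x)\<bar> \<le>
          (M * (1 + ?s)) * (n\<^sup>2 * (1 + ?s)\<^sup>2 * exp \<bar>y x\<bar>)"
        unfolding abs_mult using M1 s by (intro mult_mono) auto
      also have "\<dots> = (M * n\<^sup>2) * ((1 + ?s) ^ 3 * exp \<bar>y x\<bar>)"
        by (simp add: power2_eq_square power3_eq_cube mult_ac)
      also have "\<dots> \<le> (M * n\<^sup>2) * dominator r x"
        using M1 by (intro mult_left_mono dom) auto
      finally show ?thesis .
    qed
    have meas: "(\<lambda>x. f x * (exp (y x) - 1 - y x)) \<in> borel_measurable (base E)"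
      by measurable
    have iR: "integrable (P \<theta>) (\<lambda>x. f x * (exp (y x) - 1 - y x))"
      by (rule integrable_dominated(1)[OF r(2) meas bound])
    have R: "\<bar>R\<bar> \<le> M * n\<^sup>2 * G"
      unfolding R_def G_def by (rule integrable_dominated(2)[OF r(2) meas bound])
    have if': "integrable (P \<theta>) f" "(\<integral>x. f x \<partial>P \<theta>) = 0"
      unfolding f_def using integral_centered[OF \<theta> k]
      by (auto intro!: Bochner_Integration.integrable_diff integrable_stat integrable_const_P \<theta> k)
    have ify: "integrable (P \<theta>) (\<lambda>x. f x * y x)" "(\<integral>x. f x * y x \<partial>P \<theta>) = A"
      unfolding f_def y_def A_def using Var_apply[OF \<theta> k, of ?v] by simp_all
    have "(\<lambda>x. f x * exp (y x)) = (\<lambda>x. f x + f x * y x + f x * (exp (y x) - 1 - y x))"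
      by (auto simp: algebra_simps)
    then have N: "(\<integral>x. f x * exp (y x) \<partial>P \<theta>) = A + R"
      using if' ify iR by (simp add: R_def)
    have "mean \<theta>' k - mean \<theta> k = (\<integral>x. f x \<partial>P \<theta>')"
      unfolding f_def using integrable_stat[OF \<theta>'(1) k] integrable_const_P[OF \<theta>'(1)]
        integral_const_P[OF \<theta>'(1)]
      by (simp add: mean_def)
    also have "\<dots> = (A + R) / D"
      using integral_change[OF \<theta> \<theta>'(1), of f] N by (simp add: partition_ratio[OF \<theta>] D_def y_def)
    finally have eq: "mean \<theta>' k - mean \<theta> k - A = (R - A * (D - 1)) / D"
      using partition_pos[OF \<theta>] partition_pos[OF \<theta>'(1)] by (simp add: D_def field_simps)
    have D1: "\<bar>D - 1\<bar> \<le> C0 * n"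
      using C0(3)[OF \<theta>'(1)] n(3) by (simp add: D_def n_def)
    have "C0 * n \<le> C0 * (1 / (2 * C0 + 1))"
      using C0(1) n(4) by (intro mult_left_mono)
    also have "\<dots> \<le> 1 / 2"
      using C0(1) by (simp add: field_simps)
    finally have D2: "1 / 2 \<le> D"
      using D1 by linarith
    have A: "\<bar>A\<bar> \<le> V * n"
      unfolding A_def V_def n_def by (rule abs_Var_apply_le[OF k])
    have "\<bar>R - A * (D - 1)\<bar> \<le> \<bar>R\<bar> + \<bar>A\<bar> * \<bar>D - 1\<bar>"
      using abs_triangle_ineq4[of R "A * (D - 1)"] by (simp add: abs_mult)
    also have "\<dots> \<le> M * n\<^sup>2 * G + (V * n) * (C0 * n)"
      using n(1) V0 by (intro add_mono mult_mono R A D1) auto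
    also have "\<dots> = (M * G + V * C0) * n\<^sup>2"
      by (simp add: power2_eq_square algebra_simps)
    finally have num: "\<bar>R - A * (D - 1)\<bar> \<le> (M * G + V * C0) * n\<^sup>2" .
    have "\<bar>mean \<theta>' k - mean \<theta> k - A\<bar> = \<bar>R - A * (D - 1)\<bar> / D"
      unfolding eq using D2 by simp
    also have "\<dots> \<le> ((M * G + V * C0) * n\<^sup>2) / (1 / 2)"
      using D2 num by (intro frac_le) (auto simp: G0 V0 M1 C0(1) order_trans[OF _ M1])
    also have "\<dots> = 2 * (M * G + V * C0) * n\<^sup>2"
      by (simp add: algebra_simps)
    finally show "\<bar>mean \<theta>' k - mean \<theta> k - (\<Sum>l\<in>K. Var E (P \<theta>) k l * (\<theta>' l - \<theta> l))\<bar>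
        \<le> 2 * (M * G + V * C0) * (dst \<theta>' \<theta>)\<^sup>2"
      by (simp only: A_def n_def)
  qed
qed

lemma mean_lipschitz_at:
  assumes "\<theta> \<in> params E"
  obtains C r where "0 \<le> C" "0 < r"
    "\<And>\<theta>' k. \<theta>' \<in> params E \<Longrightarrow> dst \<theta>' \<theta> \<le> r \<Longrightarrow> k \<in> K \<Longrightarrow> \<bar>mean \<theta>' k - mean \<theta> k\<bar> \<le> C * dst \<theta>' \<theta>"
proof -
  obtain C r where C: "0 \<le> C" "0 < r"
    "\<And>\<theta>' k. \<theta>' \<in> params E \<Longrightarrow> dst \<theta>' \<theta> \<le> r \<Longrightarrow> k \<in> K \<Longrightarrow>
      \<bar>mean \<theta>' k - mean \<theta> k - (\<Sum>l\<in>K. Var E (P \<theta>) k l * (\<theta>' l - \<theta> l))\<bar> \<le> C * (dst \<theta>' \<theta>)\<^sup>2"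
    using mean_expansion[OF assms] by blast
  define V where "V = (\<Sum>k\<in>K. \<Sum>l\<in>K. \<bar>Var E (P \<theta>) k l\<bar>)"
  show ?thesis
  proof (rule that[of "C * r + V" r])
    show "0 \<le> C * r + V"
      using C(1,2) by (simp add: V_def sum_nonneg)
    fix \<theta>' k assume \<theta>': "\<theta>' \<in> params E" "dst \<theta>' \<theta> \<le> r" and k: "k \<in> K"
    let ?A = "\<Sum>l\<in>K. Var E (P \<theta>) k l * (\<theta>' l - \<theta> l)"
    define n where "n = dst \<theta>' \<theta>"
    have n: "0 \<le> n" "n \<le> r"
      using \<theta>'(2) l1_nonneg by (auto simp: n_def)
    have A: "\<bar>?A\<bar> \<le> V * n"
      unfolding V_def n_def by (rule abs_Var_apply_le[OF k])
    have "C * n\<^sup>2 \<le> C * r * n"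
      unfolding power2_eq_square using C(1) n by (simp add: mult.assoc mult_left_mono mult_right_mono)
    moreover have "\<bar>mean \<theta>' k - mean \<theta> k - ?A\<bar> \<le> C * n\<^sup>2"
      unfolding n_def by (rule C(3)[OF \<theta>' k])
    ultimately have "\<bar>mean \<theta>' k - mean \<theta> k\<bar> \<le> C * r * n + V * n"
      using A by linarith
    then show "\<bar>mean \<theta>' k - mean \<theta> k\<bar> \<le> (C * r + V) * dst \<theta>' \<theta>"
      by (simp add: n_def distrib_right)
  qed (rule C(2))
qed

section \<open>Local surjectivity of the moment map\<close>

text \<open>Continuity refers to the product topology on all functions, in which \<open>dst\<close>
  tends to 0 because it involves finitely many coordinates. It serves the minimisation over a
  compact box in \<open>mean_locally_onto\<close>.\<close>

lemma log_partition_continuous_on: "continuous_on (params E) (log_partition E)"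
proof -
  have "continuous_on (params E) Z"
    unfolding continuous_on_def
  proof
    fix \<theta> assume \<theta>: "\<theta> \<in> params E"
    let ?F = "at \<theta> within params E"
    obtain C r where C: "0 \<le> C" "0 < r"
      "\<And>\<theta>'. \<theta>' \<in> params E \<Longrightarrow> dst \<theta>' \<theta> \<le> r \<Longrightarrow> \<bar>Z \<theta>' / Z \<theta> - 1\<bar> \<le> C * dst \<theta>' \<theta>"
      using partition_ratio_near_one[OF \<theta>] by blast
    have coord: "((\<lambda>\<theta>'. \<theta>' k) \<longlongrightarrow> \<theta> k) ?F" for k
      using continuous_on_product_coordinates[of k] continuous_on_subset[of UNIV _ "params E"] \<theta>
      by (auto simp: continuous_on_def)
    have "((\<lambda>\<theta>'. dst \<theta>' \<theta>) \<longlongrightarrow> (\<Sum>k\<in>K. \<bar>\<theta> k - \<theta> k\<bar>)) ?F"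
      unfolding l1_def by (intro tendsto_intros coord)
    then have dst: "((\<lambda>\<theta>'. dst \<theta>' \<theta>) \<longlongrightarrow> 0) ?F"
      by simp
    have "eventually (\<lambda>\<theta>'. dst \<theta>' \<theta> < r) ?F"
      using order_tendstoD(2)[OF dst C(2)] .
    moreover have "eventually (\<lambda>\<theta>'. \<theta>' \<in> params E) ?F"
      by (simp add: eventually_at_topological) (use open_UNIV in blast)
    ultimately have "eventually (\<lambda>\<theta>'. norm (Z \<theta>' / Z \<theta> - 1) \<le> C * dst \<theta>' \<theta>) ?F"
      by eventually_elim (simp add: C(3))
    then have "((\<lambda>\<theta>'. Z \<theta>' / Z \<theta> - 1) \<longlongrightarrow> 0) ?F"
      by (rule Lim_null_comparison) (use tendsto_mult_right_zero[OF dst] in simp)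
    then have "((\<lambda>\<theta>'. Z \<theta> * ((Z \<theta>' / Z \<theta> - 1) + 1)) \<longlongrightarrow> Z \<theta> * (0 + 1)) ?F"
      by (intro tendsto_intros)
    then show "(Z \<longlongrightarrow> Z \<theta>) ?F"
      using partition_pos[OF \<theta>] by simp
  qed
  then show ?thesis
    unfolding log_partition_def using partition_pos
    by (intro continuous_on_ln) fastforce+
qed

lemma dot_continuous_on: "continuous_on S (\<lambda>\<theta>. dot K \<theta> \<eta>)"
  unfolding dot_def
  by (intro continuous_intros continuous_on_subset[OF continuous_on_product_coordinates]) auto

text \<open>A concave function on a box whose maximum is not on the boundary has a stationary point
  inside; by the strict convexity of the log partition function this survives a small change of
  the mean parameter.\<close>

lemma mean_locally_onto:
  assumes \<theta>0: "\<theta>0 \<in> params E" and "0 < \<epsilon>"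
  obtains \<delta> where "0 < \<delta>"
    "\<And>\<eta>. (\<And>k. k \<in> K \<Longrightarrow> \<bar>\<eta> k - mean \<theta>0 k\<bar> < \<delta>) \<Longrightarrow>
      \<exists>\<theta>\<in>params E. (\<forall>k\<in>K. mean \<theta> k = \<eta> k) \<and> (\<forall>k\<in>K. \<bar>\<theta> k - \<theta>0 k\<bar> < \<epsilon>)"
proof (cases "K = {}")
  case True
  then show ?thesis
    using \<theta>0 by (intro that[of 1]) auto
next
  case K: False
  obtain \<rho>0 where \<rho>0: "0 < \<rho>0"
    "\<And>\<theta>. \<theta> \<in> extensional K \<Longrightarrow> (\<And>k. k \<in> K \<Longrightarrow> \<bar>\<theta> k - \<theta>0 k\<bar> \<le> \<rho>0) \<Longrightarrow> \<theta> \<in> params E"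
    using params_box[OF \<theta>0] by blast
  define \<rho> where "\<rho> = min \<rho>0 (\<epsilon> / 2)"
  have \<rho>: "0 < \<rho>" "\<rho> \<le> \<rho>0" "\<rho> < \<epsilon>"
    using \<rho>0(1) assms(2) by (auto simp: \<rho>_def)
  define B where "B = {\<theta> \<in> extensional K. \<forall>k\<in>K. \<bar>\<theta> k - \<theta>0 k\<bar> \<le> \<rho>}"
  define bd where "bd = B \<inter> (\<Union>k\<in>K. {\<theta>. \<bar>\<theta> k - \<theta>0 k\<bar> = \<rho>})"
  have Bp: "B \<subseteq> params E"
    using \<rho>0(2) \<rho>(2) unfolding B_def by fastforce
  have compB: "compact B"
  proof -
    \<comment> \<open>Extensionality is a product of singletons outside \<open>K\<close>, so the box
      is compact as a product of compact sets.\<close>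
    let ?S = "\<lambda>k. if k \<in> K then {\<theta>0 k - \<rho> .. \<theta>0 k + \<rho>} else {undefined}"
    have "compactin (product_topology (\<lambda>_. euclideanreal) UNIV) (Pi\<^sub>E UNIV ?S)"
      unfolding compactin_PiE by (auto simp: compactin_euclidean_iff)
    then have "compact (Pi\<^sub>E UNIV ?S)"
      by (simp add: euclidean_product_topology compactin_euclidean_iff)
    also have "Pi\<^sub>E UNIV ?S = B"
    proof -
      have "\<theta> k \<in> ?S k \<longleftrightarrow> (if k \<in> K then \<bar>\<theta> k - \<theta>0 k\<bar> \<le> \<rho> else \<theta> k = undefined)" for \<theta> k
        by (auto simp: abs_le_iff)
      then show ?thesis
        unfolding PiE_UNIV_domain B_def extensional_def Pi_def by auto
    qed
    finally show ?thesis .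
  qed
  have coord: "continuous_on UNIV (\<lambda>\<theta> :: 'k \<Rightarrow> real. \<bar>\<theta> k - \<theta>0 k\<bar>)" for k
    by (intro continuous_intros continuous_on_product_coordinates)
  have compbd: "compact bd"
    unfolding bd_def
    by (intro compact_Int_closed compB closed_UN finite_index ballI closed_Collect_eq coord
        continuous_on_const)
  \<comment> \<open>At a stationary point of this convex function the moment map takes the value
    \<eta>.\<close>
  define g where "g \<eta> \<theta> = log_partition E \<theta> - dot K \<theta> \<eta>" for \<eta> \<theta>
  have cont: "continuous_on S (g \<eta>)" if "S \<subseteq> B" for S \<eta>
    unfolding g_def using that Bp
    by (intro continuous_on_diff dot_continuous_on
        continuous_on_subset[OF log_partition_continuous_on]) auto
  have \<theta>0B: "\<theta>0 \<in> B"
    using params_extensional[OF \<theta>0] \<rho>(1) by (simp add: B_def)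
  have gdiff: "g \<eta> \<theta> = g (mean \<theta>0) \<theta> - dot K \<theta> (\<lambda>k. \<eta> k - mean \<theta>0 k)" for \<eta> \<theta>
    by (simp add: g_def dot_diff_right)
  obtain k0 where k0: "k0 \<in> K" using K by blast
  have "bd \<noteq> {}"
  proof -
    have "\<theta>0(k0 := \<theta>0 k0 + \<rho>) \<in> B"
      using k0 params_extensional[OF \<theta>0] \<rho>(1) by (auto simp: B_def extensional_def)
    then have "\<theta>0(k0 := \<theta>0 k0 + \<rho>) \<in> bd"
      using k0 \<rho>(1) by (auto simp: bd_def)
    then show ?thesis by blast
  qed
  then obtain \<theta>b where \<theta>b: "\<theta>b \<in> bd" "\<And>\<theta>. \<theta> \<in> bd \<Longrightarrow> g (mean \<theta>0) \<theta>b \<le> g (mean \<theta>0) \<theta>"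
    using continuous_attains_inf[OF compbd _ cont, of "mean \<theta>0"] by (auto simp: bd_def)
  \<comment> \<open>By strict convexity \<theta>0 beats every boundary point for its own mean;
    compactness of the boundary makes the margin uniform.\<close>
  define gap where "gap = g (mean \<theta>0) \<theta>b - g (mean \<theta>0) \<theta>0"
  have gap: "0 < gap"
  proof -
    have "\<theta>b \<in> params E" "\<exists>k\<in>K. \<theta>b k \<noteq> \<theta>0 k"
      using \<theta>b(1) Bp \<rho>(1) by (auto simp: bd_def)
    from log_partition_gradient_less[OF \<theta>0 this] show ?thesis
      by (simp add: gap_def g_def dot_diff_left)
  qed
  \<comment> \<open>In the box each coordinate of \<theta> - \<theta>0 is at most \<rho> in absolute
    value, so moving the mean by less than \<delta> per coordinate changes the comparison with
    \<theta>0 by less than \<open>gap\<close>.\<close>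
  define \<delta> where "\<delta> = gap / (\<rho> * card K)"
  have cK: "0 < card K"
    using K by (simp add: card_gt_0_iff)
  show ?thesis
  proof (rule that[of \<delta>])
    show "0 < \<delta>"
      using gap \<rho>(1) cK by (simp add: \<delta>_def)
    fix \<eta> assume \<eta>: "\<And>k. k \<in> K \<Longrightarrow> \<bar>\<eta> k - mean \<theta>0 k\<bar> < \<delta>"
    obtain \<theta> where \<theta>: "\<theta> \<in> B" "\<And>\<theta>'. \<theta>' \<in> B \<Longrightarrow> g \<eta> \<theta> \<le> g \<eta> \<theta>'"
      using continuous_attains_inf[OF compB _ cont, of \<eta>] \<theta>0B by auto
    have \<theta>p: "\<theta> \<in> params E"
      using \<theta>(1) Bp by blast
    have notbd: "\<theta> \<notin> bd"
    proof
      assume "\<theta> \<in> bd"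
      then have "gap \<le> g (mean \<theta>0) \<theta> - g (mean \<theta>0) \<theta>0"
        using \<theta>b(2) by (simp add: gap_def)
      also have "\<dots> \<le> dot K (\<lambda>k. \<theta> k - \<theta>0 k) (\<lambda>k. \<eta> k - mean \<theta>0 k)"
        using \<theta>(2)[OF \<theta>0B] gdiff[of \<eta>] by (simp add: dot_diff_left)
      also have "\<dots> \<le> (\<Sum>k\<in>K. \<rho> * \<bar>\<eta> k - mean \<theta>0 k\<bar>)"
        unfolding dot_def
      proof (rule sum_mono)
        fix k assume "k \<in> K"
        have "(\<theta> k - \<theta>0 k) * (\<eta> k - mean \<theta>0 k) \<le> \<bar>\<theta> k - \<theta>0 k\<bar> * \<bar>\<eta> k - mean \<theta>0 k\<bar>"
          by (simp add: abs_mult[symmetric])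
        also have "\<dots> \<le> \<rho> * \<bar>\<eta> k - mean \<theta>0 k\<bar>"
          using \<theta>(1) \<open>k \<in> K\<close> by (intro mult_right_mono) (auto simp: B_def)
        finally show "(\<theta> k - \<theta>0 k) * (\<eta> k - mean \<theta>0 k) \<le> \<rho> * \<bar>\<eta> k - mean \<theta>0 k\<bar>" .
      qed
      also have "\<dots> < (\<Sum>k\<in>K. \<rho> * \<delta>)"
        using \<eta> \<rho>(1) K by (intro sum_strict_mono) auto
      also have "\<dots> = gap"
        using \<rho>(1) cK K by (simp add: \<delta>_def)
      finally show False by simp
    qed
    have inner: "\<bar>\<theta> k - \<theta>0 k\<bar> < \<rho>" if "k \<in> K" for k
      using \<theta>(1) notbd that by (fastforce simp: B_def bd_def)
    \<comment> \<open>Stationarity without a derivative of \<open>g\<close>: a small move by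
      \<open>\<sigma> * t\<close> in coordinate \<open>k\<close> stays in the box, so minimality and
      the gradient inequality at the moved point fix the sign of the mean minus \<eta> there, and
      the Lipschitz bound carries it back to \<theta>.\<close>
    have stat: "0 \<le> \<sigma> * (mean \<theta> k - \<eta> k)" if k: "k \<in> K" and \<sigma>: "\<sigma> = 1 \<or> \<sigma> = - 1" for \<sigma> k
    proof (rule ccontr)
      assume "\<not> 0 \<le> \<sigma> * (mean \<theta> k - \<eta> k)"
      define e where "e = - \<sigma> * (mean \<theta> k - \<eta> k)"
      have neg: "0 < e"
        using \<open>\<not> 0 \<le> \<sigma> * (mean \<theta> k - \<eta> k)\<close> by (simp add: e_def)
      obtain C r where C: "0 \<le> C" "0 < r"
        "\<And>\<theta>' k. \<theta>' \<in> params E \<Longrightarrow> dst \<theta>' \<theta> \<le> r \<Longrightarrow> k \<in> K \<Longrightarrow> \<bar>mean \<theta>' k - mean \<theta> k\<bar> \<le> C * dst \<theta>' \<theta>"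
        using mean_lipschitz_at[OF \<theta>p] by blast
      \<comment> \<open>\<open>t\<close> respects the Lipschitz radius and the box; the third bound
        gives \<open>C * t <= e / 2\<close>, with \<open>C + 1\<close> guarding against
        \<open>C = 0\<close>.\<close>
      define t where "t = min r (min (\<rho> - \<bar>\<theta> k - \<theta>0 k\<bar>) (e / (C + 1) / 2))"
      have t: "0 < t" "t \<le> r" "t \<le> \<rho> - \<bar>\<theta> k - \<theta>0 k\<bar>"
          "t \<le> e / (C + 1) / 2"
        using C(1,2) inner[OF k] neg unfolding t_def by (auto simp: divide_pos_pos)
      define \<theta>t where "\<theta>t = \<theta>(k := \<theta> k + \<sigma> * t)"
      have "\<theta>t \<in> B"
        unfolding B_def \<theta>t_def using \<theta>(1) k t(1,3) \<sigma>
        by (auto simp: B_def extensional_def)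
      then have \<theta>tp: "\<theta>t \<in> params E" and le: "g \<eta> \<theta> \<le> g \<eta> \<theta>t"
        using Bp \<theta>(2) by auto
      have single: "dot K (\<lambda>l. \<theta>t l - \<theta> l) w = \<sigma> * t * w k" for w
      proof -
        have "dot K (\<lambda>l. \<theta>t l - \<theta> l) w = (\<Sum>l\<in>K. if l = k then \<sigma> * t * w k else 0)"
          unfolding dot_def \<theta>t_def by (intro sum.cong) auto
        then show ?thesis using k by simp
      qed
      have dst: "dst \<theta>t \<theta> = t"
      proof -
        have "dst \<theta>t \<theta> = (\<Sum>l\<in>K. if l = k then t else 0)"
          unfolding l1_def \<theta>t_def using t(1) \<sigma> by (intro sum.cong) auto
        then show ?thesis using k by simp
      qed
      have "log_partition E \<theta>t + dot K (\<lambda>l. \<theta> l - \<theta>t l) (mean \<theta>t) \<le> log_partition E \<theta>"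
        by (rule log_partition_gradient_le[OF \<theta>tp \<theta>p])
      then have "log_partition E \<theta>t - \<sigma> * t * mean \<theta>t k \<le> log_partition E \<theta>"
        using single[of "mean \<theta>t"] by (simp add: dot_diff_left)
      moreover have "log_partition E \<theta> \<le> log_partition E \<theta>t - \<sigma> * t * \<eta> k"
        using le single[of \<eta>] by (simp add: g_def dot_diff_left)
      ultimately have "0 \<le> t * (\<sigma> * (mean \<theta>t k - \<eta> k))"
        by (simp add: algebra_simps)
      then have "0 \<le> \<sigma> * (mean \<theta>t k - \<eta> k)"
        using t(1) by (simp add: zero_le_mult_iff)
      moreover have "\<bar>mean \<theta>t k - mean \<theta> k\<bar> \<le> C * t"
        using C(3)[OF \<theta>tp _ k] dst t(2) by simp
      then have "\<sigma> * (mean \<theta>t k - mean \<theta> k) \<le> C * t"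
        using \<sigma> by auto
      ultimately have "e \<le> C * t"
        by (simp add: e_def algebra_simps)
      also have "\<dots> \<le> (C + 1) * t"
        using t(1) by simp
      also have "\<dots> \<le> (C + 1) * (e / (C + 1) / 2)"
        using C(1) t(4) by (intro mult_left_mono) auto
      also have "\<dots> = e / 2"
        using C(1) by (simp add: field_simps)
      finally show False
        using neg by simp
    qed
    have "mean \<theta> k = \<eta> k" if "k \<in> K" for k
      using stat[OF that, of 1] stat[OF that, of "- 1"] by simp
    then show "\<exists>\<theta>\<in>params E. (\<forall>k\<in>K. mean \<theta> k = \<eta> k) \<and> (\<forall>k\<in>K. \<bar>\<theta> k - \<theta>0 k\<bar> < \<epsilon>)"
      using \<theta>p inner \<rho>(3) by (intro bexI[of _ \<theta>]) (auto intro: less_trans)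
  qed
qed

section \<open>The inverse moment map and the Legendre transform\<close>

text \<open>Unlike for \<open>mean_params\<close>, membership depends only on the values on
  \<open>K\<close>, so coordinate updates and compositions with coordinate maps need no
  extensionality.\<close>

definition moment_set :: "('k \<Rightarrow> real) set" where
  "moment_set = {\<eta>. \<exists>\<theta>\<in>params E. \<forall>k\<in>K. mean \<theta> k = \<eta> k}"

definition nat_param :: "('k \<Rightarrow> real) \<Rightarrow> 'k \<Rightarrow> real" where
  "nat_param \<eta> = (SOME \<theta>. \<theta> \<in> params E \<and> (\<forall>k\<in>K. mean \<theta> k = \<eta> k))"

lemma nat_param:
  assumes "\<eta> \<in> moment_set"
  shows "nat_param \<eta> \<in> params E" "k \<in> K \<Longrightarrow> mean (nat_param \<eta>) k = \<eta> k"
proof -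
  have "\<exists>\<theta>. \<theta> \<in> params E \<and> (\<forall>k\<in>K. mean \<theta> k = \<eta> k)"
    using assms unfolding moment_set_def by blast
  from someI_ex[OF this] show "nat_param \<eta> \<in> params E" "k \<in> K \<Longrightarrow> mean (nat_param \<eta>) k = \<eta> k"
    unfolding nat_param_def[symmetric] by simp_all
qed

lemma nat_param_eqI:
  assumes "\<theta> \<in> params E" "\<And>k. k \<in> K \<Longrightarrow> mean \<theta> k = \<eta> k"
  shows "\<eta> \<in> moment_set" "nat_param \<eta> = \<theta>"
proof -
  show *: "\<eta> \<in> moment_set"
    using assms unfolding moment_set_def by blast
  show "nat_param \<eta> = \<theta>"
    using nat_param[OF *] assms by (intro mean_injective) auto
qed

lemma nat_param_cong:
  assumes "\<And>k. k \<in> K \<Longrightarrow> \<eta> k = \<eta>' k"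
  shows "nat_param \<eta> = nat_param \<eta>'"
proof -
  have "(\<forall>k\<in>K. mean \<theta> k = \<eta> k) \<longleftrightarrow> (\<forall>k\<in>K. mean \<theta> k = \<eta>' k)" for \<theta>
    using assms by auto
  then show ?thesis
    by (simp only: nat_param_def)
qed

lemma legendre_cong:
  assumes "\<And>k. k \<in> K \<Longrightarrow> \<eta> k = \<eta>' k"
  shows "legendre E \<eta> = legendre E \<eta>'"
proof -
  have "dot K \<theta> \<eta> = dot K \<theta> \<eta>'" for \<theta>
    using assms by (intro dot_cong) auto
  then show ?thesis
    by (simp only: legendre_def)
qed

lemma moment_set_open:
  assumes "\<eta> \<in> moment_set"
  obtains \<delta> where "0 < \<delta>" "\<And>\<eta>'. (\<And>k. k \<in> K \<Longrightarrow> \<bar>\<eta>' k - \<eta> k\<bar> < \<delta>) \<Longrightarrow> \<eta>' \<in> moment_set"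
proof -
  have pos: "0 < (1 :: real)"
    by simp
  obtain \<delta> where \<delta>: "0 < \<delta>"
    "\<And>\<eta>'. (\<And>k. k \<in> K \<Longrightarrow> \<bar>\<eta>' k - mean (nat_param \<eta>) k\<bar> < \<delta>) \<Longrightarrow>
      \<exists>\<theta>\<in>params E. (\<forall>k\<in>K. mean \<theta> k = \<eta>' k) \<and> (\<forall>k\<in>K. \<bar>\<theta> k - nat_param \<eta> k\<bar> < 1)"
    using mean_locally_onto[OF nat_param(1)[OF assms] pos] by blast
  show ?thesis
  proof (rule that[OF \<delta>(1)])
    fix \<eta>' assume "\<And>k. k \<in> K \<Longrightarrow> \<bar>\<eta>' k - \<eta> k\<bar> < \<delta>"
    then have "\<exists>\<theta>\<in>params E. (\<forall>k\<in>K. mean \<theta> k = \<eta>' k) \<and> (\<forall>k\<in>K. \<bar>\<theta> k - nat_param \<eta> k\<bar> < 1)"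
      using nat_param(2)[OF assms] by (intro \<delta>(2)) simp
    then show "\<eta>' \<in> moment_set"
      unfolding moment_set_def by blast
  qed
qed

text \<open>The gradient inequality at \<open>nat_param \<eta>\<close> says that the supremum is
  attained there.\<close>

lemma legendre_fenchel:
  assumes "\<eta> \<in> moment_set"
  shows legendre_eq: "legendre E \<eta> = dot K (nat_param \<eta>) \<eta> - log_partition E (nat_param \<eta>)"
    and legendre_ge: "\<theta> \<in> params E \<Longrightarrow> dot K \<theta> \<eta> - log_partition E \<theta> \<le> legendre E \<eta>"
proof -
  let ?\<theta> = "nat_param \<eta>"
  have le: "dot K \<theta> \<eta> - log_partition E \<theta> \<le> dot K ?\<theta> \<eta> - log_partition E ?\<theta>"
    if "\<theta> \<in> params E" for \<theta>
  proof -
    have "dot K w (mean ?\<theta>) = dot K w \<eta>" for w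
      using nat_param(2)[OF assms] by (intro dot_cong) auto
    then show ?thesis
      using log_partition_gradient_le[OF nat_param(1)[OF assms] that] by (simp add: dot_diff_left)
  qed
  show eq: "legendre E \<eta> = dot K ?\<theta> \<eta> - log_partition E ?\<theta>"
    unfolding legendre_def using nat_param(1)[OF assms] le by (intro cSup_eq_maximum) auto
  show "\<theta> \<in> params E \<Longrightarrow> dot K \<theta> \<eta> - log_partition E \<theta> \<le> legendre E \<eta>"
    unfolding eq by (rule le)
qed

text \<open>With \<open>B\<close> the inverse covariance, \<open>mean_expansion\<close> says that
  the natural parameter moves by \<open>B\<close> applied to \<open>t e_c - R\<close>, where
  \<open>R\<close> is of order \<open>n^2\<close> and \<open>n\<close> is the distance moved. For
  small \<open>n\<close> the quadratic term is absorbed, so \<open>n <= 2 * b * |t|\<close> and the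
  error is of order \<open>t^2\<close>.\<close>

lemma nat_param_expansion:
  assumes \<eta>: "\<eta> \<in> moment_set" and c: "c \<in> K"
  shows "\<exists>M \<delta>. 0 \<le> M \<and> 0 < \<delta> \<and> (\<forall>t. \<bar>t\<bar> < \<delta> \<longrightarrow> \<eta>(c := \<eta> c + t) \<in> moment_set \<and>
    (\<forall>d\<in>K. \<bar>nat_param (\<eta>(c := \<eta> c + t)) d - nat_param \<eta> d
       - t * fmat_inv K (Var E (P (nat_param \<eta>))) d c\<bar> \<le> M * t\<^sup>2))"
proof -
  define \<theta>0 where "\<theta>0 = nat_param \<eta>"
  have \<theta>0: "\<theta>0 \<in> params E" "\<And>k. k \<in> K \<Longrightarrow> mean \<theta>0 k = \<eta> k"
    using nat_param[OF \<eta>] by (auto simp: \<theta>0_def)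
  define V where "V = Var E (P \<theta>0)"
  define B where "B = fmat_inv K V"
  have "fdet K V \<noteq> 0"
    unfolding V_def by (intro pos_def_fdet_nonzero pos_def_Var \<theta>0(1)) simp
  then have BV: "(\<Sum>m\<in>K. B k m * V m l) = (if k = l then 1 else 0)" if "k \<in> K" "l \<in> K" for k l
    unfolding B_def using that by (intro fmat_inv_left) auto
  obtain C r where C: "0 \<le> C" "0 < r"
    "\<And>\<theta>' k. \<theta>' \<in> params E \<Longrightarrow> dst \<theta>' \<theta>0 \<le> r \<Longrightarrow> k \<in> K \<Longrightarrow>
      \<bar>mean \<theta>' k - mean \<theta>0 k - (\<Sum>l\<in>K. V k l * (\<theta>' l - \<theta>0 l))\<bar> \<le> C * (dst \<theta>' \<theta>0)\<^sup>2"
    using mean_expansion[OF \<theta>0(1)] unfolding V_def by blast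
  define b where "b = (\<Sum>d\<in>K. \<Sum>k\<in>K. \<bar>B d k\<bar>)"
  have b0: "0 \<le> b" unfolding b_def by (simp add: sum_nonneg)
  have row: "(\<Sum>k\<in>K. \<bar>B d k\<bar>) \<le> b" if "d \<in> K" for d
    unfolding b_def using that
    by (intro member_le_sum[of d K "\<lambda>d. \<Sum>k\<in>K. \<bar>B d k\<bar>"]) (auto simp: sum_nonneg)
  \<comment> \<open>The second bound gives \<open>b * C * n <= 1 / 2\<close>, which is what the
    absorption needs.\<close>
  define r1 where "r1 = min r (1 / (2 * (b * C + 1)))"
  have bC: "0 \<le> b * C" using b0 C(1) by simp
  have r1: "0 < r1" using C(2) bC by (simp add: r1_def)
  \<comment> \<open>Closeness up to \<epsilon> in every coordinate makes the l1 distance at most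
    \<open>r1\<close>.\<close>
  define \<epsilon> where "\<epsilon> = r1 / (card K + 1)"
  have \<epsilon>: "0 < \<epsilon>" using r1 by (simp add: \<epsilon>_def)
  obtain \<delta> where \<delta>: "0 < \<delta>"
    "\<And>\<eta>'. (\<And>k. k \<in> K \<Longrightarrow> \<bar>\<eta>' k - mean \<theta>0 k\<bar> < \<delta>) \<Longrightarrow>
      \<exists>\<theta>\<in>params E. (\<forall>k\<in>K. mean \<theta> k = \<eta>' k) \<and> (\<forall>k\<in>K. \<bar>\<theta> k - \<theta>0 k\<bar> < \<epsilon>)"
    using mean_locally_onto[OF \<theta>0(1) \<epsilon>] by blast
  have main: "\<eta>(c := \<eta> c + t) \<in> moment_set \<and>
      (\<forall>d\<in>K. \<bar>nat_param (\<eta>(c := \<eta> c + t)) d - \<theta>0 d - t * B d c\<bar> \<le> (b * C * (2 * b)\<^sup>2) * t\<^sup>2)"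
    if t: "\<bar>t\<bar> < \<delta>" for t
  proof -
    have "\<bar>(\<eta>(c := \<eta> c + t)) k - mean \<theta>0 k\<bar> < \<delta>" if "k \<in> K" for k
      using that t \<delta>(1) \<theta>0(2) by auto
    then obtain \<theta> where \<theta>: "\<theta> \<in> params E" "\<And>k. k \<in> K \<Longrightarrow> mean \<theta> k = (\<eta>(c := \<eta> c + t)) k"
        "\<And>k. k \<in> K \<Longrightarrow> \<bar>\<theta> k - \<theta>0 k\<bar> < \<epsilon>"
      using \<delta>(2)[of "\<eta>(c := \<eta> c + t)"] by blast
    have np: "\<eta>(c := \<eta> c + t) \<in> moment_set" "nat_param (\<eta>(c := \<eta> c + t)) = \<theta>"
      by (rule nat_param_eqI[OF \<theta>(1)], erule \<theta>(2))+
    define n where "n = dst \<theta> \<theta>0"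
    have n0: "0 \<le> n" unfolding n_def by (rule l1_nonneg)
    have nr: "n \<le> r1"
    proof -
      have "n \<le> (\<Sum>k\<in>K. \<epsilon>)"
        unfolding n_def l1_def using \<theta>(3) by (intro sum_mono less_imp_le)
      also have "\<dots> \<le> r1"
        using r1 by (simp add: \<epsilon>_def field_simps)
      finally show ?thesis .
    qed
    define R where "R k = (if k = c then t else 0) - (\<Sum>l\<in>K. V k l * (\<theta> l - \<theta>0 l))" for k
    have R: "\<bar>R k\<bar> \<le> C * n\<^sup>2" if "k \<in> K" for k
    proof -
      have "mean \<theta> k - mean \<theta>0 k = (if k = c then t else 0)"
        using \<theta>(2)[OF that] \<theta>0(2)[OF that] by simp
      then show ?thesis
        using C(3)[OF \<theta>(1) _ that] nr by (simp add: R_def n_def r1_def)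
    qed
    have inv: "\<theta> d - \<theta>0 d = (\<Sum>k\<in>K. B d k * ((if k = c then t else 0) - R k))" if d: "d \<in> K" for d
    proof -
      have "(\<Sum>k\<in>K. B d k * (\<Sum>l\<in>K. V k l * (\<theta> l - \<theta>0 l))) =
          (\<Sum>l\<in>K. (\<Sum>k\<in>K. B d k * V k l) * (\<theta> l - \<theta>0 l))"
        by (simp add: sum_distrib_left sum_distrib_right mult.assoc) (rule sum.swap)
      also have "\<dots> = (\<Sum>l\<in>K. if d = l then \<theta> l - \<theta>0 l else 0)"
        using d by (intro sum.cong) (auto simp: BV)
      also have "\<dots> = \<theta> d - \<theta>0 d"
        using d by simp
      finally show ?thesis
        by (simp add: R_def)
    qed
    have err: "\<bar>\<theta> d - \<theta>0 d - t * B d c\<bar> \<le> b * C * n\<^sup>2" if d: "d \<in> K" for d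
    proof -
      have "\<theta> d - \<theta>0 d = (\<Sum>k\<in>K. B d k * ((if k = c then t else 0) - R k))"
        by (rule inv[OF d])
      also have "\<dots> = (\<Sum>k\<in>K. if k = c then t * B d c else 0) - (\<Sum>k\<in>K. B d k * R k)"
        unfolding right_diff_distrib sum_subtractf
        by (intro arg_cong2[where f = "(-)"] sum.cong) auto
      also have "\<dots> = t * B d c - (\<Sum>k\<in>K. B d k * R k)"
        using c by simp
      finally have "\<bar>\<theta> d - \<theta>0 d - t * B d c\<bar> = \<bar>\<Sum>k\<in>K. B d k * R k\<bar>"
        by simp
      also have "\<dots> \<le> (\<Sum>k\<in>K. \<bar>B d k\<bar> * (C * n\<^sup>2))"
        by (rule order_trans[OF sum_abs]) (auto simp: abs_mult intro!: sum_mono mult_left_mono R)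
      also have "\<dots> \<le> b * (C * n\<^sup>2)"
        unfolding sum_distrib_right[symmetric] using C(1) d by (intro mult_right_mono row) auto
      finally show ?thesis
        by (simp add: mult.assoc)
    qed
    have "n \<le> 2 * b * \<bar>t\<bar>"
    proof -
      have inv_err: "\<bar>\<theta> d - \<theta>0 d\<bar> \<le> (\<Sum>k\<in>K. \<bar>B d k\<bar>) * (\<bar>t\<bar> + C * n\<^sup>2)" if d: "d \<in> K" for d
      proof -
        have "\<bar>\<theta> d - \<theta>0 d\<bar> = \<bar>\<Sum>k\<in>K. B d k * ((if k = c then t else 0) - R k)\<bar>"
          by (simp only: inv[OF d])
        also have "\<dots> \<le> (\<Sum>k\<in>K. \<bar>B d k\<bar> * (\<bar>t\<bar> + C * n\<^sup>2))"
        proof (rule order_trans[OF sum_abs], unfold abs_mult, rule sum_mono, rule mult_left_mono)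
          fix k assume "k \<in> K"
          then show "\<bar>(if k = c then t else 0) - R k\<bar> \<le> \<bar>t\<bar> + C * n\<^sup>2"
            using R[of k] by auto
        qed simp
        finally show ?thesis
          by (simp add: sum_distrib_right)
      qed
      have "n \<le> (\<Sum>d\<in>K. (\<Sum>k\<in>K. \<bar>B d k\<bar>) * (\<bar>t\<bar> + C * n\<^sup>2))"
        unfolding n_def l1_def by (intro sum_mono) (use inv_err in \<open>simp add: n_def l1_def\<close>)
      also have "\<dots> = b * (\<bar>t\<bar> + C * n\<^sup>2)"
        by (simp only: b_def sum_distrib_right)
      also have "\<dots> = b * \<bar>t\<bar> + (b * C * n) * n"
        by (simp add: algebra_simps power2_eq_square)
      finally have 1: "n \<le> b * \<bar>t\<bar> + (b * C * n) * n" .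
      have "b * C * n \<le> b * C * (1 / (2 * (b * C + 1)))"
        using bC nr by (intro mult_left_mono) (auto simp: r1_def)
      also have "\<dots> \<le> 1 / 2"
        using bC by (simp add: field_simps)
      finally have "(b * C * n) * n \<le> 1 / 2 * n"
        using n0 by (rule mult_right_mono)
      with 1 show ?thesis by linarith
    qed
    then have "n\<^sup>2 \<le> (2 * b)\<^sup>2 * t\<^sup>2"
      using n0 power_mono[of n "2 * b * \<bar>t\<bar>" 2] by (simp add: power_mult_distrib)
    then have "b * C * n\<^sup>2 \<le> b * C * ((2 * b)\<^sup>2 * t\<^sup>2)"
      using bC by (rule mult_left_mono)
    then show ?thesis
      using err np by (force simp: mult.assoc)
  qed
  show ?thesis
    unfolding \<theta>0_def[symmetric] V_def[symmetric] B_def[symmetric]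
    using main \<delta>(1) bC
    by (intro exI[of _ "b * C * (2 * b)\<^sup>2"] exI[of _ \<delta>]) simp
qed

lemma nat_param_has_derivative:
  assumes "\<eta> \<in> moment_set" "c \<in> K" "d \<in> K"
  shows "((\<lambda>t. nat_param (\<eta>(c := t)) d) has_real_derivative
    fmat_inv K (Var E (P (nat_param \<eta>))) d c) (at (\<eta> c))"
proof -
  obtain M \<delta> where "0 < \<delta>"
    and M: "\<And>t. \<bar>t\<bar> < \<delta> \<Longrightarrow> \<bar>nat_param (\<eta>(c := \<eta> c + t)) d - nat_param \<eta> d
       - t * fmat_inv K (Var E (P (nat_param \<eta>))) d c\<bar> \<le> M * t\<^sup>2"
    using nat_param_expansion[OF assms(1,2)] assms(3) by blast
  show ?thesis
  proof (rule has_real_derivative_quadratic_error[OF \<open>0 < \<delta>\<close>])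
    fix t assume "\<bar>t\<bar> < \<delta>"
    from M[OF this] show "\<bar>nat_param (\<eta>(c := \<eta> c + t)) d - nat_param (\<eta>(c := \<eta> c)) d
       - t * fmat_inv K (Var E (P (nat_param \<eta>))) d c\<bar> \<le> M * t\<^sup>2"
      by simp
  qed
qed

text \<open>Testing each of the two suprema with the maximiser of the other one sandwiches their
  difference: after subtracting \<open>t * nat_param \<eta> c\<close> it lies between 0 and
  \<open>t\<close> times the change of the natural parameter, which is of order
  \<open>t^2\<close>.\<close>

lemma legendre_has_derivative:
  assumes "\<eta> \<in> moment_set" "c \<in> K"
  shows "((\<lambda>t. legendre E (\<eta>(c := t))) has_real_derivative nat_param \<eta> c) (at (\<eta> c))"
proof -
  define D where "D = fmat_inv K (Var E (P (nat_param \<eta>))) c c"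
  obtain M \<delta> where M: "0 \<le> M" "0 < \<delta>"
    "\<And>t. \<bar>t\<bar> < \<delta> \<Longrightarrow> \<eta>(c := \<eta> c + t) \<in> moment_set"
    "\<And>t. \<bar>t\<bar> < \<delta> \<Longrightarrow> \<bar>nat_param (\<eta>(c := \<eta> c + t)) c - nat_param \<eta> c - t * D\<bar> \<le> M * t\<^sup>2"
    unfolding D_def using nat_param_expansion[OF assms] assms(2) by blast
  show ?thesis
  proof (rule has_real_derivative_quadratic_error[OF M(2), of _ _ _ "\<bar>D\<bar> + M * \<delta>"])
    fix t assume t: "\<bar>t\<bar> < \<delta>"
    let ?\<eta> = "\<eta>(c := \<eta> c + t)"
    have shift: "dot K \<theta> ?\<eta> = dot K \<theta> \<eta> + t * \<theta> c" for \<theta>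
    proof -
      have "dot K \<theta> ?\<eta> = (\<Sum>k\<in>K. \<theta> k * \<eta> k + (if k = c then t * \<theta> c else 0))"
        unfolding dot_def by (intro sum.cong) (auto simp: algebra_simps)
      then show ?thesis
        using assms(2) by (simp add: dot_def sum.distrib)
    qed
    have lower: "legendre E \<eta> + t * nat_param \<eta> c \<le> legendre E ?\<eta>"
      using legendre_ge[OF M(3)[OF t] nat_param(1)[OF assms(1)]] legendre_eq[OF assms(1)] shift
      by simp
    have upper: "legendre E ?\<eta> \<le> legendre E \<eta> + t * nat_param ?\<eta> c"
      using legendre_ge[OF assms(1) nat_param(1)[OF M(3)[OF t]]] legendre_eq[OF M(3)[OF t]] shift
      by simp
    have "\<bar>legendre E ?\<eta> - legendre E \<eta> - t * nat_param \<eta> c\<bar> \<le> t * (nat_param ?\<eta> c - nat_param \<eta> c)"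
      using lower upper by (simp add: algebra_simps)
    also have "\<dots> \<le> \<bar>t\<bar> * \<bar>nat_param ?\<eta> c - nat_param \<eta> c\<bar>"
      by (simp add: abs_mult[symmetric])
    also have "\<dots> \<le> \<bar>t\<bar> * (\<bar>t\<bar> * \<bar>D\<bar> + M * t\<^sup>2)"
    proof (rule mult_left_mono)
      have "\<bar>nat_param ?\<eta> c - nat_param \<eta> c\<bar> \<le> \<bar>t * D\<bar> + M * t\<^sup>2"
        using M(4)[OF t] by linarith
      then show "\<bar>nat_param ?\<eta> c - nat_param \<eta> c\<bar> \<le> \<bar>t\<bar> * \<bar>D\<bar> + M * t\<^sup>2"
        by (simp add: abs_mult)
    qed simp
    also have "\<dots> = (\<bar>D\<bar> + M * \<bar>t\<bar>) * t\<^sup>2"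
      by (simp add: algebra_simps power2_eq_square abs_if)
    also have "\<dots> \<le> (\<bar>D\<bar> + M * \<delta>) * t\<^sup>2"
      using M(1) t by (intro mult_right_mono add_left_mono mult_left_mono) auto
    finally show "\<bar>legendre E (\<eta>(c := \<eta> c + t)) - legendre E (\<eta>(c := \<eta> c)) - t * nat_param \<eta> c\<bar>
        \<le> (\<bar>D\<bar> + M * \<delta>) * t\<^sup>2"
      by simp
  qed
qed

text \<open>The components of one family are embedded by \<open>\<iota>\<close> into the common
  coordinate set. Injectivity turns an update at \<open>\<iota> i\<close> into an update at
  \<open>i\<close>; other coordinates leave the function unchanged. The indices appear as
  \<open>j i\<close> because component \<open>j\<close> of \<open>nat_param\<close> is
  differentiated along \<open>i\<close>.\<close>

lemma legendre_has_hessian: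
  assumes \<iota>: "inj_on \<iota> K" "\<iota> ` K \<subseteq> C" and x: "(\<lambda>j. x (\<iota> j)) \<in> moment_set"
  shows "has_hessian_at C (\<lambda>y. legendre E (\<lambda>j. y (\<iota> j))) x
    (\<lambda>c d. \<Sum>i\<in>K. \<Sum>j\<in>K. if \<iota> i = c \<and> \<iota> j = d
       then fmat_inv K (Var E (P (nat_param (\<lambda>j. x (\<iota> j))))) j i else 0)"
proof -
  obtain \<delta> where \<delta>: "0 < \<delta>"
    "\<And>\<eta>. (\<And>k. k \<in> K \<Longrightarrow> \<bar>\<eta> k - x (\<iota> k)\<bar> < \<delta>) \<Longrightarrow> \<eta> \<in> moment_set"
    using moment_set_open[OF x] by blast
  have upd: "(y(\<iota> i := t)) (\<iota> k) = ((\<lambda>j. y (\<iota> j))(i := t)) k" if "i \<in> K" "k \<in> K" for y :: "_ \<Rightarrow> real" and i k t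
    using \<iota>(1) that by (auto simp: inj_on_eq_iff)
  have single: "(\<Sum>j\<in>K. if \<iota> j = \<iota> i then f j else 0) = f i" if "i \<in> K" for f :: "_ \<Rightarrow> real" and i
  proof -
    have "(\<Sum>j\<in>K. if \<iota> j = \<iota> i then f j else 0) = (\<Sum>j\<in>K. if j = i then f j else 0)"
      using \<iota>(1) that by (intro sum.cong) (auto simp: inj_on_eq_iff)
    then show ?thesis using that by simp
  qed
  have none: "(\<Sum>j\<in>K. if \<iota> j = d then f j else 0) = 0" if "d \<notin> \<iota> ` K" for f :: "_ \<Rightarrow> real" and d
    using that by (intro sum.neutral) auto
  show ?thesis
  proof (rule has_hessian_atI[where \<delta> = \<delta> and
        g = "\<lambda>d y. \<Sum>j\<in>K. if \<iota> j = d then nat_param (\<lambda>j. y (\<iota> j)) j else 0"])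
    fix y d assume y: "\<And>c. c \<in> C \<Longrightarrow> \<bar>y c - x c\<bar> < \<delta>"
    then have ym: "(\<lambda>j. y (\<iota> j)) \<in> moment_set"
      using \<iota>(2) by (intro \<delta>(2)) auto
    show "((\<lambda>t. legendre E (\<lambda>j. (y(d := t)) (\<iota> j))) has_real_derivative
        (\<Sum>j\<in>K. if \<iota> j = d then nat_param (\<lambda>j. y (\<iota> j)) j else 0)) (at (y d))"
    proof (cases "d \<in> \<iota> ` K")
      case True
      then obtain i where i: "i \<in> K" "d = \<iota> i" by blast
      have "legendre E (\<lambda>j. (y(d := t)) (\<iota> j)) = legendre E ((\<lambda>j. y (\<iota> j))(i := t))" for t
        unfolding i(2) using upd[OF i(1)] by (intro legendre_cong) auto
      then show ?thesis
        using legendre_has_derivative[OF ym i(1)] single[OF i(1)] by (simp add: i(2))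
    next
      case False
      then have "legendre E (\<lambda>j. (y(d := t)) (\<iota> j)) = legendre E (\<lambda>j. y (\<iota> j))" for t
        by (intro legendre_cong) auto
      then show ?thesis
        using none[OF False] by simp
    qed
  next
    fix c d
    define B where "B = fmat_inv K (Var E (P (nat_param (\<lambda>j. x (\<iota> j)))))"
    have "((\<lambda>t. \<Sum>j\<in>K. if \<iota> j = d then nat_param (\<lambda>j. (x(c := t)) (\<iota> j)) j else 0) has_real_derivative
        (\<Sum>i\<in>K. \<Sum>j\<in>K. if \<iota> i = c \<and> \<iota> j = d then B j i else 0)) (at (x c))"
    proof (cases "c \<in> \<iota> ` K \<and> d \<in> \<iota> ` K")
      case True
      then obtain i j where ij: "i \<in> K" "c = \<iota> i" "j \<in> K" "d = \<iota> j" by blast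
      have "nat_param (\<lambda>j. (x(c := t)) (\<iota> j)) = nat_param ((\<lambda>j. x (\<iota> j))(i := t))" for t
        unfolding ij(2) using upd[OF ij(1)] by (intro nat_param_cong) auto
      moreover have "(\<Sum>i'\<in>K. \<Sum>j'\<in>K. if \<iota> i' = c \<and> \<iota> j' = d then B j' i' else 0) =
          (\<Sum>i'\<in>K. if \<iota> i' = \<iota> i then \<Sum>j'\<in>K. if \<iota> j' = \<iota> j then B j' i' else 0 else 0)"
        unfolding ij(2,4) by (intro sum.cong) auto
      ultimately show ?thesis
        using nat_param_has_derivative[OF x ij(1,3)] single[OF ij(1)] single[OF ij(3)]
        by (simp add: ij(2,4) B_def)
    next
      case False
      have "(\<Sum>i\<in>K. \<Sum>j\<in>K. if \<iota> i = c \<and> \<iota> j = d then B j i else 0) = 0"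
        using False by (intro sum.neutral ballI) auto
      \<comment> \<open>If \<open>c\<close> does not belong to this family, nothing depends on
        \<open>t\<close>; if only \<open>d\<close> does not, the sum is 0.\<close>
      moreover have "\<exists>a. \<forall>t. (\<Sum>j\<in>K. if \<iota> j = d then nat_param (\<lambda>j. (x(c := t)) (\<iota> j)) j else 0) = a"
      proof (cases "c \<in> \<iota> ` K")
        case True
        with False show ?thesis using none by auto
      next
        case c: False
        have eq: "nat_param (\<lambda>j. (x(c := t)) (\<iota> j)) = nat_param (\<lambda>j. x (\<iota> j))" for t
          using c by (intro nat_param_cong) auto
        show ?thesis
          by (intro exI allI) (simp only: eq)
      qed
      ultimately show ?thesis
        by auto
    qed
    then show "((\<lambda>t. \<Sum>j\<in>K. if \<iota> j = d then nat_param (\<lambda>j. (x(c := t)) (\<iota> j)) j else 0) has_real_derivative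
        (\<Sum>i\<in>K. \<Sum>j\<in>K. if \<iota> i = c \<and> \<iota> j = d
          then fmat_inv K (Var E (P (nat_param (\<lambda>j. x (\<iota> j))))) j i else 0)) (at (x c))"
      by (simp only: B_def)
  qed (rule \<delta>(1))
qed

text \<open>A member is determined by its mean, by injectivity of the moment map. This expresses the
  pseudomarginals through the coordinates and identifies the vertex marginals.\<close>

lemma member_eq_nat_param:
  assumes "b \<in> members E" "\<And>k. k \<in> K \<Longrightarrow> mean_vec E b k = \<zeta> k"
  shows "\<zeta> \<in> moment_set" "b = P (nat_param \<zeta>)"
proof -
  obtain \<theta> where \<theta>: "\<theta> \<in> params E" "b = P \<theta>"
    using assms(1) unfolding members_def by blast
  have "mean \<theta> k = \<zeta> k" if "k \<in> K" for k
    using assms(2)[OF that] that by (simp add: \<theta>(2) mean_vec_def mean_def)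
  from nat_param_eqI[OF \<theta>(1) this] show "\<zeta> \<in> moment_set" "b = P (nat_param \<zeta>)"
    by (simp_all add: \<theta>(2))
qed

end

section \<open>The Bethe free energy\<close>

text \<open>Dropping \<alpha> from the vertex components glues the copies of a vertex statistic in
  different hyperedges; this is the map behind \<open>Q\<close>.\<close>

fun hcoord :: "'v set \<Rightarrow> 'v hindex \<Rightarrow> 'v coord" where
  "hcoord \<alpha> (Extra k) = HCoord \<alpha> k"
| "hcoord \<alpha> (Vtx i k) = VCoord i k"

lemma inj_hcoord: "inj_on (hcoord \<alpha>) X"
proof (rule inj_onI)
  fix j j' assume "hcoord \<alpha> j = hcoord \<alpha> j'"
  then show "j = j'" by (cases j; cases j') auto
qed

text \<open>\<open>B = VarV\<close> gives \<open>R\<close>, the transposed inverses give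
  \<open>R^-1\<close>, and pulling \<open>R\<close> back along \<open>hcoord\<close> gives the
  blocks of \<open>T\<close>.\<close>

fun vblock :: "('v \<Rightarrow> nat \<Rightarrow> nat \<Rightarrow> real) \<Rightarrow> 'v coord \<Rightarrow> 'v coord \<Rightarrow> real" where
  "vblock B (VCoord i k) (VCoord j l) = (if i = j then B i k l else 0)"
| "vblock B (HCoord \<alpha> k) (HCoord \<beta> l) = (if \<alpha> = \<beta> \<and> k = l then 1 else 0)"
| "vblock B _ _ = 0"

text \<open>\<open>X\<close> is any finite set of additional coordinates, so that the whole
  coordinate set and that of a single hyperedge are both covered.\<close>

lemma fdet_vblock:
  assumes "finite X" "X \<subseteq> range (\<lambda>(\<alpha>, k). HCoord \<alpha> k)" "finite I"
  shows "fdet (X \<union> {VCoord i k |i k. i \<in> I \<and> k < r i}) (vblock B) = (\<Prod>i\<in>I. fdet {..<r i} (B i))"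
proof -
  let ?Y = "{VCoord i k |i k. i \<in> I \<and> k < r i}"
  have Y: "?Y = (\<lambda>(i, k). VCoord i k) ` (SIGMA i:I. {..<r i})"
    by auto
  have finY: "finite ?Y"
    unfolding Y using assms(3) by auto
  define lbl where "lbl c = (case c of VCoord i k \<Rightarrow> i | HCoord _ _ \<Rightarrow> undefined)" for c :: "'a coord"
  have "fdet (X \<union> ?Y) (vblock B) = fdet X (vblock B) * fdet ?Y (vblock B)"
    by (rule fdet_block_lower) (use assms finY in auto)
  also have "fdet X (vblock B) = 1"
  proof (rule fdet_identity[OF assms(1)])
    fix c d assume "c \<in> X" "d \<in> X"
    from this[THEN subsetD[OF assms(2)]]
    obtain \<alpha> k \<beta> l where "c = HCoord \<alpha> k" "d = HCoord \<beta> l"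
      by auto
    then show "vblock B c d = (if c = d then 1 else 0)"
      by simp
  qed
  also have "fdet ?Y (vblock B) = (\<Prod>i\<in>I. fdet {c \<in> ?Y. lbl c = i} (vblock B))"
    by (rule fdet_block_diagonal) (use assms finY in \<open>auto simp: lbl_def\<close>)
  also have "\<dots> = (\<Prod>i\<in>I. fdet {..<r i} (B i))"
  proof (rule prod.cong[OF refl])
    fix i assume "i \<in> I"
    then have "{c \<in> ?Y. lbl c = i} = VCoord i ` {..<r i}"
      by (auto simp: lbl_def)
    moreover have "inj_on (VCoord i) {..<r i}"
      by (auto simp: inj_on_def)
    ultimately show "fdet {c \<in> ?Y. lbl c = i} (vblock B) = fdet {..<r i} (B i)"
      by (simp add: fdet_image)
  qed
  finally show ?thesis by simp
qed

section \<open>A point with its pseudomarginals\<close>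

locale bethe_point =
  fixes D :: "('v, 'x) inference_data"
    and \<eta> :: "'v lparam"
    and bF :: "'v set \<Rightarrow> ('v \<Rightarrow> 'x) measure"
    and bV :: "'v \<Rightarrow> 'x measure"
  assumes family: "inference_family D"
    and point: "\<eta> \<in> local_params D"
    and pseudo: "pseudomarginals D \<eta> bF bV"
begin

abbreviation "V \<equiv> verts D"
abbreviation "F \<equiv> hedges D"
abbreviation "r \<equiv> vdim D"
abbreviation "KF \<alpha> \<equiv> index (hfam D \<alpha>)"
abbreviation "VarF \<alpha> \<equiv> Var (hfam D \<alpha>) (bF \<alpha>)"
abbreviation "VarV i \<equiv> Var (vfam D i) (bV i)"
abbreviation "invF \<alpha> \<equiv> fmat_inv (KF \<alpha>) (VarF \<alpha>)"
abbreviation "invV i \<equiv> fmat_inv {..<r i} (VarV i)"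
abbreviation "C \<equiv> coord_index D"
abbreviation "x0 \<equiv> to_coords \<eta>"

lemma finite_verts: "finite V"
  and hedge_subset: "\<alpha> \<in> F \<Longrightarrow> \<alpha> \<subseteq> V"
  and finite_hedges: "finite F"
  using family unfolding inference_family_def hypergraph_def
  by (auto intro: finite_subset[of _ "Pow (verts D)"])

lemma finite_hedge: "\<alpha> \<in> F \<Longrightarrow> finite \<alpha>"
  using hedge_subset finite_verts finite_subset by blast

lemma regular_vfam: "i \<in> V \<Longrightarrow> regular_family (vfam D i)"
  using family by (auto simp: inference_family_def regular_family_def)

lemma regular_hfam: "\<alpha> \<in> F \<Longrightarrow> regular_family (hfam D \<alpha>)"
  using family by (auto simp: inference_family_def regular_family_def)

lemma index_vfam [simp]: "index (vfam D i) = {..<r i}"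
  by (simp add: vfam_def)

lemma KF_eq: "KF \<alpha> = Extra ` {..<hdim D \<alpha>} \<union> {Vtx i k |i k. i \<in> \<alpha> \<and> k < r i}"
  by (simp add: hfam_def)

lemma Extra_in_KF [simp]: "Extra k \<in> KF \<alpha> \<longleftrightarrow> k < hdim D \<alpha>"
  and Vtx_in_KF [simp]: "Vtx i k \<in> KF \<alpha> \<longleftrightarrow> i \<in> \<alpha> \<and> k < r i"
  by (auto simp: KF_eq)

lemma finite_KF [simp]: "\<alpha> \<in> F \<Longrightarrow> finite (KF \<alpha>)"
  using regular_family.finite_index[OF regular_hfam] .

lemma hcoord_in_C: "\<alpha> \<in> F \<Longrightarrow> j \<in> KF \<alpha> \<Longrightarrow> hcoord \<alpha> j \<in> C"
  using hedge_subset by (cases j) (auto simp: coord_index_def)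

lemma coord_index_eq:
  "C = (\<lambda>(\<alpha>, k). HCoord \<alpha> k) ` (SIGMA \<alpha>:F. {..<hdim D \<alpha>}) \<union> {VCoord i k |i k. i \<in> V \<and> k < r i}"
  by (auto simp: coord_index_def)

lemma finite_C: "finite C"
proof -
  have "{VCoord i k |i k. i \<in> V \<and> k < r i} = (\<lambda>(i, k). VCoord i k) ` (SIGMA i:V. {..<r i})"
    by auto
  then show ?thesis
    unfolding coord_index_eq using finite_hedges finite_verts by auto
qed

lemma x0_hcoord: "\<alpha> \<in> F \<Longrightarrow> j \<in> KF \<alpha> \<Longrightarrow> x0 (hcoord \<alpha> j) = fst \<eta> \<alpha> j"
  using point by (cases j) (auto simp: to_coords_def local_params_def)

lemma bF_nat_param:
  assumes "\<alpha> \<in> F"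
  shows "(\<lambda>j. x0 (hcoord \<alpha> j)) \<in> regular_family.moment_set (hfam D \<alpha>)"
    and "bF \<alpha> = member (hfam D \<alpha>) (regular_family.nat_param (hfam D \<alpha>) (\<lambda>j. x0 (hcoord \<alpha> j)))"
  using regular_family.member_eq_nat_param[OF regular_hfam[OF assms], of "bF \<alpha>" "\<lambda>j. x0 (hcoord \<alpha> j)"]
    pseudo assms x0_hcoord[OF assms]
  by (auto simp: pseudomarginals_def)

lemma bV_nat_param:
  assumes "i \<in> V"
  shows "(\<lambda>k. x0 (VCoord i k)) \<in> regular_family.moment_set (vfam D i)"
    and "bV i = member (vfam D i) (regular_family.nat_param (vfam D i) (\<lambda>k. x0 (VCoord i k)))"
  using regular_family.member_eq_nat_param[OF regular_vfam[OF assms], of "bV i" "\<lambda>k. x0 (VCoord i k)"]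
    pseudo assms
  by (auto simp: pseudomarginals_def to_coords_def)

lemma pos_def_VarF: "\<alpha> \<in> F \<Longrightarrow> pos_def (KF \<alpha>) (VarF \<alpha>)"
  using family pseudo by (auto simp: inference_family_def regular_exp_family_def pseudomarginals_def)

lemma pos_def_VarV: "i \<in> V \<Longrightarrow> pos_def {..<r i} (VarV i)"
  using family pseudo
  by (auto simp: inference_family_def regular_exp_family_def pseudomarginals_def)

lemma fdet_VarF_nonzero: "\<alpha> \<in> F \<Longrightarrow> fdet (KF \<alpha>) (VarF \<alpha>) \<noteq> 0"
  by (intro pos_def_fdet_nonzero pos_def_VarF finite_KF)

lemma fdet_VarV_nonzero: "i \<in> V \<Longrightarrow> fdet {..<r i} (VarV i) \<noteq> 0"
  by (intro pos_def_fdet_nonzero pos_def_VarV) auto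

text \<open>The moment map of \<open>vfam D i\<close> is injective, so the marginal of \<open>bF \<alpha>\<close> at \<open>i\<close>, a member
  with the same mean as \<open>bV i\<close>, is \<open>bV i\<close> itself.\<close>

lemma marginal_eq:
  assumes "\<alpha> \<in> F" "i \<in> \<alpha>"
  shows "distr (bF \<alpha>) (vmeasure D i) (\<lambda>x. x i) = bV i"
    and "(\<lambda>x. x i) \<in> measurable (bF \<alpha>) (vmeasure D i)"
proof -
  have i: "i \<in> V"
    using hedge_subset assms by blast
  interpret fam: regular_family "vfam D i"
    by (rule regular_vfam[OF i])
  let ?b = "distr (bF \<alpha>) (vmeasure D i) (\<lambda>x. x i)"
  have mem: "bF \<alpha> \<in> members (hfam D \<alpha>)" "mean_vec (hfam D \<alpha>) (bF \<alpha>) = fst \<eta> \<alpha>"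
    using pseudo assms by (auto simp: pseudomarginals_def)
  have b: "?b \<in> members (vfam D i)"
    using family mem(1) assms by (auto simp: inference_family_def)
  have "sets (bF \<alpha>) = sets (PiM \<alpha> (vmeasure D))"
    using mem(1) by (auto simp: members_def member_def hfam_def)
  then have meas: "measurable (bF \<alpha>) (vmeasure D i) = measurable (PiM \<alpha> (vmeasure D)) (vmeasure D i)"
    by (intro measurable_cong_sets) auto
  show m: "(\<lambda>x. x i) \<in> measurable (bF \<alpha>) (vmeasure D i)"
    unfolding meas by (rule measurable_component_singleton[OF assms(2)])
  have "mean_vec (vfam D i) ?b k = x0 (VCoord i k)" if k: "k < r i" for k
  proof -
    have st: "(\<lambda>y. vstat D i y k) \<in> borel_measurable (vmeasure D i)"
      using fam.measurable_stat[of k] k by (simp add: vfam_def)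
    have "mean_vec (vfam D i) ?b k = (\<integral>y. vstat D i y k \<partial>?b)"
      using k by (simp add: mean_vec_def vfam_def)
    also have "\<dots> = (\<integral>x. vstat D i (x i) k \<partial>bF \<alpha>)"
      by (rule integral_distr[OF m st])
    also have "\<dots> = mean_vec (hfam D \<alpha>) (bF \<alpha>) (Vtx i k)"
      using k assms(2) by (simp add: mean_vec_def hfam_def)
    also have "\<dots> = x0 (VCoord i k)"
      using x0_hcoord[OF assms(1), of "Vtx i k"] k assms(2) mem(2) by simp
    finally show ?thesis .
  qed
  then show "?b = bV i"
    using fam.member_eq_nat_param(2)[OF b, of "\<lambda>k. x0 (VCoord i k)"] bV_nat_param(2)[OF i] by simp
qed

text \<open>Hence \<open>S - T\<close> has no entries between components of one vertex within a
  hyperedge.\<close>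

lemma marginal_Var:
  assumes "\<alpha> \<in> F" "i \<in> \<alpha>" "k < r i" "l < r i"
  shows "VarF \<alpha> (Vtx i k) (Vtx i l) = VarV i k l"
proof -
  have i: "i \<in> V"
    using hedge_subset assms by blast
  interpret fam: regular_family "vfam D i"
    by (rule regular_vfam[OF i])
  have [measurable]: "(\<lambda>y. vstat D i y k) \<in> borel_measurable (vmeasure D i)"
      "(\<lambda>y. vstat D i y l) \<in> borel_measurable (vmeasure D i)"
    using fam.measurable_stat[of k] fam.measurable_stat[of l] assms by (simp_all add: vfam_def)
  note m = marginal_eq[OF assms(1,2)]
  have "VarV i k l = Cov (distr (bF \<alpha>) (vmeasure D i) (\<lambda>x. x i)) (\<lambda>y. vstat D i y k) (\<lambda>y. vstat D i y l)"
    by (simp add: m(1) Var_def vfam_def)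
  also have "\<dots> = Cov (bF \<alpha>) (\<lambda>x. vstat D i (x i) k) (\<lambda>x. vstat D i (x i) l)"
    unfolding Cov_def by (simp add: integral_distr[OF m(2)])
  also have "\<dots> = VarF \<alpha> (Vtx i k) (Vtx i l)"
    by (simp add: Var_def hfam_def)
  finally show ?thesis by simp
qed

lemma VarF_Vtx: "VarF \<alpha> (Vtx i k) (Vtx j l) = Cov (bF \<alpha>) (\<lambda>x. vstat D i (x i) k) (\<lambda>x. vstat D j (x j) l)"
  by (simp add: Var_def hfam_def)

text \<open>The restrictions made by \<open>of_coords\<close> disappear, since only values on the
  index sets matter; the factor \<open>- 1\<close> puts the linear term in the form of
  \<open>has_hessian_at_cmult\<close>.\<close>

lemma bethe_of_coords:
  "bethe D \<theta> (of_coords D x) =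
     - 1 * (\<Sum>\<alpha>\<in>F. dot (KF \<alpha>) (\<theta> \<alpha>) (\<lambda>j. x (hcoord \<alpha> j)))
     + (\<Sum>\<alpha>\<in>F. legendre (hfam D \<alpha>) (\<lambda>j. x (hcoord \<alpha> j)))
     + (\<Sum>i\<in>V. (1 - real (deg F i)) * legendre (vfam D i) (\<lambda>k. x (VCoord i k)))"
proof -
  have c: "(case j of Extra k \<Rightarrow> x (HCoord \<alpha> k) | Vtx i k \<Rightarrow> x (VCoord i k)) = x (hcoord \<alpha> j)" for \<alpha> j
    by (cases j) auto
  have "dot (KF \<alpha>) (\<theta> \<alpha>) (fst (of_coords D x) \<alpha>) = dot (KF \<alpha>) (\<theta> \<alpha>) (\<lambda>j. x (hcoord \<alpha> j))"
    "legendre (hfam D \<alpha>) (fst (of_coords D x) \<alpha>) = legendre (hfam D \<alpha>) (\<lambda>j. x (hcoord \<alpha> j))"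
    if "\<alpha> \<in> F" for \<alpha>
    using that by (auto simp: of_coords_def c intro!: dot_cong regular_family.legendre_cong[OF regular_hfam])
  moreover have "legendre (vfam D i) (snd (of_coords D x) i) = legendre (vfam D i) (\<lambda>k. x (VCoord i k))"
    if "i \<in> V" for i
    using that by (auto simp: of_coords_def intro!: regular_family.legendre_cong[OF regular_vfam])
  ultimately show ?thesis
    by (simp add: bethe_def)
qed

definition bethe_hessian :: "'v coord \<Rightarrow> 'v coord \<Rightarrow> real" where
  "bethe_hessian c d =
     (\<Sum>\<alpha>\<in>F. \<Sum>i\<in>KF \<alpha>. \<Sum>j\<in>KF \<alpha>. if hcoord \<alpha> i = c \<and> hcoord \<alpha> j = d then invF \<alpha> j i else 0)
     + (\<Sum>i\<in>V. (1 - real (deg F i)) *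
         (\<Sum>k<r i. \<Sum>l<r i. if VCoord i k = c \<and> VCoord i l = d then invV i l k else 0))"

lemma hessian_bethe:
  assumes "c \<in> C" "d \<in> C"
  shows "hessian (\<lambda>x. bethe D \<theta> (of_coords D x)) x0 c d = bethe_hessian c d"
proof (rule hessian_eq[OF _ assms])
  have 1: "has_hessian_at C (\<lambda>x. legendre (hfam D \<alpha>) (\<lambda>j. x (hcoord \<alpha> j))) x0
      (\<lambda>c d. \<Sum>i\<in>KF \<alpha>. \<Sum>j\<in>KF \<alpha>. if hcoord \<alpha> i = c \<and> hcoord \<alpha> j = d then invF \<alpha> j i else 0)"
    if \<alpha>: "\<alpha> \<in> F" for \<alpha>
    using regular_family.legendre_has_hessian[OF regular_hfam[OF \<alpha>] inj_hcoord _ bF_nat_param(1)[OF \<alpha>], of C]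
      hcoord_in_C[OF \<alpha>]
    unfolding bF_nat_param(2)[OF \<alpha>, symmetric] by blast
  have 2: "has_hessian_at C (\<lambda>x. legendre (vfam D i) (\<lambda>k. x (VCoord i k))) x0
      (\<lambda>c d. \<Sum>k<r i. \<Sum>l<r i. if VCoord i k = c \<and> VCoord i l = d then invV i l k else 0)"
    if i: "i \<in> V" for i
  proof -
    have "inj_on (VCoord i) (index (vfam D i))" "VCoord i ` index (vfam D i) \<subseteq> C"
      using i by (auto simp: inj_on_def coord_index_def)
    from regular_family.legendre_has_hessian[OF regular_vfam[OF i] this bV_nat_param(1)[OF i]]
    show ?thesis
      unfolding bV_nat_param(2)[OF i, symmetric] index_vfam .
  qed
  have "has_hessian_at C (\<lambda>x. bethe D \<theta> (of_coords D x)) x0 (\<lambda>c d. - 1 * (\<Sum>\<alpha>\<in>F. 0)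
     + (\<Sum>\<alpha>\<in>F. \<Sum>i\<in>KF \<alpha>. \<Sum>j\<in>KF \<alpha>. if hcoord \<alpha> i = c \<and> hcoord \<alpha> j = d then invF \<alpha> j i else 0)
     + (\<Sum>i\<in>V. (1 - real (deg F i)) *
         (\<Sum>k<r i. \<Sum>l<r i. if VCoord i k = c \<and> VCoord i l = d then invV i l k else 0)))"
    unfolding bethe_of_coords
    by (intro has_hessian_at_add has_hessian_at_sum has_hessian_at_cmult has_hessian_at_dot 1 2)
  then show "has_hessian_at C (\<lambda>x. bethe D \<theta> (of_coords D x)) x0 bethe_hessian"
    by (simp add: bethe_hessian_def[abs_def])
qed

section \<open>Matrices on the components of the hyperedges\<close>

abbreviation "A \<equiv> SIGMA \<alpha>:F. KF \<alpha>"

definition \<pi> :: "'v set \<times> 'v hindex \<Rightarrow> 'v coord" where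
  "\<pi> a = hcoord (fst a) (snd a)"

definition hblock :: "('v set \<Rightarrow> 'v hindex \<Rightarrow> 'v hindex \<Rightarrow> real) \<Rightarrow>
    'v set \<times> 'v hindex \<Rightarrow> 'v set \<times> 'v hindex \<Rightarrow> real" where
  "hblock B a b = (if fst a = fst b then B (fst a) (snd a) (snd b) else 0)"

abbreviation "coord_var \<equiv> vblock VarV"

text \<open>The column \<open>Vtx q l\<close> of \<open>T^-1 S - I\<close> in the block of \<alpha>,
  as \<open>coord_var_weight\<close> confirms. On \<open>Extra\<close> rows \<open>T\<close> is the
  identity, so the covariance itself stands there.\<close>

fun weight :: "'v set \<Rightarrow> 'v hindex \<Rightarrow> 'v \<Rightarrow> nat \<Rightarrow> real" where
  "weight \<alpha> (Extra k) q l = VarF \<alpha> (Extra k) (Vtx q l)"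
| "weight \<alpha> (Vtx p k) q l = (if p = q then 0 else bethe_weight D bF bV \<alpha> q p k l)"

text \<open>The matrix of \<open>I - \<M>\<close>, enlarged by rows and columns for the additional statistics; the
  enlarged columns are unit vectors.\<close>

definition ext_edge_mat :: "'v set \<times> 'v hindex \<Rightarrow> 'v set \<times> 'v hindex \<Rightarrow> real" where
  "ext_edge_mat a b = (if a = b then 1 else 0) - (case snd b of Extra _ \<Rightarrow> 0 | Vtx q l \<Rightarrow>
     if fst a \<noteq> fst b \<and> q \<in> fst a then weight (fst a) (snd a) q l else 0)"

lemma finite_A: "finite A"
  using finite_hedges by auto

lemma fdet_hblock: "fdet A (hblock B) = (\<Prod>\<alpha>\<in>F. fdet (KF \<alpha>) (B \<alpha>))"
proof -
  have "fdet A (hblock B) = (\<Prod>\<alpha>\<in>F. fdet {a \<in> A. fst a = \<alpha>} (hblock B))"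
    by (rule fdet_block_diagonal) (use finite_hedges in \<open>auto simp: hblock_def\<close>)
  also have "\<dots> = (\<Prod>\<alpha>\<in>F. fdet (KF \<alpha>) (B \<alpha>))"
  proof (rule prod.cong[OF refl])
    fix \<alpha> assume \<alpha>: "\<alpha> \<in> F"
    then have "{a \<in> A. fst a = \<alpha>} = Pair \<alpha> ` KF \<alpha>"
      by auto
    then show "fdet {a \<in> A. fst a = \<alpha>} (hblock B) = fdet (KF \<alpha>) (B \<alpha>)"
      using \<alpha> by (simp add: fdet_image inj_on_def hblock_def)
  qed
  finally show ?thesis .
qed

lemma sum_A: "(\<Sum>a\<in>A. f a) = (\<Sum>\<alpha>\<in>F. \<Sum>j\<in>KF \<alpha>. f (\<alpha>, j))"
  using finite_hedges by (simp add: sum.Sigma)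

lemma sum_hblock:
  assumes "\<alpha> \<in> F"
  shows "(\<Sum>m\<in>A. hblock B (\<alpha>, j) m * f m) = (\<Sum>j'\<in>KF \<alpha>. B \<alpha> j j' * f (\<alpha>, j'))"
proof -
  have "(\<Sum>m\<in>A. hblock B (\<alpha>, j) m * f m) =
      (\<Sum>\<beta>\<in>F. if \<alpha> = \<beta> then \<Sum>j'\<in>KF \<alpha>. B \<alpha> j j' * f (\<alpha>, j') else 0)"
    unfolding sum_A by (intro sum.cong) (auto simp: hblock_def)
  then show ?thesis
    using assms finite_hedges by simp
qed

lemma sum_KF_Vtx:
  assumes "\<alpha> \<in> F" "p \<in> \<alpha>" "\<And>j. j \<in> KF \<alpha> \<Longrightarrow> (\<And>k. j \<noteq> Vtx p k) \<Longrightarrow> f j = 0"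
  shows "(\<Sum>j\<in>KF \<alpha>. f j) = (\<Sum>k<r p. f (Vtx p k))"
proof -
  have "(\<Sum>j\<in>KF \<alpha>. f j) = (\<Sum>j\<in>Vtx p ` {..<r p}. f j)"
  proof (rule sum.mono_neutral_right)
    show "\<forall>j\<in>KF \<alpha> - Vtx p ` {..<r p}. f j = 0"
    proof
      fix j assume j: "j \<in> KF \<alpha> - Vtx p ` {..<r p}"
      then have "j \<noteq> Vtx p k" for k
        by auto
      with j show "f j = 0"
        by (intro assms(3)) auto
    qed
  qed (use assms(1,2) in auto)
  then show ?thesis
    by (simp add: sum.reindex inj_on_def)
qed

text \<open>An \<open>Extra\<close> row of \<open>T\<close> is a unit vector; for a vertex
  \<open>p\<close> other than \<open>q\<close>, \<open>VarV p\<close> cancels the inverse in the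
  weight; for \<open>p = q\<close> the weight is 0 and the right side vanishes by
  \<open>marginal_Var\<close>.\<close>

lemma coord_var_weight:
  assumes "\<alpha> \<in> F" "j \<in> KF \<alpha>" "q \<in> \<alpha>" "l < r q"
  shows "(\<Sum>j'\<in>KF \<alpha>. coord_var (hcoord \<alpha> j) (hcoord \<alpha> j') * weight \<alpha> j' q l) =
    VarF \<alpha> j (Vtx q l) - coord_var (hcoord \<alpha> j) (VCoord q l)"
proof (cases j)
  case (Extra k)
  have "(\<Sum>j'\<in>KF \<alpha>. coord_var (hcoord \<alpha> j) (hcoord \<alpha> j') * weight \<alpha> j' q l) =
      (\<Sum>j'\<in>KF \<alpha>. if j' = Extra k then VarF \<alpha> (Extra k) (Vtx q l) else 0)"
  proof (rule sum.cong[OF refl])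
    fix j' assume "j' \<in> KF \<alpha>"
    show "coord_var (hcoord \<alpha> j) (hcoord \<alpha> j') * weight \<alpha> j' q l =
        (if j' = Extra k then VarF \<alpha> (Extra k) (Vtx q l) else 0)"
      by (cases j') (auto simp: Extra)
  qed
  then show ?thesis
    using assms Extra by simp
next
  case (Vtx p k)
  have p: "p \<in> \<alpha>" "k < r p" "p \<in> V"
    using assms Vtx hedge_subset by auto
  have "(\<Sum>j'\<in>KF \<alpha>. coord_var (hcoord \<alpha> j) (hcoord \<alpha> j') * weight \<alpha> j' q l) =
      (\<Sum>k'<r p. coord_var (hcoord \<alpha> j) (hcoord \<alpha> (Vtx p k')) * weight \<alpha> (Vtx p k') q l)"
  proof (rule sum_KF_Vtx[OF assms(1) p(1)])
    fix j' assume "\<And>k. j' \<noteq> Vtx p k"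
    then show "coord_var (hcoord \<alpha> j) (hcoord \<alpha> j') * weight \<alpha> j' q l = 0"
      by (cases j') (auto simp: Vtx)
  qed
  also have "\<dots> = VarF \<alpha> j (Vtx q l) - coord_var (hcoord \<alpha> j) (VCoord q l)"
  proof (cases "p = q")
    case True
    then show ?thesis
      using marginal_Var[OF assms(1) p(1,2), of l] assms(4) by (simp add: Vtx)
  next
    case False
    have "(\<Sum>k'<r p. VarV p k k' * bethe_weight D bF bV \<alpha> q p k' l) =
        (\<Sum>m<r p. (\<Sum>k'<r p. VarV p k k' * invV p k' m) * VarF \<alpha> (Vtx p m) (Vtx q l))"
      unfolding bethe_weight_def VarF_Vtx
      by (simp add: sum_distrib_left sum_distrib_right mult.assoc) (rule sum.swap)
    also have "\<dots> = (\<Sum>m<r p. if k = m then VarF \<alpha> (Vtx p m) (Vtx q l) else 0)"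
      using p fdet_VarV_nonzero[OF p(3)]
      by (intro sum.cong refl) (simp add: fmat_inv_right)
    finally show ?thesis
      using False p(2) by (simp add: Vtx)
  qed
  finally show ?thesis .
qed

text \<open>An additional coordinate occurs in exactly one hyperedge and so counts as degree 1,
  which removes it from the term with \<open>1 - d\<close>.\<close>

lemma card_fibre:
  assumes "c \<in> C"
  shows "card {a \<in> A. \<pi> a = c} = (case c of HCoord _ _ \<Rightarrow> 1 | VCoord i _ \<Rightarrow> deg F i)"
proof (cases c)
  case (HCoord \<alpha> k)
  have "{a \<in> A. \<pi> a = c} = {(\<alpha>, Extra k)}"
  proof (intro equalityI subsetI)
    fix a assume "a \<in> {a \<in> A. \<pi> a = c}"
    then show "a \<in> {(\<alpha>, Extra k)}"
      by (cases a; cases "snd a") (auto simp: \<pi>_def HCoord)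
  qed (use assms HCoord in \<open>auto simp: \<pi>_def coord_index_def\<close>)
  then show ?thesis
    by (simp add: HCoord)
next
  case (VCoord i k)
  have "{a \<in> A. \<pi> a = c} = (\<lambda>\<alpha>. (\<alpha>, Vtx i k)) ` {\<alpha> \<in> F. i \<in> \<alpha>}"
  proof (intro equalityI subsetI)
    fix a assume "a \<in> {a \<in> A. \<pi> a = c}"
    then show "a \<in> (\<lambda>\<alpha>. (\<alpha>, Vtx i k)) ` {\<alpha> \<in> F. i \<in> \<alpha>}"
      by (cases a; cases "snd a") (auto simp: \<pi>_def VCoord)
  qed (use assms VCoord in \<open>auto simp: \<pi>_def coord_index_def\<close>)
  then show ?thesis
    by (simp add: VCoord card_image inj_on_def deg_def)
qed

lemma bethe_hessian_eq:
  assumes "c \<in> C" "e \<in> C"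
  shows "bethe_hessian c e =
    (1 - of_nat (card {a \<in> A. \<pi> a = c})) * vblock (\<lambda>i k l. invV i l k) c e +
    (\<Sum>a\<in>A. \<Sum>b\<in>A. if \<pi> a = c \<and> \<pi> b = e then hblock (\<lambda>\<alpha> j j'. invF \<alpha> j' j) a b else 0)"
proof -
  have "(\<Sum>i\<in>V. (1 - real (deg F i)) *
      (\<Sum>k<r i. \<Sum>l<r i. if VCoord i k = c \<and> VCoord i l = e then invV i l k else 0)) =
    (1 - of_nat (card {a \<in> A. \<pi> a = c})) * vblock (\<lambda>i k l. invV i l k) c e"
  proof (cases c)
    \<comment> \<open>Both sides are 0: no \<open>VCoord\<close> equals \<open>c\<close>, and the
      fibre has one element.\<close>
    case (HCoord \<alpha> k)
    then show ?thesis
      using card_fibre[OF assms(1)] by simp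
  next
    case (VCoord p k)
    have p: "p \<in> V" "k < r p"
      using assms(1) VCoord by (auto simp: coord_index_def)
    have inner: "(\<Sum>l<r p. if VCoord p k' = c \<and> VCoord p l = e then invV p l k' else 0) =
        (if k' = k then (\<Sum>l<r p. if VCoord p l = e then invV p l k else 0) else 0)" for k'
      by (cases "k' = k") (auto simp: VCoord)
    have "(\<Sum>i\<in>V. (1 - real (deg F i)) *
        (\<Sum>k<r i. \<Sum>l<r i. if VCoord i k = c \<and> VCoord i l = e then invV i l k else 0)) =
      (\<Sum>i\<in>V. if i = p then (1 - real (deg F p)) *
        (\<Sum>k'<r p. if k' = k then (\<Sum>l<r p. if VCoord p l = e then invV p l k else 0) else 0) else 0)"
    proof (rule sum.cong[OF refl])
      fix i
      show "(1 - real (deg F i)) *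
          (\<Sum>k<r i. \<Sum>l<r i. if VCoord i k = c \<and> VCoord i l = e then invV i l k else 0) =
        (if i = p then (1 - real (deg F p)) *
          (\<Sum>k'<r p. if k' = k then (\<Sum>l<r p. if VCoord p l = e then invV p l k else 0) else 0) else 0)"
      proof (cases "i = p")
        case True
        then show ?thesis
          by (simp only: inner refl if_True)
      next
        case False
        then show ?thesis
          by (simp add: VCoord)
      qed
    qed
    also have "\<dots> = (1 - real (deg F p)) * (\<Sum>l<r p. if VCoord p l = e then invV p l k else 0)"
      using p finite_verts by simp
    also have "(\<Sum>l<r p. if VCoord p l = e then invV p l k else 0) = vblock (\<lambda>i k l. invV i l k) c e"
      using assms(2) by (cases e) (auto simp: VCoord coord_index_def)
    finally show ?thesis
      using card_fibre[OF assms(1)] by (simp add: VCoord)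
  qed
  moreover have "(\<Sum>a\<in>A. \<Sum>b\<in>A. if \<pi> a = c \<and> \<pi> b = e then hblock (\<lambda>\<alpha> j j'. invF \<alpha> j' j) a b else 0) =
      (\<Sum>\<alpha>\<in>F. \<Sum>i\<in>KF \<alpha>. \<Sum>j\<in>KF \<alpha>. if hcoord \<alpha> i = c \<and> hcoord \<alpha> j = e then invF \<alpha> j i else 0)"
    unfolding sum_A
  proof (intro sum.cong refl)
    fix \<alpha> i assume \<alpha>: "\<alpha> \<in> F" "i \<in> KF \<alpha>"
    have "(\<Sum>\<beta>\<in>F. \<Sum>j\<in>KF \<beta>. if \<pi> (\<alpha>, i) = c \<and> \<pi> (\<beta>, j) = e
          then hblock (\<lambda>\<alpha> j j'. invF \<alpha> j' j) (\<alpha>, i) (\<beta>, j) else 0) =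
        (\<Sum>\<beta>\<in>F. if \<beta> = \<alpha> then \<Sum>j\<in>KF \<alpha>. if hcoord \<alpha> i = c \<and> hcoord \<alpha> j = e then invF \<alpha> j i else 0 else 0)"
    proof (rule sum.cong[OF refl])
      fix \<beta>
      show "(\<Sum>j\<in>KF \<beta>. if \<pi> (\<alpha>, i) = c \<and> \<pi> (\<beta>, j) = e
          then hblock (\<lambda>\<alpha> j j'. invF \<alpha> j' j) (\<alpha>, i) (\<beta>, j) else 0) =
        (if \<beta> = \<alpha> then \<Sum>j\<in>KF \<alpha>. if hcoord \<alpha> i = c \<and> hcoord \<alpha> j = e then invF \<alpha> j i else 0 else 0)"
        by (cases "\<beta> = \<alpha>") (simp_all add: \<pi>_def hblock_def cong: if_cong)
    qed
    then show "(\<Sum>\<beta>\<in>F. \<Sum>j\<in>KF \<beta>. if \<pi> (\<alpha>, i) = c \<and> \<pi> (\<beta>, j) = e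
          then hblock (\<lambda>\<alpha> j j'. invF \<alpha> j' j) (\<alpha>, i) (\<beta>, j) else 0) =
        (\<Sum>j\<in>KF \<alpha>. if hcoord \<alpha> i = c \<and> hcoord \<alpha> j = e then invF \<alpha> j i else 0)"
      using \<alpha> finite_hedges by simp
  qed
  ultimately show ?thesis
    unfolding bethe_hessian_def by simp
qed

lemma fdet_edge_hessian:
  "fdet A (hblock (\<lambda>\<alpha> j j'. coord_var (hcoord \<alpha> j) (hcoord \<alpha> j'))) * fdet A ext_edge_mat =
   fdet A (hblock VarF) * fdet C bethe_hessian * fdet C coord_var"
proof (rule fdet_edge_vertex_identity[OF finite_A finite_C, of \<pi>, where
      Si = "hblock (\<lambda>\<alpha> j j'. invF \<alpha> j' j)" and Ri = "vblock (\<lambda>i k l. invV i l k)"])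
  let ?T = "hblock (\<lambda>\<alpha> j j'. coord_var (hcoord \<alpha> j) (hcoord \<alpha> j'))"
  show "\<pi> a \<in> C" if "a \<in> A" for a
    using that hcoord_in_C by (auto simp: \<pi>_def)
  show "(\<Sum>m\<in>A. hblock VarF a m * hblock (\<lambda>\<alpha> j j'. invF \<alpha> j' j) m b) = (if a = b then 1 else 0)"
    if "a \<in> A" "b \<in> A" for a b
  proof -
    obtain \<alpha> i \<beta> j where ab: "a = (\<alpha>, i)" "\<alpha> \<in> F" "i \<in> KF \<alpha>" "b = (\<beta>, j)" "\<beta> \<in> F" "j \<in> KF \<beta>"
      using \<open>a \<in> A\<close> \<open>b \<in> A\<close> by auto
    have "(\<Sum>m\<in>KF \<alpha>. VarF \<alpha> i m * invF \<alpha> j m) = (if i = j then 1 else 0)" if "j \<in> KF \<alpha>"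
    proof -
      \<comment> \<open>The Hessian carries the transposed inverse; symmetry of the covariance makes
        it a right inverse.\<close>
      have "(\<Sum>m\<in>KF \<alpha>. VarF \<alpha> i m * invF \<alpha> j m) = (\<Sum>m\<in>KF \<alpha>. invF \<alpha> j m * VarF \<alpha> m i)"
        using pos_def_VarF[OF ab(2)] ab(3)
        by (intro sum.cong refl) (simp add: pos_def_def mult.commute)
      also have "\<dots> = (if i = j then 1 else 0)"
        using fmat_inv_left[OF finite_KF[OF ab(2)] fdet_VarF_nonzero[OF ab(2)] that ab(3)] by auto
      finally show ?thesis .
    qed
    then show ?thesis
      unfolding ab(1,4) sum_hblock[OF ab(2)] using ab(6)
      by (cases "\<alpha> = \<beta>") (auto simp: hblock_def)
  qed
  show "(\<Sum>m\<in>C. vblock (\<lambda>i k l. invV i l k) c m * coord_var m e) = (if c = e then 1 else 0)"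
    if "c \<in> C" "e \<in> C" for c e
  proof (cases c)
    case (HCoord \<alpha> k)
    have "(\<Sum>m\<in>C. vblock (\<lambda>i k l. invV i l k) c m * coord_var m e) = (\<Sum>m\<in>C. if m = c then coord_var c e else 0)"
    proof (rule sum.cong[OF refl])
      fix m show "vblock (\<lambda>i k l. invV i l k) c m * coord_var m e = (if m = c then coord_var c e else 0)"
        by (cases m) (auto simp: HCoord)
    qed
    also have "\<dots> = coord_var c e"
      using \<open>c \<in> C\<close> finite_C by simp
    finally show ?thesis
      by (cases e) (auto simp: HCoord)
  next
    case (VCoord p k)
    then have p: "p \<in> V" "k < r p"
      using \<open>c \<in> C\<close> by (auto simp: coord_index_def)
    have "(\<Sum>m\<in>C. vblock (\<lambda>i k l. invV i l k) c m * coord_var m e) =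
        (\<Sum>m\<in>VCoord p ` {..<r p}. vblock (\<lambda>i k l. invV i l k) c m * coord_var m e)"
    proof (rule sum.mono_neutral_right[OF finite_C])
      show "VCoord p ` {..<r p} \<subseteq> C"
        using p by (auto simp: coord_index_def)
      show "\<forall>m\<in>C - VCoord p ` {..<r p}. vblock (\<lambda>i k l. invV i l k) c m * coord_var m e = 0"
      proof
        fix m assume "m \<in> C - VCoord p ` {..<r p}"
        then show "vblock (\<lambda>i k l. invV i l k) c m * coord_var m e = 0"
          by (cases m) (auto simp: VCoord coord_index_def)
      qed
    qed
    also have "\<dots> = (\<Sum>l<r p. invV p l k * coord_var (VCoord p l) e)"
      by (simp add: sum.reindex inj_on_def VCoord)
    also have "\<dots> = (if c = e then 1 else 0)"
    proof (cases "\<exists>l. e = VCoord p l")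
      case True
      then obtain l where l: "e = VCoord p l" "l < r p"
        using \<open>e \<in> C\<close> by (auto simp: coord_index_def)
      have "(\<Sum>m<r p. invV p m k * VarV p m l) = (\<Sum>m<r p. VarV p l m * invV p m k)"
        using pos_def_VarV[OF p(1)] l(2)
        by (intro sum.cong refl) (simp add: pos_def_def mult.commute)
      also have "\<dots> = (if l = k then 1 else 0)"
        using fmat_inv_right[OF _ fdet_VarV_nonzero[OF p(1)]] p(2) l(2) by simp
      finally show ?thesis
        by (auto simp: l(1) VCoord)
    next
      case False
      then have "coord_var (VCoord p l) e = 0" for l
        by (cases e) auto
      then show ?thesis
        using False VCoord by auto
    qed
    finally show ?thesis .
  qed
  \<comment> \<open>\<open>T Q = Q R\<close>: in the row of a component of \<alpha>, a nonzero entry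
    of \<open>R\<close> lies in a column of the same vertex or the same additional coordinate, hence
    again in a coordinate of \<alpha>.\<close>
  show "(\<Sum>b\<in>A. if \<pi> b = c then ?T a b else 0) = coord_var (\<pi> a) c" if "a \<in> A" "c \<in> C" for a c
  proof -
    obtain \<alpha> i where a: "a = (\<alpha>, i)" "\<alpha> \<in> F" "i \<in> KF \<alpha>"
      using \<open>a \<in> A\<close> by auto
    have "(\<Sum>b\<in>A. if \<pi> b = c then ?T a b else 0) = (\<Sum>b\<in>A. ?T a b * (if \<pi> b = c then 1 else 0))"
      by (intro sum.cong) auto
    also have "\<dots> = (\<Sum>j\<in>KF \<alpha>. if hcoord \<alpha> j = c then coord_var (hcoord \<alpha> i) c else 0)"
      unfolding a(1) sum_hblock[OF a(2)] by (intro sum.cong) (auto simp: \<pi>_def)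
    also have "\<dots> = coord_var (\<pi> a) c"
    proof (cases "c \<in> hcoord \<alpha> ` KF \<alpha>")
      case True
      then obtain j where j: "j \<in> KF \<alpha>" "c = hcoord \<alpha> j" by blast
      have "(\<Sum>j\<in>KF \<alpha>. if hcoord \<alpha> j = c then coord_var (hcoord \<alpha> i) c else 0) =
          (\<Sum>j'\<in>KF \<alpha>. if j' = j then coord_var (hcoord \<alpha> i) c else 0)"
        using j inj_hcoord[of \<alpha> UNIV] by (intro sum.cong refl) (simp add: inj_eq)
      then show ?thesis
        using j a(2) by (simp add: a(1) \<pi>_def)
    next
      case False
      have "coord_var (hcoord \<alpha> i) c = 0"
      proof (rule ccontr)
        assume "coord_var (hcoord \<alpha> i) c \<noteq> 0"
        then have "c \<in> hcoord \<alpha> ` KF \<alpha>"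
          using a(3) \<open>c \<in> C\<close>
          by (cases i; cases c)
            (auto simp: coord_index_def split: if_splits
              intro: image_eqI[where x = "Vtx _ _"] image_eqI[where x = "Extra _"])
        with False show False by blast
      qed
      then show ?thesis
        by (simp add: a(1) \<pi>_def cong: if_cong)
    qed
    finally show ?thesis .
  qed
  show "(\<Sum>m\<in>A. ?T a m * ext_edge_mat m b) =
      ?T a b - (\<Sum>m\<in>A. if \<pi> m = \<pi> b \<and> m \<noteq> b then hblock VarF a m - ?T a m else 0)"
    if "a \<in> A" "b \<in> A" for a b
  proof -
    obtain \<alpha> i \<beta> j where ab: "a = (\<alpha>, i)" "\<alpha> \<in> F" "i \<in> KF \<alpha>" "b = (\<beta>, j)" "\<beta> \<in> F" "j \<in> KF \<beta>"
      using \<open>a \<in> A\<close> \<open>b \<in> A\<close> by auto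
    \<comment> \<open>\<open>N\<close> is the part of column \<open>b\<close> that comes from the
      weights, so the goal becomes that \<open>T N\<close> is the column of
      \<open>(S - T) (Q Q^T - 1)\<close>.\<close>
    define N where "N m = (case j of Extra _ \<Rightarrow> 0 | Vtx q l \<Rightarrow>
      if fst m \<noteq> \<beta> \<and> q \<in> fst m then weight (fst m) (snd m) q l else 0)" for m
    have W: "ext_edge_mat m b = (if m = b then 1 else 0) - N m" for m
      by (simp add: ext_edge_mat_def N_def ab(4) split: hindex.split)
    have "(\<Sum>m\<in>A. ?T a m * ext_edge_mat m b) = (\<Sum>m\<in>A. (if m = b then ?T a b else 0) - ?T a m * N m)"
      unfolding W right_diff_distrib by (intro sum.cong) auto
    also have "\<dots> = ?T a b - (\<Sum>m\<in>A. ?T a m * N m)"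
      using \<open>b \<in> A\<close> finite_A by (simp add: sum_subtractf)
    also have "(\<Sum>m\<in>A. ?T a m * N m) =
        (\<Sum>m\<in>A. if \<pi> m = \<pi> b \<and> m \<noteq> b then hblock VarF a m - ?T a m else 0)"
    proof (cases j)
      case (Extra k)
      \<comment> \<open>Only \<open>b\<close> lies over an additional coordinate, so both sums
        vanish.\<close>
      have "m = b" if "m \<in> A" "\<pi> m = \<pi> b" for m
        using that by (cases m; cases "snd m") (auto simp: \<pi>_def ab(4) Extra)
      then have "(\<Sum>m\<in>A. if \<pi> m = \<pi> b \<and> m \<noteq> b then hblock VarF a m - ?T a m else 0) = 0"
        by (intro sum.neutral) auto
      then show ?thesis
        by (simp add: N_def Extra)
    next
      case (Vtx q l)
      have q: "q \<in> \<beta>" "l < r q"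
        using ab(6) Vtx by auto
      \<comment> \<open>On both sides only the copy of \<open>Vtx q l\<close> in \<alpha> matters:
        it exists iff \<open>q\<close> is in \<alpha>, and it differs from \<open>b\<close> iff
        \<alpha> and \<beta> differ.\<close>
      let ?c = "\<alpha> \<noteq> \<beta> \<and> q \<in> \<alpha>"
      have "(\<Sum>m\<in>A. ?T a m * N m) =
          (if ?c then VarF \<alpha> i (Vtx q l) - coord_var (hcoord \<alpha> i) (VCoord q l) else 0)"
        unfolding ab(1) sum_hblock[OF ab(2)] using coord_var_weight[OF ab(2,3) _ q(2)]
        by (auto simp: N_def Vtx)
      moreover have "(\<Sum>m\<in>A. if \<pi> m = \<pi> b \<and> m \<noteq> b then hblock VarF a m - ?T a m else 0) =
          (\<Sum>m\<in>A. if m = (\<alpha>, Vtx q l) then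
            (if \<alpha> \<noteq> \<beta> then VarF \<alpha> i (Vtx q l) - coord_var (hcoord \<alpha> i) (VCoord q l) else 0) else 0)"
      proof (rule sum.cong[OF refl])
        fix m assume "m \<in> A"
        show "(if \<pi> m = \<pi> b \<and> m \<noteq> b then hblock VarF a m - ?T a m else 0) =
          (if m = (\<alpha>, Vtx q l) then
            (if \<alpha> \<noteq> \<beta> then VarF \<alpha> i (Vtx q l) - coord_var (hcoord \<alpha> i) (VCoord q l) else 0) else 0)"
          by (cases m; cases "snd m") (auto simp: \<pi>_def ab(1,4) Vtx hblock_def)
      qed
      ultimately show ?thesis
        using finite_A ab(2) q(2) by simp
    qed
    finally show ?thesis .
  qed
  show "bethe_hessian c e =
    (1 - of_nat (card {a \<in> A. \<pi> a = c})) * vblock (\<lambda>i k l. invV i l k) c e +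
    (\<Sum>a\<in>A. \<Sum>b\<in>A. if \<pi> a = c \<and> \<pi> b = e then hblock (\<lambda>\<alpha> j j'. invF \<alpha> j' j) a b else 0)"
    if "c \<in> C" "e \<in> C" for c e
    by (rule bethe_hessian_eq[OF that])
qed

section \<open>Evaluation of the determinants\<close>

lemma fdet_coord_var: "fdet C coord_var = (\<Prod>i\<in>V. fdet {..<r i} (VarV i))"
  unfolding coord_index_eq using finite_hedges finite_verts by (intro fdet_vblock) auto

lemma fdet_coord_var_hedge:
  assumes "\<alpha> \<in> F"
  shows "fdet (KF \<alpha>) (\<lambda>j j'. coord_var (hcoord \<alpha> j) (hcoord \<alpha> j')) = (\<Prod>i\<in>\<alpha>. fdet {..<r i} (VarV i))"
proof -
  have "hcoord \<alpha> ` KF \<alpha> = HCoord \<alpha> ` {..<hdim D \<alpha>} \<union> {VCoord i k |i k. i \<in> \<alpha> \<and> k < r i}"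
    unfolding KF_eq image_Un by (force simp: image_image)
  then have "fdet (hcoord \<alpha> ` KF \<alpha>) coord_var = (\<Prod>i\<in>\<alpha>. fdet {..<r i} (VarV i))"
    using finite_hedge[OF assms] by (simp, intro fdet_vblock) auto
  then show ?thesis
    using assms by (simp add: fdet_image inj_hcoord)
qed

text \<open>This is \<open>det T\<close>: a vertex contributes one factor for each hyperedge
  containing it.\<close>

lemma prod_fdet_coord_var:
  "(\<Prod>\<alpha>\<in>F. fdet (KF \<alpha>) (\<lambda>j j'. coord_var (hcoord \<alpha> j) (hcoord \<alpha> j'))) =
    (\<Prod>i\<in>V. fdet {..<r i} (VarV i) ^ deg F i)"
proof -
  let ?x = "\<lambda>i. fdet {..<r i} (VarV i)"
  have "(\<Prod>\<alpha>\<in>F. fdet (KF \<alpha>) (\<lambda>j j'. coord_var (hcoord \<alpha> j) (hcoord \<alpha> j'))) = (\<Prod>\<alpha>\<in>F. \<Prod>i\<in>\<alpha>. ?x i)"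
    by (intro prod.cong refl fdet_coord_var_hedge)
  also have "\<dots> = (\<Prod>\<alpha>\<in>F. \<Prod>i\<in>V. if i \<in> \<alpha> then ?x i else 1)"
  proof (rule prod.cong[OF refl])
    fix \<alpha> assume "\<alpha> \<in> F"
    then have "V \<inter> \<alpha> = \<alpha>"
      using hedge_subset by blast
    then show "(\<Prod>i\<in>\<alpha>. ?x i) = (\<Prod>i\<in>V. if i \<in> \<alpha> then ?x i else 1)"
      using prod.inter_restrict[OF finite_verts, of ?x \<alpha>] by simp
  qed
  also have "\<dots> = (\<Prod>i\<in>V. \<Prod>\<alpha>\<in>F. if i \<in> \<alpha> then ?x i else 1)"
    by (rule prod.swap)
  also have "\<dots> = (\<Prod>i\<in>V. ?x i ^ deg F i)"
  proof (rule prod.cong[OF refl])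
    fix i
    have "(\<Prod>\<alpha>\<in>F. if i \<in> \<alpha> then ?x i else 1) = (\<Prod>\<alpha>\<in>{\<alpha> \<in> F. i \<in> \<alpha>}. ?x i)"
      by (rule prod.inter_filter[OF finite_hedges, symmetric])
    then show "(\<Prod>\<alpha>\<in>F. if i \<in> \<alpha> then ?x i else 1) = ?x i ^ deg F i"
      by (simp add: deg_def)
  qed
  finally show ?thesis .
qed

text \<open>The unit columns of the additional statistics make the matrix block lower triangular
  with an identity block, so only the directed edges remain.\<close>

lemma fdet_ext_edge_mat:
  "fdet A ext_edge_mat = fdet (dedge_index F r) (\<lambda>p q. ext_edge_mat (fst (fst p), Vtx (snd (fst p)) (snd p))
     (fst (fst q), Vtx (snd (fst q)) (snd q)))"
proof -
  let ?h = "\<lambda>p. (fst (fst p), Vtx (snd (fst p)) (snd p))"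
  let ?L = "(SIGMA \<alpha>:F. Extra ` {..<hdim D \<alpha>}) :: ('v set \<times> 'v hindex) set"
  have A: "A = ?h ` dedge_index F r \<union> ?L"
  proof (intro equalityI subsetI)
    fix a assume "a \<in> A"
    then show "a \<in> ?h ` dedge_index F r \<union> ?L"
      by (cases a; cases "snd a")
        (auto simp: dedge_index_def dedges_def intro!: image_eqI[where x = "((fst a, _), _)"])
  qed (auto simp: dedge_index_def dedges_def)
  have fin: "finite (?h ` dedge_index F r)" "finite ?L"
    using finite_A unfolding A by simp_all
  have inj: "inj_on ?h (dedge_index F r)"
    by (auto simp: inj_on_def)
  have "fdet A ext_edge_mat = fdet (?h ` dedge_index F r) ext_edge_mat * fdet ?L ext_edge_mat"
    unfolding A by (rule fdet_block_lower[OF fin]) (auto simp: ext_edge_mat_def)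
  also have "fdet ?L ext_edge_mat = 1"
    by (rule fdet_identity[OF fin(2)]) (auto simp: ext_edge_mat_def)
  also have "fdet (?h ` dedge_index F r) ext_edge_mat = fdet (dedge_index F r) (\<lambda>p q. ext_edge_mat (?h p) (?h q))"
    using finite_imageD[OF fin(1) inj] inj by (rule fdet_image)
  finally show ?thesis by simp
qed

text \<open>Applied to a unit vector, \<M> leaves at most one summand, present exactly when the two
  edges are consecutive; its weight then joins distinct vertices of one hyperedge, where
  \<open>u\<close> is prescribed.\<close>

lemma op_det_edge:
  assumes u: "\<And>\<alpha> i j k l. \<alpha> \<in> F \<Longrightarrow> i \<in> \<alpha> \<Longrightarrow> j \<in> \<alpha> \<Longrightarrow> i \<noteq> j \<Longrightarrow> k < r j \<Longrightarrow> l < r i \<Longrightarrow>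
     u \<alpha> i j k l = complex_of_real (bethe_weight D bF bV \<alpha> i j k l)"
  shows "op_det (dedge_index F r) (\<lambda>f p. f p - \<M> F r u f p) = complex_of_real (fdet A ext_edge_mat)"
  unfolding op_det_def fdet_ext_edge_mat fdet_of_real[symmetric]
proof (rule fdet_cong[OF refl])
  fix p q assume "p \<in> dedge_index F r" "q \<in> dedge_index F r"
  then obtain \<alpha> i k \<beta> j l where p: "p = ((\<alpha>, i), k)" "\<alpha> \<in> F" "i \<in> \<alpha>" "k < r i"
      and q: "q = ((\<beta>, j), l)" "\<beta> \<in> F" "j \<in> \<beta>" "l < r j"
    by (auto simp: dedge_index_def dedges_def)
  let ?S = "{e'. e' \<in> dedges F \<and> e' \<rightharpoonup> (\<alpha>, i)}"
  have "dedges F \<subseteq> F \<times> V"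
    by (auto simp: dedges_def dest: subsetD[OF hedge_subset])
  then have fin: "finite ?S"
    using finite_hedges finite_verts by (auto intro: finite_subset[of _ "F \<times> V"])
  have "\<M> F r u (\<lambda>m. if m = q then 1 else 0) p =
      (\<Sum>e'\<in>?S. if e' = (\<beta>, j) then (\<Sum>l'<r j. if l' = l then u \<alpha> j i k l else 0) else 0)"
    unfolding \<M>_def p(1) q(1) prod.case
  proof (rule sum.cong[OF refl])
    fix e'
    show "(\<Sum>l'<r (tgt e'). u (src (\<alpha>, i)) (tgt e') (tgt (\<alpha>, i)) k l' *
          (if (e', l') = ((\<beta>, j), l) then 1 else 0)) =
        (if e' = (\<beta>, j) then (\<Sum>l'<r j. if l' = l then u \<alpha> j i k l else 0) else 0)"
      by (cases "e' = (\<beta>, j)") (auto simp: mult_indicator)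
  qed
  also have "\<dots> = (if (\<beta>, j) \<in> ?S then u \<alpha> j i k l else 0)"
    using fin q(4) by simp
  also have "(\<beta>, j) \<in> ?S \<longleftrightarrow> j \<in> \<alpha> \<and> j \<noteq> i \<and> \<beta> \<noteq> \<alpha>"
    using q by (auto simp: dedges_def follows_def)
  finally show "(if p = q then 1 else 0) - \<M> F r u (\<lambda>m. if m = q then 1 else 0) p =
      complex_of_real (ext_edge_mat (fst (fst p), Vtx (snd (fst p)) (snd p)) (fst (fst q), Vtx (snd (fst q)) (snd q)))"
    using u[OF p(2), of j i k l] p q by (auto simp: ext_edge_mat_def)
qed

end

theorem theorem4p1:
  fixes D :: "('v, 'x) inference_data"
    and \<theta> :: "'v set \<Rightarrow> 'v hindex \<Rightarrow> real"
    and \<eta> :: "'v lparam"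
    and bF :: "'v set \<Rightarrow> ('v \<Rightarrow> 'x) measure"
    and bV :: "'v \<Rightarrow> 'x measure"
    and u :: "'v set \<Rightarrow> 'v \<Rightarrow> 'v \<Rightarrow> nat \<Rightarrow> nat \<Rightarrow> complex"
  assumes "inference_family D"
    and "\<eta> \<in> local_params D"
    and "pseudomarginals D \<eta> bF bV"
    and "\<And>\<alpha> i j k l. \<alpha> \<in> hedges D \<Longrightarrow> i \<in> \<alpha> \<Longrightarrow> j \<in> \<alpha> \<Longrightarrow> i \<noteq> j \<Longrightarrow>
           k < vdim D j \<Longrightarrow> l < vdim D i \<Longrightarrow>
           u \<alpha> i j k l = complex_of_real (bethe_weight D bF bV \<alpha> i j k l)"
  shows "op_det (dedge_index (hedges D) (vdim D)) (\<lambda>f p. f p - \<M> (hedges D) (vdim D) u f p) =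
    complex_of_real
      (fdet (coord_index D) (hessian (\<lambda>x. bethe D \<theta> (of_coords D x)) (to_coords \<eta>))
       * (\<Prod>\<alpha>\<in>hedges D. fdet (index (hfam D \<alpha>)) (Var (hfam D \<alpha>) (bF \<alpha>)))
       * (\<Prod>i\<in>verts D. fdet {..<vdim D i} (Var (vfam D i) (bV i))
            powi (1 - int (deg (hedges D) i))))"
proof -
  interpret bethe_point D \<eta> bF bV
    by unfold_locales fact+
  let ?x = "\<lambda>i. fdet {..<r i} (VarV i)"
  have H: "fdet C (hessian (\<lambda>x. bethe D \<theta> (of_coords D x)) x0) = fdet C bethe_hessian"
    by (rule fdet_cong[OF refl hessian_bethe])
  \<comment> \<open>\<open>?p\<close> is \<open>det T\<close>; it is nonzero and is cancelled at the
    end.\<close>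
  let ?p = "\<Prod>i\<in>V. ?x i ^ deg F i"
  have p0: "?p \<noteq> 0"
    using finite_verts fdet_VarV_nonzero by simp
  \<comment> \<open>The exponents \<open>d\<close> and \<open>1 - d\<close> add up to 1; splitting
    \<open>powi\<close> this way relies on a nonzero base.\<close>
  have "?p * (\<Prod>i\<in>V. ?x i powi (1 - int (deg F i))) = (\<Prod>i\<in>V. ?x i)"
    unfolding prod.distrib[symmetric]
  proof (rule prod.cong[OF refl])
    fix i assume "i \<in> V"
    then have "?x i powi (int (deg F i) + (1 - int (deg F i))) =
        ?x i powi int (deg F i) * ?x i powi (1 - int (deg F i))"
      by (intro power_int_add) (simp add: fdet_VarV_nonzero)
    then show "?x i ^ deg F i * ?x i powi (1 - int (deg F i)) = ?x i"
      by simp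
  qed
  moreover have "?p * fdet A ext_edge_mat =
      (\<Prod>\<alpha>\<in>F. fdet (KF \<alpha>) (VarF \<alpha>)) * fdet C bethe_hessian * (\<Prod>i\<in>V. ?x i)"
    using fdet_edge_hessian by (simp only: fdet_hblock prod_fdet_coord_var fdet_coord_var)
  ultimately have "?p * fdet A ext_edge_mat = ?p * (fdet C bethe_hessian * (\<Prod>\<alpha>\<in>F. fdet (KF \<alpha>) (VarF \<alpha>)) *
      (\<Prod>i\<in>V. ?x i powi (1 - int (deg F i))))"
    by (simp add: mult_ac)
  then have "fdet A ext_edge_mat = fdet C bethe_hessian * (\<Prod>\<alpha>\<in>F. fdet (KF \<alpha>) (VarF \<alpha>)) *
      (\<Prod>i\<in>V. ?x i powi (1 - int (deg F i)))"
    by (simp only: mult_left_cancel[OF p0])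
  moreover have "op_det (dedge_index F r) (\<lambda>f p. f p - \<M> F r u f p) = complex_of_real (fdet A ext_edge_mat)"
    by (rule op_det_edge) (rule assms(4))
  ultimately show ?thesis
    by (simp only: H)
qed

end
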